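(* Let $d\geq2$ and let $\mathbb{P}=\mathbb{P}^+_\beta$ be the plus phase of the Ising model on $\mathbb{Z}^d$ at inverse temperature $\beta$. There exists $\beta_0>\beta_c$ such that for all $\beta>\beta_0$ the following hold. (1) For all $p\in\mathbb{N}$ there exists a constant $C_p\in(0,\infty)$ such that for any local function $g:\Omega\to\mathbb{R}$, $$\mathbb{E}\left[(g-\mathbb{E}g)^{2p}\right]\leq C_p\,\|\delta g\|^{2p}_{\ell^2(\mathbb{Z}^d)},$$ and consequently, for all $t>0$, $$\mathbb{P}\left\{|g-\mathbb{E}g|>t\right\}\leq C_p\,\frac{\|\delta g\|^{2p}_{\ell^2(\mathbb{Z}^d)}}{t^{2p}}.$$ (2) There exists $0<\varrho(\beta)<1$ such that for any $0<\varrho<\varrho(\beta)$ there is a constant $K_\varrho>0$ such that for any local function $g:\Omega\to\mathbb{R}$, $$\|g-\mathbb{E}g\|_{\Phi_\varrho}\leq K_\varrho\,\|\delta g\|_{\ell^2(\mathbb{Z}^d)},$$ and consequently there exists a constant $c_\varrho\in(0,\infty)$ such that for any local function $g$ and all $t>0$, $$\mathbb{P}\left\{|g-\mathbb{E}g|>t\right\}\leq4\exp\left(-c_\varrho\,\frac{t^\varrho}{\|\delta g\|^\varrho_{\ell^2(\mathbb{Z}^d)}}\right).$$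
   Context: $\Omega=\{-,+\}^{\mathbb{Z}^d}$ (spins identified with $\pm1$). The plus phase $\mathbb{P}^+_\beta$ is the weak limit as $\Lambda\uparrow\mathbb{Z}^d$ of the finite-volume measures $$\mathbb{P}^+_{\Lambda,\beta}(\sigma_\Lambda)=\exp\Big(\beta\sum_{\langle xy\rangle\subset\Lambda}\sigma_x\sigma_y+\beta\sum_{\langle xy\rangle,\,x\in\Lambda,\,y\notin\Lambda}\sigma_x\Big)\Big/Z^+_{\Lambda,\beta},$$ where $\langle xy\rangle$ are nearest-neighbor bonds and $Z^+_{\Lambda,\beta}$ is the partition function; $\beta_c$ is the critical inverse temperature. $\mathbb{E}$ is expectation under $\mathbb{P}$. A function is local if it depends only on finitely many coordinates; $\delta_xg=\sup_\sigma|g(\sigma^x)-g(\sigma)|$ with $\sigma^x$ equal to $\sigma$ flipped at $x$; $\delta g=(\delta_xg)_x$; $\|\delta g\|^2_{\ell^2(\mathbb{Z}^d)}=\sum_x(\delta_xg)^2$. If $\delta g=0$ the exponential is read as $0$. Constants may depend on $\beta$ and $d$. Luxembourg norm: for $0<\varrho<1$ let $\Phi_\varrho(x)=e^{(|x|+h_\varrho)^\varrho}-e^{h_\varrho^\varrho}$, $x\in\mathbb{R}$, with $h_\varrho=((1-\varrho)/\varrho)^{1/\varrho}$; for a random variable $Z$, $\|Z\|_{\Phi_\varrho}=\inf\{\lambda>0:\mathbb{E}(\Phi_\varrho(Z/\lambda))\leq1\}$. *)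

theory Defs
  imports "HOL-Probability.Probability"
begin

text \<open>Spin configurations on the lattice; \<open>True\<close> is the spin \<open>+\<close> and \<open>False\<close> the spin \<open>-\<close>.
  The type \<open>bool\<close> carries the discrete topology, hence the type of configurations carries the
  product topology, and its Borel sets are the product \<open>\<sigma>\<close>-algebra.\<close>

type_synonym 'd config = "int ^ 'd \<Rightarrow> bool"

definition spin :: "bool \<Rightarrow> real" where
  "spin s = (if s then 1 else - 1)"

definition nearest_neighbour :: "int ^ 'd::finite \<Rightarrow> int ^ 'd \<Rightarrow> bool" where
  "nearest_neighbour x y \<longleftrightarrow> (\<Sum>i\<in>UNIV. \<bar>x $ i - y $ i\<bar>) = 1"

definition inner_bonds :: "(int ^ 'd::finite) set \<Rightarrow> (int ^ 'd) set set" where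
  "inner_bonds \<Lambda> = {{x, y} | x y. x \<in> \<Lambda> \<and> y \<in> \<Lambda> \<and> nearest_neighbour x y}"

definition boundary_bonds :: "(int ^ 'd::finite) set \<Rightarrow> ((int ^ 'd) \<times> (int ^ 'd)) set" where
  "boundary_bonds \<Lambda> = {(x, y). x \<in> \<Lambda> \<and> y \<notin> \<Lambda> \<and> nearest_neighbour x y}"

definition ising_plus_weight :: "(int ^ 'd::finite) set \<Rightarrow> real \<Rightarrow> 'd config \<Rightarrow> real" where
  "ising_plus_weight \<Lambda> \<beta> \<sigma> =
     exp (\<beta> * (\<Sum>b\<in>inner_bonds \<Lambda>. \<Prod>x\<in>b. spin (\<sigma> x)) +
          \<beta> * (\<Sum>(x, y)\<in>boundary_bonds \<Lambda>. spin (\<sigma> x)))"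

text \<open>A configuration in the volume \<open>\<Lambda>\<close> is represented by its extension by \<open>+\<close> outside \<open>\<Lambda>\<close>.\<close>

definition plus_configs :: "(int ^ 'd::finite) set \<Rightarrow> 'd config set" where
  "plus_configs \<Lambda> = {\<sigma>. \<forall>x. x \<notin> \<Lambda> \<longrightarrow> \<sigma> x}"

definition ising_plus_partition :: "(int ^ 'd::finite) set \<Rightarrow> real \<Rightarrow> real" where
  "ising_plus_partition \<Lambda> \<beta> = (\<Sum>\<sigma>\<in>plus_configs \<Lambda>. ising_plus_weight \<Lambda> \<beta> \<sigma>)"

text \<open>Only meaningful for finite \<open>\<Lambda>\<close>; see \<open>pmf_ising_plus\<close> below.\<close>

definition ising_plus :: "(int ^ 'd::finite) set \<Rightarrow> real \<Rightarrow> 'd config pmf" where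
  "ising_plus \<Lambda> \<beta> =
     embed_pmf (\<lambda>\<sigma>. if \<sigma> \<in> plus_configs \<Lambda>
                     then ising_plus_weight \<Lambda> \<beta> \<sigma> / ising_plus_partition \<Lambda> \<beta> else 0)"

lemma finite_boundary_bonds:
  fixes \<Lambda> :: "(int ^ 'd::finite) set"
  assumes "finite \<Lambda>"
  shows "finite (boundary_bonds \<Lambda>)"
proof -
  have fin: "finite {y. nearest_neighbour x y}" for x :: "int ^ 'd"
  proof -
    have "{y. nearest_neighbour x y} \<subseteq> vec_lambda ` Pi\<^sub>E UNIV (\<lambda>i. {x $ i - 1..x $ i + 1})"
    proof
      fix y assume "y \<in> {y. nearest_neighbour x y}"
      then have s: "(\<Sum>i\<in>UNIV. \<bar>x $ i - y $ i\<bar>) = 1"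
        by (simp add: nearest_neighbour_def)
      have "\<bar>x $ i - y $ i\<bar> \<le> 1" for i
        unfolding s[symmetric] by (rule member_le_sum) auto
      then have "vec_nth y \<in> Pi\<^sub>E UNIV (\<lambda>i. {x $ i - 1..x $ i + 1})"
        by (auto simp: PiE_def Pi_def abs_le_iff algebra_simps)
      then show "y \<in> vec_lambda ` Pi\<^sub>E UNIV (\<lambda>i. {x $ i - 1..x $ i + 1})"
        by (metis image_eqI vec_nth_inverse)
    qed
    then show ?thesis
      by (rule finite_subset) (intro finite_imageI finite_PiE, auto)
  qed
  have "boundary_bonds \<Lambda> \<subseteq> (SIGMA x:\<Lambda>. {y. nearest_neighbour x y})"
    by (auto simp: boundary_bonds_def)
  then show ?thesis
    by (rule finite_subset) (intro finite_SigmaI assms fin)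
qed

lemma finite_plus_configs:
  assumes "finite \<Lambda>"
  shows "finite (plus_configs \<Lambda>)"
proof -
  have "plus_configs \<Lambda> \<subseteq> (\<lambda>A x. x \<notin> A) ` Pow \<Lambda>"
  proof
    fix \<sigma> assume "\<sigma> \<in> plus_configs \<Lambda>"
    then have "{x. \<not> \<sigma> x} \<in> Pow \<Lambda>" "\<sigma> = (\<lambda>x. x \<notin> {x. \<not> \<sigma> x})"
      by (auto simp: plus_configs_def)
    then show "\<sigma> \<in> (\<lambda>A x. x \<notin> A) ` Pow \<Lambda>"
      by (rule rev_image_eqI)
  qed
  then show ?thesis
    using assms by (meson finite_Pow_iff finite_imageI finite_subset)
qed

lemma pmf_ising_plus:
  assumes "finite \<Lambda>"
  shows "pmf (ising_plus \<Lambda> \<beta>) \<sigma> =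
           (if \<sigma> \<in> plus_configs \<Lambda>
            then ising_plus_weight \<Lambda> \<beta> \<sigma> / ising_plus_partition \<Lambda> \<beta> else 0)"
proof -
  let ?f = "\<lambda>\<sigma>. if \<sigma> \<in> plus_configs \<Lambda>
                  then ising_plus_weight \<Lambda> \<beta> \<sigma> / ising_plus_partition \<Lambda> \<beta> else 0"
  have fin: "finite (plus_configs \<Lambda>)"
    by (rule finite_plus_configs[OF assms])
  have ne: "(\<lambda>_. True) \<in> plus_configs \<Lambda>"
    by (simp add: plus_configs_def)
  have Z: "ising_plus_partition \<Lambda> \<beta> > 0"
    unfolding ising_plus_partition_def
    by (rule sum_pos[OF fin]) (use ne in \<open>auto simp: ising_plus_weight_def\<close>)
  have nonneg: "0 \<le> ?f \<sigma>" for \<sigma>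
    using Z by (auto simp: ising_plus_weight_def)
  have "(\<integral>\<^sup>+\<sigma>. ennreal (?f \<sigma>) \<partial>count_space UNIV) = (\<Sum>\<sigma>\<in>plus_configs \<Lambda>. ennreal (?f \<sigma>))"
    by (rule nn_integral_count_space'[OF fin]) auto
  also have "\<dots> = ennreal (\<Sum>\<sigma>\<in>plus_configs \<Lambda>. ?f \<sigma>)"
    using nonneg by (rule sum_ennreal)
  also have "(\<Sum>\<sigma>\<in>plus_configs \<Lambda>. ?f \<sigma>) = 1"
    using Z by (simp add: ising_plus_partition_def flip: sum_divide_distrib)
  finally have "(\<integral>\<^sup>+\<sigma>. ennreal (?f \<sigma>) \<partial>count_space UNIV) = 1"
    by simp
  then show ?thesis
    unfolding ising_plus_def by (intro pmf_embed_pmf nonneg)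
qed

text \<open>The limit \<open>\<Lambda> \<up> \<int>\<^sup>d\<close> is taken along the finite subsets of the lattice directed by inclusion.\<close>

definition is_plus_phase :: "real \<Rightarrow> 'd::finite config measure \<Rightarrow> bool" where
  "is_plus_phase \<beta> \<mu> \<longleftrightarrow>
     prob_space \<mu> \<and> sets \<mu> = sets borel \<and>
     (\<forall>f :: 'd config \<Rightarrow> real. continuous_on UNIV f \<and> bounded (range f) \<longrightarrow>
        ((\<lambda>\<Lambda>. measure_pmf.expectation (ising_plus \<Lambda> \<beta>) f) \<longlongrightarrow> integral\<^sup>L \<mu> f)
          (finite_subsets_at_top UNIV))"

definition plus_phase :: "real \<Rightarrow> 'd::finite config measure" where
  "plus_phase \<beta> = (THE \<mu>. is_plus_phase \<beta> \<mu>)"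

text \<open>The threshold for positive spontaneous magnetization. It is extended real valued: it would be
  infinite if there were no phase transition, as in dimension one.\<close>

definition critical_beta :: "'d::finite itself \<Rightarrow> ereal" where
  "critical_beta _ =
     Inf {ereal \<beta> | \<beta>. 0 \<le> \<beta> \<and> 0 < (\<integral>\<sigma>. spin (\<sigma> 0) \<partial>(plus_phase \<beta> :: 'd config measure))}"

definition local_function :: "('d::finite config \<Rightarrow> real) \<Rightarrow> bool" where
  "local_function g \<longleftrightarrow>
     (\<exists>\<Lambda>. finite \<Lambda> \<and> (\<forall>\<sigma> \<tau>. (\<forall>x\<in>\<Lambda>. \<sigma> x = \<tau> x) \<longrightarrow> g \<sigma> = g \<tau>))"

definition flip :: "int ^ 'd::finite \<Rightarrow> 'd config \<Rightarrow> 'd config" where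
  "flip x \<sigma> = \<sigma>(x := \<not> \<sigma> x)"

definition variation :: "('d::finite config \<Rightarrow> real) \<Rightarrow> int ^ 'd \<Rightarrow> real" where
  "variation g x = (SUP \<sigma>. \<bar>g (flip x \<sigma>) - g \<sigma>\<bar>)"

definition l2norm :: "(int ^ 'd::finite \<Rightarrow> real) \<Rightarrow> real" where
  "l2norm u = sqrt (\<Sum>\<^sub>\<infinity>x. (u x)\<^sup>2)"

definition h_const :: "real \<Rightarrow> real" where
  "h_const \<rho> = ((1 - \<rho>) / \<rho>) powr (1 / \<rho>)"

definition young_Phi :: "real \<Rightarrow> real \<Rightarrow> real" where
  "young_Phi \<rho> x = exp ((\<bar>x\<bar> + h_const \<rho>) powr \<rho>) - exp (h_const \<rho> powr \<rho>)"

text \<open>Taking the infimum in \<open>ennreal\<close> gives \<open>\<infinity>\<close> when no \<open>l\<close> is admissible.\<close>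

definition luxembourg_norm :: "'a measure \<Rightarrow> real \<Rightarrow> ('a \<Rightarrow> real) \<Rightarrow> ennreal" where
  "luxembourg_norm M \<rho> Z =
     Inf {ennreal l | l. 0 < l \<and> (\<integral>\<^sup>+\<omega>. ennreal (young_Phi \<rho> (Z \<omega> / l)) \<partial>M) \<le> 1}"

end

theory Submission
  imports Defs
begin

text \<open>Encode a configuration by its set \<open>A\<close> of minus spins. With plus boundary condition its weight is
  proportional to \<open>exp (- 2 \<beta> |\<partial>A|)\<close> in every volume containing \<open>A\<close>, so that shrinking the volume
  amounts to conditioning on the absence of minus spins, and revealing a cluster of minus spins
  leaves a smaller volume with plus boundary condition.

  Explore the minus clusters one by one. By the FKG property, revealing the cluster \<open>T\<close> of \<open>x\<close> changes
  the mean of \<open>g\<close> by at most the sum of \<open>\<delta>\<^sub>j g\<close> times the probability that the cluster of \<open>j\<close> reaches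
  \<open>T\<close>. For large \<open>\<beta>\<close> the Peierls argument bounds this probability exponentially in the distance,
  uniformly in the volume, so the increment is at most a polynomial in the radius of \<open>T\<close> times
  \<open>u\<^sub>x = \<Sum>\<^sub>j \<delta>\<^sub>j g / (1 + |x - j|)\<^bsup>2d\<^esup>\<close>, and its \<open>p\<close>-th moments grow polynomially in \<open>p\<close>. An induction on
  the volume with the potential \<open>(a\<^sup>2 + s)\<^sup>p\<close>, in which each step adds a multiple of \<open>u\<^sub>x\<^sup>2\<close> to \<open>s\<close>, yields
  \<open>E (g - E g)\<^bsup>2p\<^esup> \<le> (Q p\<^bsup>2d+1\<^esup> \<parallel>\<delta>g\<parallel>)\<^bsup>2p\<^esup>\<close> with \<open>Q\<close> independent of \<open>p\<close> and of the volume. The bound passes to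
  the infinite volume limit, and summing the exponential series gives the stretched exponential
  moments of order \<open>\<rho> < 1 / (2d + 1)\<close>.\<close>

section \<open>Monotonicity of the finite volume measures\<close>

text \<open>A cluster can be as large as the volume, so the increments have no useful deterministic
  bound and bounded difference inequalities do not apply; only their moments are controlled. The
  induction closes because the cost \<open>u x\<close> of exploring from \<open>x\<close> is the
  same number whatever was revealed before. This has two sources: conditional measures are again
  plus measures in smaller volumes, and the Peierls bound holds in all finite volumes with the same
  constants. The exponent \<open>2 * d\<close> makes the kernel in \<open>u x\<close> dominated by a
  product of inverse squares, so that convolution with it is bounded on l2. In the power
  \<open>2 * d + 1\<close> of \<open>p\<close>, the part \<open>2 * d\<close> comes from factorial
  moments of the radius and \<open>1\<close> from the potential. The term of order \<open>k\<close>
  in the exponential series is then, up to a factor \<open>C ^ k\<close>, of size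
  \<open>k powr (k * \<rho> * (2 * d + 1)) / fact k\<close>, which limits \<rho>. The Peierls bound
  also makes the magnetization positive, which places the threshold above the critical point. Since
  the plus phase is given by a definite description, its existence and uniqueness have to be proved
  as well.\<close>

lemma four_numbers_inequality:
  fixes a0 a1 b0 b1 c0 c1 d0 d1 :: real
  assumes nn: "0 \<le> a0" "0 \<le> a1" "0 \<le> b0" "0 \<le> b1" "0 \<le> c0" "0 \<le> c1" "0 \<le> d0" "0 \<le> d1"
    and h: "a0 * b0 \<le> c0 * d0" "a0 * b1 \<le> c1 * d0" "a1 * b0 \<le> c1 * d0" "a1 * b1 \<le> c1 * d1"
  shows "(a0 + a1) * (b0 + b1) \<le> (c0 + c1) * (d0 + d1)"
proof -
  define u v m where "u = a0 * b1" and "v = a1 * b0" and "m = c1 * d0"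
  have uvm: "0 \<le> u" "0 \<le> v" "u \<le> m" "v \<le> m" "0 \<le> m" "0 \<le> c0 * d1"
    using nn h by (auto simp: u_def v_def m_def)
  \<comment> \<open>The products \<open>a0 * b0\<close> and \<open>a1 * b1\<close> are dominated one
    by one, but both mixed products have the same bound \<open>m\<close>. Combining
    \<open>0 \<le> (m - u) * (m - v)\<close> with \<open>u * v \<le> m * (c0 * d1)\<close> controls
    their sum.\<close>
  have "u + v \<le> m + c0 * d1"
  proof (cases "m = 0")
    case True
    then show ?thesis using uvm by linarith
  next
    case False
    then have m: "0 < m" using uvm by linarith
    have "u * v = (a0 * b0) * (a1 * b1)" by (simp add: u_def v_def)
    also have "\<dots> \<le> (c0 * d0) * (c1 * d1)"
      by (rule mult_mono) (use nn h in auto)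
    also have "\<dots> = m * (c0 * d1)" by (simp add: m_def)
    finally have uv: "u * v \<le> m * (c0 * d1)" .
    have "0 \<le> (m - u) * (m - v)" using uvm by simp
    then have "m * (u + v) \<le> m * m + u * v" by (simp add: algebra_simps)
    also have "\<dots> \<le> m * (m + c0 * d1)" using uv by (simp add: algebra_simps)
    finally show ?thesis using m by simp
  qed
  then show ?thesis using h(1,4) by (simp add: algebra_simps u_def v_def m_def)
qed

lemma sum_Pow_insert:
  fixes f :: "'a set \<Rightarrow> real"
  assumes "finite S" "x \<notin> S"
  shows "(\<Sum>A\<in>Pow (insert x S). f A) = (\<Sum>A\<in>Pow S. f A + f (insert x A))"
proof -
  have "(\<Sum>A\<in>Pow (insert x S). f A) = (\<Sum>A\<in>Pow S. f A) + (\<Sum>A\<in>insert x ` Pow S. f A)"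
    unfolding Pow_insert by (rule sum.union_disjoint) (use assms in auto)
  also have "(\<Sum>A\<in>insert x ` Pow S. f A) = (\<Sum>A\<in>Pow S. f (insert x A))"
    by (rule sum.reindex_cong[OF _ refl refl])
       (use assms in \<open>force simp: inj_on_def\<close>)
  finally show ?thesis by (simp add: sum.distrib)
qed

text \<open>The theorem of Ahlswede and Daykin. Summing out the membership of one point leaves four
  functions on the subsets of the rest, and the inequality for four pairs of numbers shows that they
  satisfy the hypothesis again.\<close>

theorem four_functions:
  fixes a b c d :: "'a set \<Rightarrow> real"
  assumes "finite S"
    and "\<And>A. A \<subseteq> S \<Longrightarrow> 0 \<le> a A" "\<And>A. A \<subseteq> S \<Longrightarrow> 0 \<le> b A"
    and "\<And>A. A \<subseteq> S \<Longrightarrow> 0 \<le> c A" "\<And>A. A \<subseteq> S \<Longrightarrow> 0 \<le> d A"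
    and "\<And>A B. A \<subseteq> S \<Longrightarrow> B \<subseteq> S \<Longrightarrow> a A * b B \<le> c (A \<union> B) * d (A \<inter> B)"
  shows "(\<Sum>A\<in>Pow S. a A) * (\<Sum>A\<in>Pow S. b A) \<le> (\<Sum>A\<in>Pow S. c A) * (\<Sum>A\<in>Pow S. d A)"
  using assms
proof (induction S arbitrary: a b c d rule: finite_induct)
  case empty
  show ?case using empty(5)[of "{}" "{}"] by simp
next
  case (insert x S)
  note nn = insert.prems(1-4) and le = insert.prems(5)
  have "(\<Sum>A\<in>Pow S. a A + a (insert x A)) * (\<Sum>A\<in>Pow S. b A + b (insert x A))
      \<le> (\<Sum>A\<in>Pow S. c A + c (insert x A)) * (\<Sum>A\<in>Pow S. d A + d (insert x A))"
  proof (rule insert.IH)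
    fix A B assume AB: "A \<subseteq> S" "B \<subseteq> S"
    have x: "x \<notin> A" "x \<notin> B" using AB insert.hyps by auto
    have sub: "A \<subseteq> insert x S" "B \<subseteq> insert x S" "insert x A \<subseteq> insert x S"
      "insert x B \<subseteq> insert x S" "A \<union> B \<subseteq> insert x S" "A \<inter> B \<subseteq> insert x S"
      "insert x (A \<union> B) \<subseteq> insert x S" "insert x (A \<inter> B) \<subseteq> insert x S"
      using AB by auto
    have eq: "insert x A \<inter> B = A \<inter> B" "A \<inter> insert x B = A \<inter> B" "A \<union> insert x B = insert x (A \<union> B)"
      "insert x A \<union> B = insert x (A \<union> B)" "insert x A \<inter> insert x B = insert x (A \<inter> B)"
      "insert x A \<union> insert x B = insert x (A \<union> B)"
      using x by auto
    show "(a A + a (insert x A)) * (b B + b (insert x B))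
        \<le> (c (A \<union> B) + c (insert x (A \<union> B))) * (d (A \<inter> B) + d (insert x (A \<inter> B)))"
      by (rule four_numbers_inequality)
         (use nn sub le[of A B] le[of "insert x A" B] le[of A "insert x B"]
            le[of "insert x A" "insert x B"] in \<open>simp_all add: eq\<close>)
  qed (intro add_nonneg_nonneg nn; blast)+
  then show ?case
    by (simp only: sum_Pow_insert[OF insert.hyps])
qed

text \<open>A configuration is encoded by its set of minus spins, and a bond by its lower end point and
  its direction.\<close>

definition edge_boundary :: "(int ^ 'd::finite) set \<Rightarrow> ((int ^ 'd) \<times> 'd) set" where
  "edge_boundary A = {(x, i). (x \<in> A) \<noteq> (x + axis i 1 \<in> A)}"

definition adjacent :: "int ^ 'd::finite \<Rightarrow> int ^ 'd \<Rightarrow> bool" where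
  "adjacent x y \<longleftrightarrow> (\<exists>i. y = x + axis i 1 \<or> x = y + axis i 1)"

lemma adjacent_commute: "adjacent x y \<longleftrightarrow> adjacent y x"
  by (auto simp: adjacent_def)

lemma finite_edge_boundary:
  assumes "finite A"
  shows "finite (edge_boundary A)"
proof (rule finite_subset)
  show "edge_boundary A \<subseteq> A \<times> UNIV \<union> (\<lambda>(y, i). (y - axis i 1, i)) ` (A \<times> UNIV)"
    by (force simp: edge_boundary_def image_iff)
qed (use assms in auto)

definition weight :: "real \<Rightarrow> (int ^ 'd::finite) set \<Rightarrow> real" where
  "weight \<beta> A = exp (- 2 * \<beta> * card (edge_boundary A))"

lemma weight_pos [simp]: "0 < weight \<beta> A" and weight_nonneg [simp]: "0 \<le> weight \<beta> A"
  by (simp_all add: weight_def)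

text \<open>The FKG lattice condition, from submodularity of the boundary: a bond separated by both
  \<open>A \<union> B\<close> and \<open>A \<inter> B\<close> has one end in both sets and the other
  in neither, hence is separated by \<open>A\<close> and by \<open>B\<close>.\<close>

lemma weight_mult_le:
  assumes "finite A" "finite B" "0 \<le> \<beta>"
  shows "weight \<beta> A * weight \<beta> B \<le> weight \<beta> (A \<union> B) * weight \<beta> (A \<inter> B)"
proof -
  let ?b = edge_boundary
  have fin: "finite (?b A)" "finite (?b B)" "finite (?b (A \<union> B))" "finite (?b (A \<inter> B))"
    using assms by (auto intro: finite_edge_boundary)
  have "card (?b (A \<union> B)) + card (?b (A \<inter> B))
      = card (?b (A \<union> B) \<union> ?b (A \<inter> B)) + card (?b (A \<union> B) \<inter> ?b (A \<inter> B))"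
    using fin by (rule_tac card_Un_Int)
  also have "\<dots> \<le> card (?b A \<union> ?b B) + card (?b A \<inter> ?b B)"
    by (intro add_mono card_mono finite_UnI finite_Int) (use fin in \<open>auto simp: edge_boundary_def\<close>)
  also have "\<dots> = card (?b A) + card (?b B)"
    using fin by (rule_tac card_Un_Int[symmetric])
  finally have "real (card (?b (A \<union> B))) + card (?b (A \<inter> B)) \<le> real (card (?b A)) + card (?b B)"
    by linarith
  then have "\<beta> * (real (card (?b (A \<union> B))) + card (?b (A \<inter> B))) \<le> \<beta> * (real (card (?b A)) + card (?b B))"
    using assms(3) by (rule mult_left_mono)
  then show ?thesis
    by (simp add: weight_def algebra_simps flip: exp_add)
qed

text \<open>A bond in both boundaries would join \<open>A\<close> to \<open>B\<close>. This
  factorization decouples a revealed cluster from the rest.\<close>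

lemma weight_Un:
  assumes "finite A" "finite B" "A \<inter> B = {}" "\<And>x y. x \<in> A \<Longrightarrow> y \<in> B \<Longrightarrow> \<not> adjacent x y"
  shows "weight \<beta> (A \<union> B) = weight \<beta> A * weight \<beta> B"
proof -
  have "edge_boundary (A \<union> B) = edge_boundary A \<union> edge_boundary B"
    using assms(3,4) unfolding edge_boundary_def adjacent_def by blast
  moreover have "edge_boundary A \<inter> edge_boundary B = {}"
    using assms(3,4) unfolding edge_boundary_def adjacent_def by blast
  ultimately have "card (edge_boundary (A \<union> B)) = card (edge_boundary A) + card (edge_boundary B)"
    using assms(1,2) by (simp add: card_Un_disjoint finite_edge_boundary)
  then show ?thesis
    by (simp add: weight_def algebra_simps flip: exp_add)
qed

definition partition_sum :: "real \<Rightarrow> (int ^ 'd::finite) set \<Rightarrow> real" where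
  "partition_sum \<beta> U = (\<Sum>A\<in>Pow U. weight \<beta> A)"

definition mean :: "real \<Rightarrow> (int ^ 'd::finite) set \<Rightarrow> ((int ^ 'd) set \<Rightarrow> real) \<Rightarrow> real" where
  "mean \<beta> U f = (\<Sum>A\<in>Pow U. weight \<beta> A * f A) / partition_sum \<beta> U"

abbreviation event_prob :: "real \<Rightarrow> (int ^ 'd::finite) set \<Rightarrow> ((int ^ 'd) set \<Rightarrow> bool) \<Rightarrow> real" where
  "event_prob \<beta> U E \<equiv> mean \<beta> U (\<lambda>A. of_bool (E A))"

lemma partition_sum_pos:
  assumes "finite U"
  shows "0 < partition_sum \<beta> U"
  unfolding partition_sum_def by (rule sum_pos) (use assms in auto)

lemma mean_cong: "(\<And>A. A \<subseteq> U \<Longrightarrow> f A = g A) \<Longrightarrow> mean \<beta> U f = mean \<beta> U g"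
  by (simp add: mean_def)

lemma mean_add: "mean \<beta> U (\<lambda>A. f A + g A) = mean \<beta> U f + mean \<beta> U g"
  by (simp add: mean_def algebra_simps sum.distrib add_divide_distrib)

lemma mean_diff: "mean \<beta> U (\<lambda>A. f A - g A) = mean \<beta> U f - mean \<beta> U g"
  by (simp add: mean_def algebra_simps sum_subtractf diff_divide_distrib)

lemma mean_cmult: "mean \<beta> U (\<lambda>A. c * f A) = c * mean \<beta> U f"
  by (simp add: mean_def algebra_simps sum_distrib_left)

lemma mean_minus: "mean \<beta> U (\<lambda>A. - f A) = - mean \<beta> U f"
  using mean_cmult[of \<beta> U "-1" f] by simp

lemma mean_sum: "mean \<beta> U (\<lambda>A. \<Sum>j\<in>J. f j A) = (\<Sum>j\<in>J. mean \<beta> U (f j))"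
  unfolding mean_def by (simp add: sum_distrib_left sum_divide_distrib) (rule sum.swap)

lemma mean_const: "finite U \<Longrightarrow> mean \<beta> U (\<lambda>_. c) = c"
  using partition_sum_pos[of U \<beta>]
  by (simp add: mean_def partition_sum_def flip: sum_distrib_right)

lemma mean_mono:
  assumes "finite U" "\<And>A. A \<subseteq> U \<Longrightarrow> f A \<le> g A"
  shows "mean \<beta> U f \<le> mean \<beta> U g"
  unfolding mean_def
  by (intro divide_right_mono sum_mono mult_left_mono)
     (use assms partition_sum_pos[OF assms(1), of \<beta>] in auto)

lemma mean_nonneg: "finite U \<Longrightarrow> (\<And>A. A \<subseteq> U \<Longrightarrow> 0 \<le> f A) \<Longrightarrow> 0 \<le> mean \<beta> U f"
  using mean_mono[of U "\<lambda>_. 0" f \<beta>] by (simp add: mean_const)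

lemma abs_mean_le: "finite U \<Longrightarrow> \<bar>mean \<beta> U f\<bar> \<le> mean \<beta> U (\<lambda>A. \<bar>f A\<bar>)"
  using mean_mono[of U f "\<lambda>A. \<bar>f A\<bar>" \<beta>] mean_mono[of U "\<lambda>A. - f A" "\<lambda>A. \<bar>f A\<bar>" \<beta>]
  by (simp add: mean_minus abs_ge_self abs_ge_minus_self abs_le_iff)

lemma event_prob_le_1: "finite U \<Longrightarrow> event_prob \<beta> U E \<le> 1"
  using mean_mono[of U "\<lambda>A. of_bool (E A)" "\<lambda>_. 1" \<beta>] by (simp add: mean_const)

lemma mean_empty [simp]: "mean \<beta> {} f = f {}"
  by (simp add: mean_def partition_sum_def) (simp add: weight_def)

text \<open>Enlarging the volume beyond \<open>U\<close> removes the condition that there are no minus spins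
  outside \<open>U\<close>, a decreasing event.\<close>

lemma mean_mono_volume:
  fixes f :: "(int ^ 'd::finite) set \<Rightarrow> real"
  assumes "finite V" "U \<subseteq> V" "0 \<le> \<beta>"
    and mono: "\<And>A B. A \<subseteq> B \<Longrightarrow> B \<subseteq> V \<Longrightarrow> f A \<le> f B"
  shows "mean \<beta> U f \<le> mean \<beta> V f"
proof -
  have finU: "finite U" using assms finite_subset by blast
  \<comment> \<open>Subtracting the minimum makes the function nonnegative, as the four functions
    theorem demands, and does not affect the comparison of means.\<close>
  define g where "g A = f A - f {}" for A
  have g0: "0 \<le> g A" if "A \<subseteq> V" for A using mono[of "{}" A] that by (simp add: g_def)
  let ?w = "weight \<beta>"
  have restrict: "(\<Sum>A\<in>Pow V. h A * of_bool (A \<subseteq> U)) = (\<Sum>A\<in>Pow U. h A)" for h :: "(int^'d) set \<Rightarrow> real"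
    by (rule sum.mono_neutral_cong_right) (use assms in auto)
  \<comment> \<open>The indicator of \<open>A \<subseteq> U\<close> moves from the first factor to
    the last: it survives the passage to \<open>A \<inter> B\<close>, while \<open>g\<close> grows
    under the passage to \<open>A \<union> B\<close>.\<close>
  have "(\<Sum>A\<in>Pow V. ?w A * g A * of_bool (A \<subseteq> U)) * (\<Sum>A\<in>Pow V. ?w A)
      \<le> (\<Sum>A\<in>Pow V. ?w A * g A) * (\<Sum>A\<in>Pow V. ?w A * of_bool (A \<subseteq> U))"
  proof (rule four_functions)
    fix A B assume AB: "A \<subseteq> V" "B \<subseteq> V"
    then have fin: "finite A" "finite B" using assms(1) finite_subset by auto
    have gm: "g A \<le> g (A \<union> B)" using mono[of A "A \<union> B"] AB by (simp add: g_def)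
    have "(?w A * ?w B) * (g A * of_bool (A \<subseteq> U))
        \<le> (?w (A \<union> B) * ?w (A \<inter> B)) * (g (A \<union> B) * of_bool (A \<inter> B \<subseteq> U))"
      by (intro mult_mono weight_mult_le fin assms(3)) (use gm g0 AB in \<open>auto intro!: mult_nonneg_nonneg\<close>)
    then show "?w A * g A * of_bool (A \<subseteq> U) * ?w B
        \<le> ?w (A \<union> B) * g (A \<union> B) * (?w (A \<inter> B) * of_bool (A \<inter> B \<subseteq> U))"
      by (simp only: mult_ac)
  qed (use assms(1) g0 in auto)
  then have "(\<Sum>A\<in>Pow U. ?w A * g A) * partition_sum \<beta> V \<le> (\<Sum>A\<in>Pow V. ?w A * g A) * partition_sum \<beta> U"
    by (simp only: restrict partition_sum_def)
  then have "mean \<beta> U g \<le> mean \<beta> V g"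
    using partition_sum_pos[OF finU, of \<beta>] partition_sum_pos[OF assms(1), of \<beta>]
    by (simp add: mean_def divide_simps mult_ac)
  then show ?thesis
    unfolding g_def using finU assms(1) by (simp add: mean_diff mean_const)
qed

lemma oscillation_le:
  fixes g :: "'a set \<Rightarrow> real"
  assumes lip: "\<And>A j. \<bar>g (insert j A) - g A\<bar> \<le> dl j"
    and "finite B"
  shows "\<bar>g (A \<union> B) - g A\<bar> \<le> (\<Sum>j\<in>B - A. dl j)"
  using \<open>finite B\<close>
proof (induction B rule: finite_induct)
  case (insert x B)
  show ?case
  proof (cases "x \<in> A")
    case True
    then show ?thesis using insert by (simp add: insert_absorb)
  next
    case False
    then have "(\<Sum>j\<in>insert x B - A. dl j) = dl x + (\<Sum>j\<in>B - A. dl j)"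
      using insert.hyps by (simp add: insert_Diff_if)
    then show ?thesis
      using insert.IH lip[of x "A \<union> B"] by simp
  qed
qed simp

text \<open>The number of minus spins, weighted by the oscillations, dominates the variation of \<open>g\<close>, so
  that adding it to \<open>\<plusminus>g\<close> gives increasing functions.\<close>

lemma mean_diff_volume:
  fixes g :: "(int ^ 'd::finite) set \<Rightarrow> real"
  assumes "finite V" "U \<subseteq> V" "0 \<le> \<beta>"
    and lip: "\<And>A j. \<bar>g (insert j A) - g A\<bar> \<le> dl j"
  shows "\<bar>mean \<beta> U g - mean \<beta> V g\<bar>
    \<le> (\<Sum>j\<in>V. dl j * (event_prob \<beta> V (\<lambda>A. j \<in> A) - event_prob \<beta> U (\<lambda>A. j \<in> A)))"
proof -
  define m where "m = (\<lambda>A. \<Sum>j\<in>V. dl j * of_bool (j \<in> A))"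
  have mono: "m A + s * g A \<le> m B + s * g B" if "A \<subseteq> B" "B \<subseteq> V" "\<bar>s\<bar> = 1" for A B s
  proof -
    have "finite B" using that assms(1) finite_subset by blast
    then have "\<bar>g B - g A\<bar> \<le> (\<Sum>j\<in>B - A. dl j)"
      using oscillation_le[of g dl B A, OF lip] that by (simp add: Un_absorb1)
    also have "\<dots> = (\<Sum>j\<in>V. dl j * of_bool (j \<in> B - A))"
      by (rule sum.mono_neutral_cong_left) (use that assms in auto)
    also have "\<dots> = m B - m A"
      unfolding m_def sum_subtractf[symmetric]
      by (rule sum.cong) (use that in auto)
    finally have "\<bar>s * (g A - g B)\<bar> \<le> m B - m A"
      using that by (simp add: abs_mult abs_minus_commute)
    then show ?thesis by (simp add: algebra_simps abs_le_iff)
  qed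
  have *: "mean \<beta> U m + s * mean \<beta> U g \<le> mean \<beta> V m + s * mean \<beta> V g" if "\<bar>s\<bar> = 1" for s
    using mean_mono_volume[of V U \<beta> "\<lambda>A. m A + s * g A", OF assms(1-3) mono] that
    by (simp add: mean_add mean_cmult)
  have "\<bar>mean \<beta> U g - mean \<beta> V g\<bar> \<le> mean \<beta> V m - mean \<beta> U m"
    using *[of 1] *[of "-1"] by auto
  also have "\<dots> = (\<Sum>j\<in>V. dl j * (event_prob \<beta> V (\<lambda>A. j \<in> A) - event_prob \<beta> U (\<lambda>A. j \<in> A)))"
    by (simp add: m_def mean_sum mean_cmult algebra_simps sum_subtractf)
  finally show ?thesis .
qed

section \<open>Exploring clusters of minus spins\<close>

definition minus_bonds :: "(int ^ 'd::finite) set \<Rightarrow> (int ^ 'd) rel" where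
  "minus_bonds A = {(x, y). x \<in> A \<and> y \<in> A \<and> adjacent x y}"

text \<open>The union of the connected components of \<open>A\<close> that meet \<open>W\<close>. A
  site of \<open>W\<close> outside \<open>A\<close> reaches only itself, and the condition
  \<open>y \<in> A\<close> discards it; so \<open>cluster A {x}\<close> is empty when the spin at
  \<open>x\<close> is plus.\<close>

definition cluster :: "(int ^ 'd::finite) set \<Rightarrow> (int ^ 'd) set \<Rightarrow> (int ^ 'd) set" where
  "cluster A W = {y \<in> A. \<exists>w\<in>W. (w, y) \<in> (minus_bonds A)\<^sup>*}"

text \<open>The sites whose spins are known once the clusters meeting \<open>W\<close> are known to be \<open>T\<close>.\<close>

definition explored :: "(int ^ 'd::finite) set \<Rightarrow> (int ^ 'd) set \<Rightarrow> (int ^ 'd) set" where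
  "explored W T = W \<union> T \<union> {y. \<exists>x\<in>T. adjacent x y}"

lemma minus_bonds_mono: "A \<subseteq> B \<Longrightarrow> minus_bonds A \<subseteq> minus_bonds B"
  by (auto simp: minus_bonds_def)

lemma sym_minus_bonds: "sym (minus_bonds A)"
  by (auto simp: minus_bonds_def sym_def adjacent_commute)

lemma minus_bonds_rtrancl_sym: "(x, y) \<in> (minus_bonds A)\<^sup>* \<Longrightarrow> (y, x) \<in> (minus_bonds A)\<^sup>*"
  using sym_minus_bonds sym_rtrancl symD by metis

lemma minus_bonds_rtrancl_mem: "(x, y) \<in> (minus_bonds A)\<^sup>* \<Longrightarrow> x \<in> A \<longleftrightarrow> y \<in> A"
  by (induction rule: rtrancl_induct) (auto simp: minus_bonds_def)

lemma cluster_subset: "cluster A W \<subseteq> A"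
  by (auto simp: cluster_def)

lemma cluster_mono: "A \<subseteq> B \<Longrightarrow> cluster A W \<subseteq> cluster B W"
  using rtrancl_mono[OF minus_bonds_mono] unfolding cluster_def by blast

lemma cluster_step: "y \<in> cluster A W \<Longrightarrow> z \<in> A \<Longrightarrow> adjacent y z \<Longrightarrow> z \<in> cluster A W"
proof -
  assume yz: "y \<in> cluster A W" "z \<in> A" "adjacent y z"
  then obtain w where "w \<in> W" "(w, y) \<in> (minus_bonds A)\<^sup>*" "(y, z) \<in> minus_bonds A"
    by (auto simp: cluster_def minus_bonds_def)
  then show "z \<in> cluster A W"
    using yz(2) rtrancl_into_rtrancl unfolding cluster_def by fastforce
qed

lemma cluster_base: "y \<in> A \<Longrightarrow> y \<in> W \<Longrightarrow> y \<in> cluster A W"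
  by (auto simp: cluster_def)

text \<open>A path of minus spins from \<open>W\<close> never leaves the cluster, so the cluster is
  connected to \<open>W\<close> by its own sites, whatever the spins elsewhere.\<close>

lemma cluster_connected:
  assumes "w \<in> W" "(w, y) \<in> (minus_bonds A)\<^sup>*"
  shows "(w, y) \<in> (minus_bonds (cluster A W))\<^sup>*"
  using assms(2)
proof (induction rule: rtrancl_induct)
  case (step y z)
  have "y \<in> cluster A W"
    using step(1,2) assms(1) by (auto simp: cluster_def minus_bonds_def)
  then have "(y, z) \<in> minus_bonds (cluster A W)"
    using step(2) cluster_step[of y A W z] by (auto simp: minus_bonds_def)
  with step show ?case by simp
qed simp

text \<open>The event that the cluster is \<open>T\<close> depends only on the explored sites:
  \<open>T\<close> is minus and the other explored sites are plus. The set \<open>T\<close> has to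
  be a possible cluster, since otherwise its sites need not be connected to
  \<open>W\<close>.\<close>

lemma cluster_eq_iff:
  assumes T: "T = cluster A\<^sub>0 W"
  shows "cluster A W = T \<longleftrightarrow> T \<subseteq> A \<and> (A - T) \<inter> explored W T = {}"
proof
  assume "cluster A W = T"
  then show "T \<subseteq> A \<and> (A - T) \<inter> explored W T = {}"
    using cluster_subset[of A W] cluster_step[of _ A W]
    by (fastforce simp: explored_def intro: cluster_base)
next
  assume A: "T \<subseteq> A \<and> (A - T) \<inter> explored W T = {}"
  show "cluster A W = T"
  proof
    have "y \<in> A \<longrightarrow> y \<in> T" if "w \<in> W" "(w, y) \<in> (minus_bonds A)\<^sup>*" for w y
      using that(2)
    proof (induction rule: rtrancl_induct)
      case base
      then show ?case using A that by (auto simp: explored_def)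
    next
      case (step y z)
      then have "y \<in> T" "adjacent y z" "z \<in> A" by (auto simp: minus_bonds_def)
      then show ?case using A by (auto simp: explored_def)
    qed
    then show "cluster A W \<subseteq> T" unfolding cluster_def by blast
    show "T \<subseteq> cluster A W"
    proof
      fix y assume y: "y \<in> T"
      then obtain w where w: "w \<in> W" "(w, y) \<in> (minus_bonds A\<^sub>0)\<^sup>*"
        by (auto simp: T cluster_def)
      then have "(w, y) \<in> (minus_bonds T)\<^sup>*"
        unfolding T by (rule cluster_connected)
      then have "(w, y) \<in> (minus_bonds A)\<^sup>*"
        using rtrancl_mono[OF minus_bonds_mono, of T A] A by blast
      then show "y \<in> cluster A W" using w y A by (auto simp: cluster_def)
    qed
  qed
qed

text \<open>Configurations are grouped by their cluster \<open>T\<close>; by the characterization of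
  this event the remaining minus spins form an arbitrary subset of the unexplored sites.\<close>

lemma sum_Pow_cluster:
  fixes F :: "(int ^ 'd::finite) set \<Rightarrow> real"
  assumes "finite U"
  shows "(\<Sum>A\<in>Pow U. F A)
    = (\<Sum>T\<in>(\<lambda>A. cluster A W) ` Pow U. \<Sum>B\<in>Pow (U - explored W T). F (T \<union> B))"
proof -
  have "(\<Sum>A\<in>Pow U. F A)
      = (\<Sum>T\<in>(\<lambda>A. cluster A W) ` Pow U. \<Sum>A\<in>{A \<in> Pow U. cluster A W = T}. F A)"
    by (rule sum.image_gen) (use assms in simp)
  also have "\<dots> = (\<Sum>T\<in>(\<lambda>A. cluster A W) ` Pow U. \<Sum>B\<in>Pow (U - explored W T). F (T \<union> B))"
  proof (rule sum.cong[OF refl])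
    fix T assume "T \<in> (\<lambda>A. cluster A W) ` Pow U"
    then obtain A\<^sub>0 where T: "T = cluster A\<^sub>0 W" "A\<^sub>0 \<subseteq> U" by auto
    have TU: "T \<subseteq> U" using T cluster_subset by blast
    have Te: "T \<subseteq> explored W T" by (auto simp: explored_def)
    have "{A \<in> Pow U. cluster A W = T} = (\<lambda>B. T \<union> B) ` Pow (U - explored W T)"
    proof (intro set_eqI iffI)
      fix A assume "A \<in> {A \<in> Pow U. cluster A W = T}"
      then have "A \<subseteq> U" "T \<subseteq> A" "(A - T) \<inter> explored W T = {}"
        using cluster_eq_iff[OF T(1)] by auto
      then show "A \<in> (\<lambda>B. T \<union> B) ` Pow (U - explored W T)"
        by (intro image_eqI[where x = "A - T"]) auto
    next
      fix A assume "A \<in> (\<lambda>B. T \<union> B) ` Pow (U - explored W T)"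
      then show "A \<in> {A \<in> Pow U. cluster A W = T}"
        using cluster_eq_iff[OF T(1)] TU by auto
    qed
    moreover have "inj_on (\<lambda>B. T \<union> B) (Pow (U - explored W T))"
      using Te by (force simp: inj_on_def)
    ultimately show "(\<Sum>A\<in>{A \<in> Pow U. cluster A W = T}. F A)
        = (\<Sum>B\<in>Pow (U - explored W T). F (T \<union> B))"
      by (simp add: sum.reindex)
  qed
  finally show ?thesis .
qed

text \<open>For \<open>T\<close> among the possible clusters of subsets of \<open>U\<close> this is
  the probability that the cluster of \<open>W\<close> equals \<open>T\<close>.\<close>

definition cluster_prob ::
  "real \<Rightarrow> (int ^ 'd::finite) set \<Rightarrow> (int ^ 'd) set \<Rightarrow> (int ^ 'd) set \<Rightarrow> real" where
  "cluster_prob \<beta> U W T = weight \<beta> T * partition_sum \<beta> (U - explored W T) / partition_sum \<beta> U"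

text \<open>The domain Markov property: outside the explored sites the boundary condition is again plus.\<close>

lemma mean_cluster:
  fixes f :: "(int ^ 'd::finite) set \<Rightarrow> real"
  assumes "finite U"
  shows "mean \<beta> U f = (\<Sum>T\<in>(\<lambda>A. cluster A W) ` Pow U.
    cluster_prob \<beta> U W T * mean \<beta> (U - explored W T) (\<lambda>B. f (T \<union> B)))"
proof -
  have "(\<Sum>A\<in>Pow U. weight \<beta> A * f A)
    = (\<Sum>T\<in>(\<lambda>A. cluster A W) ` Pow U. \<Sum>B\<in>Pow (U - explored W T). weight \<beta> (T \<union> B) * f (T \<union> B))"
    by (rule sum_Pow_cluster[OF assms])
  also have "\<dots> = (\<Sum>T\<in>(\<lambda>A. cluster A W) ` Pow U.
      weight \<beta> T * (\<Sum>B\<in>Pow (U - explored W T). weight \<beta> B * f (T \<union> B)))"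
  proof (rule sum.cong[OF refl])
    fix T assume "T \<in> (\<lambda>A. cluster A W) ` Pow U"
    then have "T \<subseteq> U" using cluster_subset by fastforce
    have "weight \<beta> (T \<union> B) = weight \<beta> T * weight \<beta> B" if "B \<subseteq> U - explored W T" for B
    proof (rule weight_Un)
      show "finite T" "finite B"
        using \<open>T \<subseteq> U\<close> that assms by (auto intro: finite_subset)
    qed (use that in \<open>auto simp: explored_def\<close>)
    then show "(\<Sum>B\<in>Pow (U - explored W T). weight \<beta> (T \<union> B) * f (T \<union> B))
        = weight \<beta> T * (\<Sum>B\<in>Pow (U - explored W T). weight \<beta> B * f (T \<union> B))"
      by (simp add: sum_distrib_left mult.assoc)
  qed
  finally show ?thesis
    using partition_sum_pos[of "U - explored W _" \<beta>] assms
    by (simp add: mean_def cluster_prob_def less_imp_neq[symmetric]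
        sum_divide_distrib[where A = "(\<lambda>A. cluster A W) ` Pow U"])
qed

lemma cluster_prob_nonneg: "finite U \<Longrightarrow> 0 \<le> cluster_prob \<beta> U W T"
  using partition_sum_pos[of U \<beta>] partition_sum_pos[of "U - explored W T" \<beta>]
  by (simp add: cluster_prob_def)

text \<open>The domain Markov property for a function of the cluster alone, which is constant once
  \<open>T\<close> is given.\<close>

lemma sum_cluster_prob:
  assumes "finite U"
  shows "(\<Sum>T\<in>(\<lambda>A. cluster A W) ` Pow U. cluster_prob \<beta> U W T * \<phi> T)
    = mean \<beta> U (\<lambda>A. \<phi> (cluster A W))"
  unfolding mean_cluster[OF assms, of \<beta> _ W]
proof (rule sum.cong[OF refl])
  fix T assume "T \<in> (\<lambda>A. cluster A W) ` Pow U"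
  then obtain A\<^sub>0 where T: "T = cluster A\<^sub>0 W" by auto
  have "cluster (T \<union> B) W = T" if "B \<subseteq> U - explored W T" for B
    unfolding cluster_eq_iff[OF T] using that by auto
  then have "mean \<beta> (U - explored W T) (\<lambda>B. \<phi> (cluster (T \<union> B) W)) = \<phi> T"
    using assms by (subst mean_cong[where g = "\<lambda>_. \<phi> T"]) (auto simp: mean_const)
  then show "cluster_prob \<beta> U W T * \<phi> T
      = cluster_prob \<beta> U W T * mean \<beta> (U - explored W T) (\<lambda>B. \<phi> (cluster (T \<union> B) W))"
    by simp
qed

text \<open>Reveal the clusters meeting \<open>V - U\<close>. Either \<open>j\<close> lies in one of
  them, or it is left in a volume contained in \<open>U\<close>, where by monotonicity it is minus
  with at most the probability that it has in \<open>U\<close>.\<close>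

lemma influence_le_cluster:
  fixes V :: "(int ^ 'd::finite) set"
  assumes "finite V" "U \<subseteq> V" "0 \<le> \<beta>"
  shows "event_prob \<beta> V (\<lambda>A. j \<in> A) - event_prob \<beta> U (\<lambda>A. j \<in> A)
    \<le> event_prob \<beta> V (\<lambda>A. j \<in> cluster A (V - U))"
proof -
  let ?W = "V - U" and ?I = "(\<lambda>A. cluster A (V - U)) ` Pow V"
  have finU: "finite U" using assms finite_subset by blast
  have "event_prob \<beta> V (\<lambda>A. j \<in> A)
    = (\<Sum>T\<in>?I. cluster_prob \<beta> V ?W T * event_prob \<beta> (V - explored ?W T) (\<lambda>B. j \<in> T \<union> B))"
    by (rule mean_cluster[OF assms(1)])
  also have "\<dots> \<le> (\<Sum>T\<in>?I. cluster_prob \<beta> V ?W T * (of_bool (j \<in> T) + event_prob \<beta> U (\<lambda>A. j \<in> A)))"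
  proof (intro sum_mono mult_left_mono cluster_prob_nonneg assms)
    fix T
    have "event_prob \<beta> (V - explored ?W T) (\<lambda>B. j \<in> T \<union> B)
        \<le> mean \<beta> (V - explored ?W T) (\<lambda>B. of_bool (j \<in> T) + of_bool (j \<in> B))"
      by (rule mean_mono) (use assms in auto)
    also have "\<dots> = of_bool (j \<in> T) + event_prob \<beta> (V - explored ?W T) (\<lambda>B. j \<in> B)"
      using assms by (simp add: mean_add mean_const)
    also have "event_prob \<beta> (V - explored ?W T) (\<lambda>B. j \<in> B) \<le> event_prob \<beta> U (\<lambda>A. j \<in> A)"
      by (rule mean_mono_volume) (use assms finU in \<open>auto simp: explored_def\<close>)
    finally show "event_prob \<beta> (V - explored ?W T) (\<lambda>B. j \<in> T \<union> B)
        \<le> of_bool (j \<in> T) + event_prob \<beta> U (\<lambda>A. j \<in> A)" by simp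
  qed
  also have "\<dots> = event_prob \<beta> V (\<lambda>A. j \<in> cluster A ?W) + event_prob \<beta> U (\<lambda>A. j \<in> A)"
    using sum_cluster_prob[OF assms(1), of \<beta> ?W "\<lambda>_. 1"]
    by (subst sum_cluster_prob[OF assms(1)]) (simp add: mean_add mean_const assms(1))
  finally show ?thesis by simp
qed

section \<open>Distances on the lattice and the extent of clusters\<close>

definition sup_dist :: "int ^ 'd::finite \<Rightarrow> int ^ 'd \<Rightarrow> nat" where
  "sup_dist x y = Max (range (\<lambda>i. nat \<bar>x $ i - y $ i\<bar>))"

lemma sup_dist_le_iff: "sup_dist x y \<le> n \<longleftrightarrow> (\<forall>i. \<bar>x $ i - y $ i\<bar> \<le> int n)"
  by (auto simp: sup_dist_def nat_le_iff)

lemma coordinate_le_sup_dist: "\<bar>x $ i - y $ i\<bar> \<le> int (sup_dist x y)"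
  using sup_dist_le_iff[of x y "sup_dist x y"] by simp

lemma sup_dist_attained: "\<exists>i. int (sup_dist x y) = \<bar>x $ i - y $ i\<bar>"
proof -
  have "sup_dist x y \<in> range (\<lambda>i. nat \<bar>x $ i - y $ i\<bar>)"
    unfolding sup_dist_def by (rule Max_in) auto
  then show ?thesis by auto
qed

lemma sup_dist_commute: "sup_dist x y = sup_dist y x"
  by (simp add: sup_dist_def abs_minus_commute)

lemma sup_dist_triangle: "sup_dist x z \<le> sup_dist x y + sup_dist y z"
  unfolding sup_dist_le_iff
proof
  fix i
  have "\<bar>x $ i - z $ i\<bar> \<le> \<bar>x $ i - y $ i\<bar> + \<bar>y $ i - z $ i\<bar>" by linarith
  then show "\<bar>x $ i - z $ i\<bar> \<le> int (sup_dist x y + sup_dist y z)"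
    using coordinate_le_sup_dist[of x i y] coordinate_le_sup_dist[of y i z] by simp
qed

lemma sup_dist_adjacent: "adjacent x y \<Longrightarrow> sup_dist x y \<le> 1"
  unfolding sup_dist_le_iff by (auto simp: adjacent_def axis_def)

lemma sup_dist_self [simp]: "sup_dist x x = 0"
  using sup_dist_le_iff[of x x 0] by simp

text \<open>For \<open>r = 0\<close> this is the event that \<open>x\<close> has a minus spin. It is
  increasing in \<open>A\<close>, so its probability grows with the volume.\<close>

definition reaches :: "nat \<Rightarrow> int ^ 'd::finite \<Rightarrow> (int ^ 'd) set \<Rightarrow> bool" where
  "reaches r x A \<longleftrightarrow> (\<exists>y\<in>cluster A {x}. r \<le> sup_dist x y)"

lemma reaches_mono: "A \<subseteq> B \<Longrightarrow> reaches r x A \<Longrightarrow> reaches r x B"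
  using cluster_mono unfolding reaches_def by blast

definition radius :: "int ^ 'd::finite \<Rightarrow> (int ^ 'd) set \<Rightarrow> nat" where
  "radius x T = Max (insert 0 (sup_dist x ` T))"

lemma sup_dist_le_radius: "finite T \<Longrightarrow> y \<in> T \<Longrightarrow> sup_dist x y \<le> radius x T"
  by (simp add: radius_def)

lemma radius_attained: "finite T \<Longrightarrow> radius x T \<noteq> 0 \<Longrightarrow> \<exists>y\<in>T. radius x T = sup_dist x y"
  unfolding radius_def using Max_in[of "insert 0 (sup_dist x ` T)"] by auto

text \<open>If the cluster of \<open>j\<close> contains an explored site, it extends from
  \<open>j\<close> to the vicinity of \<open>x\<close>. The subtraction is truncated: for
  \<open>j\<close> close to \<open>T\<close> the bound is just the probability of a minus spin at
  \<open>j\<close>.\<close>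

lemma influence_le_reaches:
  fixes U :: "(int ^ 'd::finite) set"
  assumes "finite U" "0 \<le> \<beta>" "finite T"
  shows "event_prob \<beta> U (\<lambda>A. j \<in> A) - event_prob \<beta> (U - explored {x} T) (\<lambda>A. j \<in> A)
    \<le> event_prob \<beta> U (reaches (sup_dist x j - (radius x T + 1)) j)"
proof -
  let ?W = "U - (U - explored {x} T)"
  have "event_prob \<beta> U (\<lambda>A. j \<in> A) - event_prob \<beta> (U - explored {x} T) (\<lambda>A. j \<in> A)
      \<le> event_prob \<beta> U (\<lambda>A. j \<in> cluster A ?W)"
    by (rule influence_le_cluster) (use assms in auto)
  also have "\<dots> \<le> event_prob \<beta> U (reaches (sup_dist x j - (radius x T + 1)) j)"
  proof (rule mean_mono[OF assms(1)])
    fix A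
    have "reaches (sup_dist x j - (radius x T + 1)) j A" if j: "j \<in> cluster A ?W"
    proof -
      obtain w where w: "w \<in> explored {x} T" "(w, j) \<in> (minus_bonds A)\<^sup>*" "j \<in> A"
        using j by (auto simp: cluster_def)
      then have "w \<in> cluster A {j}"
        using minus_bonds_rtrancl_sym[OF w(2)] minus_bonds_rtrancl_mem[OF w(2)] by (auto simp: cluster_def)
      \<comment> \<open>The additional \<open>1\<close> accounts for the plus spins adjacent to
        \<open>T\<close>, which are explored too.\<close>
      moreover have "sup_dist x w \<le> radius x T + 1"
      proof -
        consider "w = x" | "w \<in> T" | v where "v \<in> T" "adjacent v w"
          using w(1) by (auto simp: explored_def)
        then show ?thesis
        proof cases
          case 3
          then show ?thesis
            using sup_dist_triangle[of x w v] sup_dist_adjacent[of v w] sup_dist_le_radius[of T v x] assms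
            by simp
        qed (use sup_dist_le_radius[of T w x] assms in auto)
      qed
      then have "sup_dist x j - (radius x T + 1) \<le> sup_dist j w"
        using sup_dist_triangle[of x j w] sup_dist_commute[of w j] by simp
      ultimately show ?thesis by (auto simp: reaches_def)
    qed
    then show "of_bool (j \<in> cluster A ?W) \<le> (of_bool (reaches (sup_dist x j - (radius x T + 1)) j A) :: real)"
      by simp
  qed
  finally show ?thesis .
qed

section \<open>Connectedness and counting of contours\<close>

text \<open>\<open>H h t\<close> is the parity of the number of \<open>s\<close> between
  \<open>0\<close> and \<open>t\<close> with \<open>h s\<close>. A single \<open>H\<close> serves
  all \<open>h\<close>, so that equal functions get equal primitives.\<close>

lemma discrete_primitive_mod_2:
  "\<exists>H :: (int \<Rightarrow> bool) \<Rightarrow> int \<Rightarrow> bool. \<forall>h t. H h (t + 1) = (H h t \<noteq> h t)"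
proof -
  define B where "B h t = {s :: int. (0 \<le> s \<and> s < t \<or> t \<le> s \<and> s < 0) \<and> h s}" for h t
  have fin: "finite (B h t)" for h t
    by (rule finite_subset[of _ "{min 0 t..max 0 t}"]) (auto simp: B_def)
  have "odd (card (B h (t + 1))) = (odd (card (B h t)) \<noteq> h t)" for h t
  proof (cases "h t")
    case False
    then have "B h (t + 1) = B h t"
      unfolding B_def by (auto simp: order_le_less)
    then show ?thesis using False by simp
  next
    case True
    show ?thesis
    proof (cases "0 \<le> t")
      case t: True
      then have "B h (t + 1) = insert t (B h t)" "t \<notin> B h t"
        using True by (auto simp: B_def)
      then show ?thesis using True fin by simp
    next
      case t: False
      then have "B h t = insert t (B h (t + 1))" "t \<notin> B h (t + 1)"
        using True by (auto simp: B_def)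
      then show ?thesis using True fin by simp
    qed
  qed
  then show ?thesis by (intro exI[where x = "\<lambda>h t. odd (card (B h t))"]) auto
qed

text \<open>The directions are treated one after the other: once the cochain vanishes in the previous
  directions, it does not depend on the corresponding coordinates.\<close>

lemma closed_cochain_exact:
  fixes f :: "int ^ 'd::finite \<Rightarrow> 'd \<Rightarrow> bool"
  assumes closed: "\<And>x i j. (f x i \<noteq> f (x + axis i 1) j) = (f x j \<noteq> f (x + axis j 1) i)"
  shows "\<exists>\<phi> :: int ^ 'd \<Rightarrow> bool. \<forall>x i. f x i = (\<phi> x \<noteq> \<phi> (x + axis i 1))"
proof -
  obtain H :: "(int \<Rightarrow> bool) \<Rightarrow> int \<Rightarrow> bool"
    where H: "\<And>h t. H h (t + 1) = (H h t \<noteq> h t)"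
    using discrete_primitive_mod_2 by blast
  have "\<exists>\<phi> :: int ^ 'd \<Rightarrow> bool. \<forall>x. \<forall>i\<in>S. f x i = (\<phi> x \<noteq> \<phi> (x + axis i 1))" if "finite S" for S
    using that
  proof (induction S rule: finite_induct)
    case (insert k S)
    from insert.IH obtain \<phi> :: "int ^ 'd \<Rightarrow> bool" where "\<forall>x. \<forall>i\<in>S. f x i = (\<phi> x \<noteq> \<phi> (x + axis i 1))" ..
    then have \<phi>: "f x i = (\<phi> x \<noteq> \<phi> (x + axis i 1))" if "i \<in> S" for x i
      using that by blast
    \<comment> \<open>\<open>g\<close> is \<open>f\<close> minus the coboundary of \<phi> modulo 2.
      It is closed and vanishes in the directions of \<open>S\<close>, so its values in direction
      \<open>k\<close> are invariant under shifts along \<open>S\<close>.\<close>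
    define g where "g x i = (f x i \<noteq> (\<phi> x \<noteq> \<phi> (x + axis i 1)))" for x i
    have g_closed: "(g x i \<noteq> g (x + axis i 1) j) = (g x j \<noteq> g (x + axis j 1) i)" for x i j
      using closed[of x i j] by (auto simp: g_def add_ac)
    have g_S: "\<not> g x i" if "i \<in> S" for x i
      using \<phi>[OF that] by (auto simp: g_def)
    have g_k: "g (x + axis i 1) k = g x k" if "i \<in> S" for x i
      using g_closed[of x i k] g_S[OF that] by auto
    \<comment> \<open>\<open>c x\<close> records \<open>g\<close> in direction \<open>k\<close>
      along the line through \<open>x\<close> parallel to that axis; its primitive at
      \<open>x $ k\<close> is the correction to be added to \<phi>.\<close>
    define c where "c x t = g (\<chi> l. if l = k then t else x $ l) k" for x :: "int ^ 'd" and t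
    define \<psi> where "\<psi> x = H (c x) (x $ k)" for x
    have c_k: "c (x + axis k 1) = c x" for x
      by (rule ext) (auto simp: c_def axis_def intro!: arg_cong[where f = "\<lambda>y. g y k"] simp: vec_eq_iff)
    have "c x (x $ k) = g x k" for x
      by (auto simp: c_def intro!: arg_cong[where f = "\<lambda>y. g y k"] simp: vec_eq_iff)
    then have \<psi>_k: "\<psi> (x + axis k 1) = (\<psi> x \<noteq> g x k)" for x
      using H[of "c x" "x $ k"] by (simp add: \<psi>_def c_k)
    have \<psi>_S: "\<psi> (x + axis i 1) = \<psi> x" if "i \<in> S" for x i
    proof -
      have "i \<noteq> k" using that insert.hyps by auto
      then have "(\<chi> l. if l = k then t else (x + axis i 1) $ l) = (\<chi> l. if l = k then t else x $ l) + axis i 1" for t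
        by (auto simp: vec_eq_iff axis_def)
      then have "c (x + axis i 1) = c x"
        using g_k[OF that] by (auto simp: c_def fun_eq_iff)
      then show ?thesis using \<open>i \<noteq> k\<close> by (simp add: \<psi>_def axis_def)
    qed
    have "f x i = ((\<phi> x \<noteq> \<psi> x) \<noteq> (\<phi> (x + axis i 1) \<noteq> \<psi> (x + axis i 1)))" if "i \<in> insert k S" for x i
    proof (cases "i = k")
      case True
      then show ?thesis using \<psi>_k[of x] by (auto simp: g_def)
    next
      case False
      then show ?thesis using \<phi>[of i x] \<psi>_S[of i x] that by auto
    qed
    then show ?case by (intro exI[where x = "\<lambda>x. \<phi> x \<noteq> \<psi> x"]) blast
  qed simp
  from this[of UNIV] show ?thesis by simp
qed

text \<open>Bonds are compared by their lower end points; distance \<open>1\<close> suffices to put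
  the four bonds of a unit square near one another.\<close>

definition near :: "(int ^ 'd::finite) \<times> 'd \<Rightarrow> ((int ^ 'd) \<times> 'd) set" where
  "near e = {f. sup_dist (fst e) (fst f) \<le> 1}"

text \<open>Connectedness is phrased by closed subsets instead of paths: the coboundary argument
  starts from such a subset, and the covering walk needs a bond that leaves it.\<close>

definition near_connected :: "((int ^ 'd::finite) \<times> 'd) set \<Rightarrow> bool" where
  "near_connected S \<longleftrightarrow>
     (\<forall>T\<subseteq>S. T \<noteq> {} \<and> (\<forall>e\<in>T. \<forall>f\<in>S. f \<in> near e \<longrightarrow> f \<in> T) \<longrightarrow> T = S)"

lemma near_sym: "f \<in> near e \<longleftrightarrow> e \<in> near f"
  by (simp add: near_def sup_dist_commute)

lemma near_square:
  "{(x, i), (x + axis i 1, j), (x, j), (x + axis j 1, i)} \<subseteq> near e"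
  if "e \<in> {(x, i), (x + axis i 1, j), (x, j), (x + axis j 1, i)}"
  using that by (auto simp: near_def sup_dist_le_iff axis_def)

text \<open>Timar's argument: a part \<open>P\<close> of the boundary that is not near to the rest meets every unit
  square in an even number of bonds, so it is the coboundary of a function, which is constant on
  both sides of the boundary.\<close>

lemma near_connected_edge_boundary:
  fixes D K :: "(int ^ 'd::finite) set"
  assumes K: "\<And>x y. x \<in> K \<Longrightarrow> y \<in> K \<Longrightarrow> (x, y) \<in> (minus_bonds K)\<^sup>*"
    and D: "\<And>x y. x \<in> D \<Longrightarrow> y \<in> D \<Longrightarrow> (x, y) \<in> (minus_bonds (- K))\<^sup>*"
    and disj: "D \<inter> K = {}"
    and sep: "\<And>x y. x \<in> D \<Longrightarrow> y \<notin> D \<Longrightarrow> adjacent x y \<Longrightarrow> y \<in> K"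
  shows "near_connected (edge_boundary D)"
  unfolding near_connected_def
proof (intro allI impI, elim conjE)
  fix P assume P: "P \<subseteq> edge_boundary D" "P \<noteq> {}"
    and closedP: "\<forall>e\<in>P. \<forall>f\<in>edge_boundary D. f \<in> near e \<longrightarrow> f \<in> P"
  define f where "f x i = ((x, i) \<in> P)" for x i
  have "(f x i \<noteq> f (x + axis i 1) j) = (f x j \<noteq> f (x + axis j 1) i)" for x i j
  proof -
    \<comment> \<open>The bonds of the unit square at \<open>x\<close> in directions
      \<open>i\<close> and \<open>j\<close>. If \<open>P\<close> contains one of them, it agrees
      with the whole boundary on the square, and the boundary of a set meets a closed loop
      evenly.\<close>
    let ?Q = "{(x, i), (x + axis i 1, j), (x, j), (x + axis j 1, i)}"
    show ?thesis
    proof (cases "?Q \<inter> P = {}")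
      case True
      then show ?thesis by (auto simp: f_def)
    next
      case False
      then obtain e where "e \<in> ?Q" "e \<in> P" by blast
      then have "e' \<in> P \<longleftrightarrow> e' \<in> edge_boundary D" if "e' \<in> ?Q" for e'
        using near_square[of e x i j] closedP P(1) that by blast
      then have "f x i = ((x, i) \<in> edge_boundary D)"
        "f (x + axis i 1) j = ((x + axis i 1, j) \<in> edge_boundary D)"
        "f x j = ((x, j) \<in> edge_boundary D)"
        "f (x + axis j 1) i = ((x + axis j 1, i) \<in> edge_boundary D)"
        by (simp_all add: f_def)
      moreover have "x + axis i 1 + axis j 1 = x + axis j 1 + axis i (1::int)"
        by (simp add: add_ac)
      ultimately show ?thesis by (auto simp: edge_boundary_def)
    qed
  qed
  then have "\<exists>\<phi> :: int ^ 'd \<Rightarrow> bool. \<forall>x i. f x i = (\<phi> x \<noteq> \<phi> (x + axis i 1))"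
    by (rule closed_cochain_exact)
  then obtain \<phi> :: "int ^ 'd \<Rightarrow> bool" where \<phi>: "\<And>x i. f x i = (\<phi> x \<noteq> \<phi> (x + axis i 1))"
    by blast
  have step: "\<phi> x = \<phi> y" if xy: "adjacent x y" "x \<in> D \<longleftrightarrow> y \<in> D" for x y
  proof -
    obtain i where "y = x + axis i 1 \<or> x = y + axis i 1"
      using xy(1) unfolding adjacent_def by blast
    then show ?thesis
      using \<phi>[of x i] \<phi>[of y i] P(1) xy(2) by (auto simp: f_def edge_boundary_def)
  qed
  have constK: "\<phi> x = \<phi> y" if "x \<in> K" "y \<in> K" for x y
    using K[OF that]
  proof (induction rule: rtrancl_induct)
    case (step y z)
    then show ?case
      using \<open>\<And>y x. adjacent x y \<Longrightarrow> x \<in> D \<longleftrightarrow> y \<in> D \<Longrightarrow> \<phi> x = \<phi> y\<close>[of y z] disj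
      by (auto simp: minus_bonds_def)
  qed simp
  have constD: "\<phi> x = \<phi> y" if "x \<in> D" "y \<in> D" for x y
    using D[OF that]
  proof (induction rule: rtrancl_induct)
    case (step y z)
    \<comment> \<open>A path that avoids \<open>K\<close> cannot leave \<open>D\<close>, because
      \<open>sep\<close> puts the outer neighbours of \<open>D\<close> into
      \<open>K\<close>.\<close>
    then have "y \<notin> K" "z \<notin> K" "adjacent y z" by (auto simp: minus_bonds_def)
    then have "y \<in> D \<longleftrightarrow> z \<in> D" using sep[of y z] sep[of z y] adjacent_commute by blast
    then show ?case
      using step.IH \<open>\<And>y x. adjacent x y \<Longrightarrow> x \<in> D \<longleftrightarrow> y \<in> D \<Longrightarrow> \<phi> x = \<phi> y\<close>[of y z] \<open>adjacent y z\<close>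
      by simp
  qed simp
  \<comment> \<open>Every boundary bond joins \<open>D\<close> to \<open>K\<close>, and \<phi> is
    constant on each. Hence a jump of \<phi> across one bond, which \<open>P \<noteq> {}\<close>
    provides, forces a jump across all.\<close>
  have ends: "\<exists>a\<in>D. \<exists>b\<in>K. {x, x + axis i 1} = {a, b}" if xi: "(x, i) \<in> edge_boundary D" for x i
  proof -
    have adj: "adjacent x (x + axis i 1)" "adjacent (x + axis i 1) x"
      by (auto simp: adjacent_def)
    consider "x \<in> D" "x + axis i 1 \<notin> D" | "x \<notin> D" "x + axis i 1 \<in> D"
      using xi by (auto simp: edge_boundary_def)
    then show ?thesis
    proof cases
      case 1
      then show ?thesis using sep[of x "x + axis i 1"] adj by blast
    next
      case 2
      then show ?thesis using sep[of "x + axis i 1" x] adj by (metis insert_commute)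
    qed
  qed
  obtain x\<^sub>0 i\<^sub>0 where e0: "(x\<^sub>0, i\<^sub>0) \<in> P" using P(2) by auto
  show "P = edge_boundary D"
  proof (intro equalityI P(1) subsetI)
    fix e assume e: "e \<in> edge_boundary D"
    obtain x i where xi: "e = (x, i)" by (cases e)
    obtain a b where ab: "a \<in> D" "b \<in> K" "{x, x + axis i 1} = {a, b}"
      using ends[of x i] e xi by auto
    obtain a\<^sub>0 b\<^sub>0 where ab0: "a\<^sub>0 \<in> D" "b\<^sub>0 \<in> K" "{x\<^sub>0, x\<^sub>0 + axis i\<^sub>0 1} = {a\<^sub>0, b\<^sub>0}"
      using ends[of x\<^sub>0 i\<^sub>0] e0 P(1) by auto
    have "f x\<^sub>0 i\<^sub>0" using e0 by (simp add: f_def)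
    then have "\<phi> a\<^sub>0 \<noteq> \<phi> b\<^sub>0"
      unfolding \<phi> using ab0(3) by (auto simp: doubleton_eq_iff)
    then have "\<phi> a \<noteq> \<phi> b"
      using constD[OF ab(1) ab0(1)] constK[OF ab(2) ab0(2)] by simp
    then have "f x i" unfolding \<phi> using ab(3) by (auto simp: doubleton_eq_iff)
    then show "e \<in> P" by (simp add: xi f_def)
  qed
qed

section \<open>Counting connected sets by the walks that cover them\<close>

fun walks :: "('e \<Rightarrow> 'e set) \<Rightarrow> nat \<Rightarrow> 'e \<Rightarrow> 'e list set" where
  "walks N 0 e = {[e]}"
| "walks N (Suc m) e = (\<Union>f\<in>N e. (#) e ` walks N m f)"

lemma finite_walks:
  assumes "\<And>e. finite (N e)"
  shows "finite (walks N m e)"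
  by (induction m arbitrary: e) (simp_all add: assms)

lemma card_walks:
  assumes "\<And>e. finite (N e)" "\<And>e. card (N e) \<le> k"
  shows "card (walks N m e) \<le> k ^ m"
proof (induction m arbitrary: e)
  case (Suc m)
  have "card (walks N (Suc m) e) \<le> (\<Sum>f\<in>N e. card ((#) e ` walks N m f))"
    unfolding walks.simps by (rule card_UN_le) (rule assms)
  also have "\<dots> \<le> (\<Sum>f\<in>N e. k ^ m)"
    by (rule sum_mono) (meson Suc card_image_le finite_walks assms(1) le_trans)
  also have "\<dots> \<le> k * k ^ m" using assms(2)[of e] by simp
  finally show ?case by simp
qed simp

lemma walk_hd: "p \<in> walks N m e \<Longrightarrow> \<exists>q. p = e # q"
  by (cases m) auto

lemma walk_detour:
  assumes "p \<in> walks N m e" "s \<in> set p" "v \<in> N s" "s \<in> N v"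
  shows "\<exists>p'\<in>walks N (m + 2) e. set p' = insert v (set p)"
  using assms(1,2)
proof (induction m arbitrary: e p)
  case 0
  then have "p = [e]" "s = e" by auto
  then have "[e, v, e] \<in> walks N (0 + 2) e" using assms by (auto simp: numeral_2_eq_2)
  then show ?case using \<open>p = [e]\<close> by (intro bexI[where x = "[e, v, e]"]) auto
next
  case (Suc m)
  obtain f q where q: "p = e # q" "f \<in> N e" "q \<in> walks N m f" using Suc.prems by auto
  show ?case
  proof (cases "s = e")
    case True
    have "v # p \<in> walks N (Suc (Suc m)) v"
      using True assms(4) Suc.prems(1) by (subst walks.simps(2)) blast
    then have "e # v # p \<in> walks N (Suc (Suc (Suc m))) e"
      using True assms(3) by (subst walks.simps(2)) blast
    then have "e # v # p \<in> walks N (Suc m + 2) e" by simp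
    then show ?thesis using q by (intro bexI[where x = "e # v # p"]) auto
  next
    case False
    then have "s \<in> set q" using Suc.prems(2) q(1) by simp
    then obtain q' where q': "q' \<in> walks N (m + 2) f" "set q' = insert v (set q)"
      using Suc.IH[OF q(3)] by blast
    have "e # q' \<in> walks N (Suc (m + 2)) e"
      using q(2) q'(1) by (subst walks.simps(2)) blast
    moreover have "set (e # q') = insert v (set p)" using q(1) q'(2) by auto
    ultimately show ?thesis by (metis add_Suc)
  qed
qed

text \<open>Grow the walk by detours \<open>s, v, s\<close> to a new neighbour \<open>v\<close>.
  Each of the \<open>card S - 1\<close> further elements costs two steps.\<close>

lemma covering_walk:
  assumes "finite S" "e \<in> S"
    and conn: "\<And>T. T \<subseteq> S \<Longrightarrow> e \<in> T \<Longrightarrow> T \<noteq> S \<Longrightarrow> \<exists>s\<in>T. \<exists>v\<in>S - T. v \<in> N s \<and> s \<in> N v"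
  shows "\<exists>p\<in>walks N (2 * (card S - 1)) e. set p = S"
proof -
  have "n < card S \<Longrightarrow> \<exists>p\<in>walks N (2 * n) e. set p \<subseteq> S \<and> card (set p) = Suc n" for n
  proof (induction n)
    case 0
    then show ?case using assms by auto
  next
    case (Suc n)
    then obtain p where p: "p \<in> walks N (2 * n) e" "set p \<subseteq> S" "card (set p) = Suc n"
      by auto
    have "e \<in> set p" using walk_hd[OF p(1)] by auto
    moreover have "set p \<noteq> S" using p Suc.prems by auto
    ultimately obtain s v where sv: "s \<in> set p" "v \<in> S - set p" "v \<in> N s" "s \<in> N v"
      using conn p(2) by blast
    obtain p' where p': "p' \<in> walks N (2 * n + 2) e" "set p' = insert v (set p)"
      using walk_detour[OF p(1) sv(1,3,4)] by blast
    have "set p' \<subseteq> S \<and> card (set p') = Suc (Suc n)" using sv(2) p(2,3) p'(2) by simp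
    moreover have "2 * n + 2 = 2 * Suc n" by simp
    ultimately show ?case using p'(1) by metis
  qed
  from this[of "card S - 1"] obtain p
    where p: "p \<in> walks N (2 * (card S - 1)) e" "set p \<subseteq> S" "card (set p) = Suc (card S - 1)"
    using assms card_gt_0_iff by fastforce
  moreover have "card S > 0" using assms card_gt_0_iff by blast
  ultimately have "set p = S" using card_subset_eq[OF assms(1) p(2)] by simp
  then show ?thesis using p by blast
qed

lemma finite_sup_ball: "finite {y :: int ^ 'd::finite. sup_dist x y \<le> n}"
proof (rule finite_subset)
  show "{y. sup_dist x y \<le> n} \<subseteq> vec_lambda ` Pi\<^sub>E UNIV (\<lambda>i. {x $ i - int n..x $ i + int n})"
  proof
    fix y assume "y \<in> {y. sup_dist x y \<le> n}"
    then have "vec_nth y \<in> Pi\<^sub>E UNIV (\<lambda>i. {x $ i - int n..x $ i + int n})"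
      by (auto simp: PiE_def Pi_def sup_dist_le_iff abs_le_iff algebra_simps)
    then show "y \<in> vec_lambda ` Pi\<^sub>E UNIV (\<lambda>i. {x $ i - int n..x $ i + int n})"
      by (metis image_eqI vec_nth_inverse)
  qed
qed (intro finite_imageI finite_PiE, auto)

definition near_degree :: "'d::finite itself \<Rightarrow> nat" where
  "near_degree _ = card ({v :: int ^ 'd. sup_dist 0 v \<le> 1} \<times> (UNIV :: 'd set))"

lemma near_finite_card:
  fixes e :: "(int ^ 'd::finite) \<times> 'd"
  shows "finite (near e) \<and> card (near e) \<le> near_degree TYPE('d)"
proof -
  let ?B = "{v :: int ^ 'd. sup_dist 0 v \<le> 1} \<times> (UNIV :: 'd set)"
  have fin: "finite ?B" by (intro finite_cartesian_product finite_sup_ball finite)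
  have sub: "near e \<subseteq> (\<lambda>(v, i). (fst e + v, i)) ` ?B"
  proof
    fix f assume "f \<in> near e"
    then have "(fst f - fst e, snd f) \<in> ?B"
      by (auto simp: near_def sup_dist_le_iff abs_minus_commute)
    then show "f \<in> (\<lambda>(v, i). (fst e + v, i)) ` ?B"
      by (rule rev_image_eqI) (cases f, simp)
  qed
  have "card (near e) \<le> card ((\<lambda>(v, i). (fst e + v, i)) ` ?B)"
    using sub fin by (intro card_mono) auto
  also have "\<dots> \<le> near_degree TYPE('d)"
    unfolding near_degree_def using fin by (rule card_image_le)
  finally show ?thesis using sub fin finite_subset by blast
qed

text \<open>Such a set is covered by a walk of \<open>2 * (n - 1)\<close> steps from
  \<open>e\<close>, each step having at most \<open>near_degree\<close> choices.\<close>

lemma card_contours: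
  fixes e :: "(int ^ 'd::finite) \<times> 'd"
  shows "finite {S. finite S \<and> e \<in> S \<and> card S = n \<and> near_connected S}"
    "card {S. finite S \<and> e \<in> S \<and> card S = n \<and> near_connected S} \<le> near_degree TYPE('d) ^ (2 * (n - 1))"
proof -
  let ?C = "{S. finite S \<and> e \<in> S \<and> card S = n \<and> near_connected S}"
  let ?W = "walks near (2 * (n - 1)) e"
  have sub: "?C \<subseteq> set ` ?W"
  proof
    fix S assume "S \<in> ?C"
    then have S: "finite S" "e \<in> S" "card S = n" "near_connected S" by auto
    have "\<exists>p\<in>walks near (2 * (card S - 1)) e. set p = S"
    proof (rule covering_walk[OF S(1,2)])
      fix T assume "T \<subseteq> S" "e \<in> T" "T \<noteq> S"
      then obtain s v where "s \<in> T" "v \<in> S" "v \<in> near s" "v \<notin> T"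
        using S(4) unfolding near_connected_def by blast
      then show "\<exists>s\<in>T. \<exists>v\<in>S - T. v \<in> near s \<and> s \<in> near v"
        using near_sym by blast
    qed
    then show "S \<in> set ` ?W" using S(3) by blast
  qed
  have finW: "finite ?W" by (rule finite_walks) (use near_finite_card in blast)
  show "finite ?C" using sub finW finite_subset by blast
  have "card ?C \<le> card (set ` ?W)" using sub finW by (intro card_mono) auto
  also have "\<dots> \<le> card ?W" using finW by (rule card_image_le)
  also have "\<dots> \<le> near_degree TYPE('d) ^ (2 * (n - 1))"
    by (rule card_walks) (use near_finite_card in blast)+
  finally show "card ?C \<le> near_degree TYPE('d) ^ (2 * (n - 1))" .
qed

section \<open>The Peierls estimate\<close>

lemma finite_exit:
  fixes H :: "(int ^ 'd::finite) set"
  assumes "finite H" "z \<in> H"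
  shows "\<exists>s. (z + axis k (int s), k) \<in> edge_boundary H \<and> (\<forall>s'\<le>s. z + axis k (int s') \<in> H)"
proof -
  have "inj (\<lambda>s. z + axis k (int s))"
    by (auto simp: inj_def axis_eq_axis)
  then have "\<not> (\<forall>s. z + axis k (int s) \<in> H)"
    using assms(1) finite_subset[of "range (\<lambda>s. z + axis k (int s))" H] range_inj_infinite by blast
  then have "\<exists>s. z + axis k (int s) \<notin> H" by blast
  then obtain t where t: "z + axis k (int t) \<notin> H" "\<forall>s<t. z + axis k (int s) \<in> H"
    using exists_least_iff[of "\<lambda>s. z + axis k (int s) \<notin> H"] by blast
  have "z + axis k (int 0) = z" by (simp add: axis_def vec_eq_iff)
  then have "t \<noteq> 0" using t(1) assms(2) by metis
  then obtain s where s: "t = Suc s" by (cases t) auto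
  have "axis k (int s) + axis k 1 = axis k (int t)"
    unfolding s by (vector axis_def)
  then have "z + axis k (int s) + axis k 1 \<notin> H"
    using t(1) by (simp only: add.assoc not_False_eq_True)
  moreover have in_H: "z + axis k (int s') \<in> H" if "s' \<le> s" for s'
    using t(2) that s by (simp add: less_Suc_eq_le)
  ultimately have "(z + axis k (int s), k) \<in> edge_boundary H"
    unfolding edge_boundary_def by blast
  then show ?thesis using in_H by blast
qed

text \<open>The symmetric difference of the two sets would be finite and have empty boundary,
  although every line through one of its points has to leave it. Sums over filled clusters thereby
  become sums over contours.\<close>

lemma edge_boundary_injective:
  fixes H H' :: "(int ^ 'd::finite) set"
  assumes "finite H" "finite H'" "edge_boundary H = edge_boundary H'"
  shows "H = H'"
proof (rule ccontr)
  assume "H \<noteq> H'"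
  define M where "M = {x. (x \<in> H) \<noteq> (x \<in> H')}"
  have "finite M"
    by (rule finite_subset[of _ "H \<union> H'"]) (use assms in \<open>auto simp: M_def\<close>)
  moreover obtain z where "z \<in> M" using \<open>H \<noteq> H'\<close> by (auto simp: M_def)
  ultimately have "edge_boundary M \<noteq> {}" using finite_exit by blast
  then obtain x i where "(x \<in> M) \<noteq> (x + axis i 1 \<in> M)" by (auto simp: edge_boundary_def)
  moreover have "((x, i) \<in> edge_boundary H) = ((x, i) \<in> edge_boundary H')" using assms by simp
  ultimately show False by (auto simp: M_def edge_boundary_def)
qed

lemma exists_other_direction:
  assumes "2 \<le> CARD('d::finite)"
  shows "\<exists>k :: 'd. k \<noteq> i"
proof (rule ccontr)
  assume "\<not> (\<exists>k. k \<noteq> i)"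
  then have "UNIV = {i}" by auto
  then have "CARD('d) = card {i}" by simp
  then show False using assms by simp
qed

text \<open>Each slice of a finite set contributes a boundary bond orthogonal to the slicing direction.\<close>

lemma slices_le_card_edge_boundary:
  fixes H :: "(int ^ 'd::finite) set"
  assumes "2 \<le> CARD('d)" "finite H"
    and "\<And>t. a \<le> t \<Longrightarrow> t \<le> a + int n \<Longrightarrow> \<exists>z\<in>H. z $ i = t"
  shows "n + 1 \<le> card (edge_boundary H)"
proof -
  obtain k :: 'd where k: "k \<noteq> i" using exists_other_direction[OF assms(1)] by blast
  have fin: "finite (edge_boundary H)" using assms(2) by (rule finite_edge_boundary)
  have "{a..a + int n} \<subseteq> (\<lambda>e. fst e $ i) ` edge_boundary H"
  proof
    fix t assume "t \<in> {a..a + int n}"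
    then obtain z where z: "z \<in> H" "z $ i = t" using assms(3)[of t] by auto
    obtain s where "(z + axis k (int s), k) \<in> edge_boundary H"
      using finite_exit[OF assms(2) z(1)] by blast
    moreover have "(z + axis k (int s)) $ i = t" using z k by (simp add: axis_def)
    ultimately show "t \<in> (\<lambda>e. fst e $ i) ` edge_boundary H" by force
  qed
  then have "card {a..a + int n} \<le> card ((\<lambda>e. fst e $ i) ` edge_boundary H)"
    using fin by (intro card_mono) auto
  also have "\<dots> \<le> card (edge_boundary H)" using fin by (rule card_image_le)
  finally show ?thesis by simp
qed

lemma path_intermediate_value:
  assumes "(x, y) \<in> (minus_bonds K)\<^sup>*" "x \<in> K" "min (x $ i) (y $ i) \<le> t" "t \<le> max (x $ i) (y $ i)"
  shows "\<exists>z\<in>K. z $ i = t"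
  using assms(1,3,4)
proof (induction arbitrary: t rule: rtrancl_induct)
  case base
  then show ?case using assms(2) by auto
next
  case (step y z)
  have "\<bar>y $ i - z $ i\<bar> \<le> 1"
    using sup_dist_adjacent[of y z] step(2) by (auto simp: sup_dist_le_iff minus_bonds_def)
  then have "t = z $ i \<or> (min (x $ i) (y $ i) \<le> t \<and> t \<le> max (x $ i) (y $ i))"
    using step.prems by (auto simp: min_def max_def split: if_splits)
  then show ?case using step.IH step(2) by (auto simp: minus_bonds_def)
qed

text \<open>In the coordinate that realizes the distance, the path meets every slice between its
  ends. This is where dimension two or more enters: in dimension one an interval of any length has
  two boundary bonds.\<close>

lemma sup_dist_less_card_edge_boundary:
  fixes H K :: "(int ^ 'd::finite) set"
  assumes "2 \<le> CARD('d)" "finite H" "K \<subseteq> H" "x \<in> K" "(x, y) \<in> (minus_bonds K)\<^sup>*"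
  shows "sup_dist x y + 1 \<le> card (edge_boundary H)"
proof -
  obtain i where i: "int (sup_dist x y) = \<bar>x $ i - y $ i\<bar>" using sup_dist_attained by blast
  show ?thesis
  proof (rule slices_le_card_edge_boundary[OF assms(1,2)])
    fix t assume "min (x $ i) (y $ i) \<le> t" "t \<le> min (x $ i) (y $ i) + int (sup_dist x y)"
    then show "\<exists>z\<in>H. z $ i = t"
      using path_intermediate_value[OF assms(5,4), of i t] assms(3) i by fastforce
  qed
qed

text \<open>The sites of the ray before its first exit lie in different slices, so their number is
  at most that of the boundary bonds. A contour of size \<open>m\<close> around \<open>x\<close>
  thus contains one of \<open>m\<close> prescribed bonds.\<close>

lemma exit_less_card_edge_boundary:
  fixes H :: "(int ^ 'd::finite) set"
  assumes "2 \<le> CARD('d)" "finite H" "x \<in> H"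
  shows "\<exists>s<card (edge_boundary H). (x + axis k (int s), k) \<in> edge_boundary H"
proof -
  obtain s where s: "(x + axis k (int s), k) \<in> edge_boundary H" "\<forall>s'\<le>s. x + axis k (int s') \<in> H"
    using finite_exit[OF assms(2,3)] by blast
  have "s + 1 \<le> card (edge_boundary H)"
  proof (rule slices_le_card_edge_boundary[OF assms(1,2)])
    fix t assume t: "x $ k \<le> t" "t \<le> x $ k + int s"
    have "x + axis k (int (nat (t - x $ k))) \<in> H"
      by (intro s(2)[rule_format]) (use t in linarith)
    then show "\<exists>z\<in>H. z $ k = t" using t by (intro bexI) (auto simp: axis_def)
  qed
  then show ?thesis using s(1) by (intro exI[of _ s]) simp
qed

section \<open>Connectedness of the complement of a box\<close>

lemma line_connected:
  fixes z :: "int ^ 'd::finite"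
  assumes "\<And>t. (\<chi> l. if l = k then t else z $ l) \<in> S"
  shows "((\<chi> l. if l = k then a else z $ l), (\<chi> l. if l = k then b else z $ l)) \<in> (minus_bonds S)\<^sup>*"
proof -
  let ?p = "\<lambda>t. (\<chi> l. if l = k then t else z $ l)"
  have step: "(?p t, ?p (t + 1)) \<in> minus_bonds S" for t
  proof -
    have "?p (t + 1) = ?p t + axis k 1" by (auto simp: vec_eq_iff axis_def)
    then show ?thesis using assms[of t] assms[of "t + 1"] by (auto simp: minus_bonds_def adjacent_def)
  qed
  have up: "(?p a, ?p (a + int n)) \<in> (minus_bonds S)\<^sup>*" for a n
  proof (induction n)
    case (Suc n)
    have "(?p (a + int n), ?p (a + int (Suc n))) \<in> minus_bonds S"
      using step[of "a + int n"] by (simp only: of_nat_Suc add_ac)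
    then show ?case using Suc by (rule_tac rtrancl_into_rtrancl)
  qed (simp only: of_nat_0 add_0_right rtrancl.rtrancl_refl)
  show ?thesis
  proof (cases "a \<le> b")
    case True
    then have "a + int (nat (b - a)) = b" by simp
    then show ?thesis using up[of a "nat (b - a)"] by (simp only:)
  next
    case False
    then have "b + int (nat (a - b)) = a" by simp
    then have "(?p b, ?p a) \<in> (minus_bonds S)\<^sup>*" using up[of b "nat (a - b)"] by (simp only:)
    then show ?thesis by (rule minus_bonds_rtrancl_sym)
  qed
qed

lemma outside_box_slice_connected:
  fixes z w :: "int ^ 'd::finite"
  assumes "int n < \<bar>z $ i\<bar>" "w $ i = z $ i"
  shows "(z, w) \<in> (minus_bonds {y. n < sup_dist 0 y})\<^sup>*"
proof -
  let ?S = "{y :: int ^ 'd. n < sup_dist 0 y}"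
  have out: "v \<in> ?S" if "v $ i = z $ i" for v :: "int ^ 'd"
    using coordinate_le_sup_dist[of 0 i v] that assms(1) by simp
  have "(z, \<chi> l. if l \<in> C then w $ l else z $ l) \<in> (minus_bonds ?S)\<^sup>*" if "finite C" "i \<notin> C" for C
    using that
  proof (induction C rule: finite_induct)
    case empty
    then show ?case by simp
  next
    case (insert k C)
    let ?v = "\<chi> l. if l \<in> C then w $ l else z $ l"
    have "((\<chi> l. if l = k then ?v $ k else ?v $ l), (\<chi> l. if l = k then w $ k else ?v $ l)) \<in> (minus_bonds ?S)\<^sup>*"
      by (rule line_connected) (use insert.prems in \<open>intro out, auto\<close>)
    moreover have "(\<chi> l. if l = k then ?v $ k else ?v $ l) = ?v" by (simp add: vec_eq_iff)
    moreover have "(\<chi> l. if l = k then w $ k else ?v $ l) = (\<chi> l. if l \<in> insert k C then w $ l else z $ l)"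
      by (auto simp: vec_eq_iff)
    ultimately have "(?v, \<chi> l. if l \<in> insert k C then w $ l else z $ l) \<in> (minus_bonds ?S)\<^sup>*"
      by simp
    with insert.IH insert.prems show ?case by (auto intro: rtrancl_trans)
  qed
  from this[of "- {i}"] have "(z, \<chi> l. if l \<in> - {i} then w $ l else z $ l) \<in> (minus_bonds ?S)\<^sup>*"
    by simp
  moreover have "(\<chi> l. if l \<in> - {i} then w $ l else z $ l) = w"
    using assms(2) by (auto simp: vec_eq_iff)
  ultimately show ?thesis by simp
qed

text \<open>Every outer point is joined to the corner \<open>?c\<close>: keep a coordinate that is
  large in absolute value while the others move to \<open>n + 1\<close>, then keep one of those
  while the first one moves. Two directions are required.\<close>

lemma outside_box_connected:
  fixes z w :: "int ^ 'd::finite"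
  assumes "2 \<le> CARD('d)" "n < sup_dist 0 z" "n < sup_dist 0 w"
  shows "(z, w) \<in> (minus_bonds {y. n < sup_dist 0 y})\<^sup>*"
proof -
  let ?S = "{y :: int ^ 'd. n < sup_dist 0 y}"
  let ?c = "(\<chi> l. int n + 1) :: int ^ 'd"
  have *: "(v, ?c) \<in> (minus_bonds ?S)\<^sup>*" if v: "n < sup_dist 0 v" for v :: "int ^ 'd"
  proof -
    obtain i where i: "int (sup_dist 0 v) = \<bar>v $ i\<bar>" using sup_dist_attained[of 0 v] by auto
    obtain k where k: "k \<noteq> i" using exists_other_direction[OF assms(1)] by blast
    let ?v = "\<chi> l. if l = i then v $ i else int n + 1"
    have "(v, ?v) \<in> (minus_bonds ?S)\<^sup>*"
      by (rule outside_box_slice_connected[of n v i]) (use v i in auto)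
    moreover have "(?v, ?c) \<in> (minus_bonds ?S)\<^sup>*"
      by (rule outside_box_slice_connected[of n ?v k]) (use k in auto)
    ultimately show ?thesis by (rule rtrancl_trans)
  qed
  show ?thesis
    using *[OF assms(2)] minus_bonds_rtrancl_sym[OF *[OF assms(3)]] by (rule rtrancl_trans)
qed

section \<open>Filling the holes of a cluster, and the Peierls flip\<close>

definition exterior :: "nat \<Rightarrow> (int ^ 'd::finite) set \<Rightarrow> (int ^ 'd) set" where
  "exterior n K = {y. y \<notin> K \<and> (\<exists>z. n < sup_dist 0 z \<and> (y, z) \<in> (minus_bonds (- K))\<^sup>*)}"

lemma exterior_sep:
  assumes "y \<in> exterior n K" "z \<notin> exterior n K" "adjacent y z"
  shows "z \<in> K"
proof (rule ccontr)
  assume "z \<notin> K"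
  obtain v where v: "y \<notin> K" "n < sup_dist 0 v" "(y, v) \<in> (minus_bonds (- K))\<^sup>*"
    using assms(1) by (auto simp: exterior_def)
  have "(z, y) \<in> minus_bonds (- K)"
    using \<open>z \<notin> K\<close> v(1) assms(3) by (simp add: minus_bonds_def adjacent_commute)
  then have "(z, v) \<in> (minus_bonds (- K))\<^sup>*"
    using v(3) by (rule converse_rtrancl_into_rtrancl)
  then show False using assms(2) \<open>z \<notin> K\<close> v(2) by (auto simp: exterior_def)
qed

text \<open>The cluster of \<open>x\<close> with its holes filled, so that only the outer contour is
  left. The box of radius \<open>n\<close> contains \<open>A\<close> in all uses, and being joined
  to its complement stands for lying in the infinite component.\<close>

definition filling :: "nat \<Rightarrow> int ^ 'd::finite \<Rightarrow> (int ^ 'd) set \<Rightarrow> (int ^ 'd) set" where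
  "filling n x A = - exterior n (cluster A {x})"

context
  fixes n :: nat and x :: "int ^ 'd::finite" and A :: "(int ^ 'd) set"
  assumes d: "2 \<le> CARD('d)" and A: "A \<subseteq> {y. sup_dist 0 y \<le> n}" and x: "x \<in> A"
begin

lemma cluster_subset_box: "cluster A {x} \<subseteq> {y. sup_dist 0 y \<le> n}"
  using A cluster_subset by blast

lemma filling_subset_box: "filling n x A \<subseteq> {y. sup_dist 0 y \<le> n}"
proof
  fix y assume y: "y \<in> filling n x A"
  show "y \<in> {y. sup_dist 0 y \<le> n}"
  proof (rule ccontr)
    assume "y \<notin> {y. sup_dist 0 y \<le> n}"
    then have "n < sup_dist 0 y" "y \<notin> cluster A {x}" using cluster_subset_box by auto
    then have "y \<in> exterior n (cluster A {x})" by (auto simp: exterior_def)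
    then show False using y by (simp add: filling_def)
  qed
qed

lemma finite_filling: "finite (filling n x A)"
  using filling_subset_box finite_sup_ball finite_subset by blast

lemma cluster_subset_filling: "cluster A {x} \<subseteq> filling n x A"
  by (auto simp: filling_def exterior_def)

lemma mem_filling: "x \<in> filling n x A"
  using cluster_subset_filling cluster_base[of x A "{x}"] x by blast

lemma edge_boundary_filling_eq: "edge_boundary (filling n x A) = edge_boundary (exterior n (cluster A {x}))"
  by (auto simp: filling_def edge_boundary_def)

text \<open>The cluster is connected, and the exterior is connected through the complement of the
  box; their common boundary is therefore a single contour.\<close>

lemma near_connected_filling: "near_connected (edge_boundary (filling n x A))"
  unfolding edge_boundary_filling_eq
proof (rule near_connected_edge_boundary[where K = "cluster A {x}"])
  let ?K = "cluster A {x}"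
  have from_x: "(x, y) \<in> (minus_bonds ?K)\<^sup>*" if "y \<in> ?K" for y
    using that by (intro cluster_connected) (auto simp: cluster_def)
  show "(y, z) \<in> (minus_bonds ?K)\<^sup>*" if "y \<in> ?K" "z \<in> ?K" for y z
    using minus_bonds_rtrancl_sym[OF from_x[OF that(1)]] from_x[OF that(2)] by (rule rtrancl_trans)
  show "(y, z) \<in> (minus_bonds (- ?K))\<^sup>*" if yz: "y \<in> exterior n ?K" "z \<in> exterior n ?K" for y z
  proof -
    obtain y' z' where *: "n < sup_dist 0 y'" "(y, y') \<in> (minus_bonds (- ?K))\<^sup>*"
        "n < sup_dist 0 z'" "(z, z') \<in> (minus_bonds (- ?K))\<^sup>*"
      using yz by (auto simp: exterior_def)
    have "(y', z') \<in> (minus_bonds (- ?K))\<^sup>*"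
      using outside_box_connected[OF d *(1,3)] rtrancl_mono[OF minus_bonds_mono, of "{y. n < sup_dist 0 y}" "- ?K"]
        cluster_subset_box by fastforce
    then show ?thesis using *(2) minus_bonds_rtrancl_sym[OF *(4)] by (auto intro: rtrancl_trans)
  qed
  show "exterior n ?K \<inter> ?K = {}" by (auto simp: exterior_def)
qed (rule exterior_sep)

text \<open>The inner end of such a bond touches the exterior without belonging to it, so it lies in
  the cluster; the outer end is adjacent to the cluster but outside it, so its spin is plus.\<close>

lemma edge_boundary_filling_subset: "edge_boundary (filling n x A) \<subseteq> edge_boundary A"
proof
  fix e assume "e \<in> edge_boundary (filling n x A)"
  then obtain y i where e: "e = (y, i)" and b: "(y \<in> filling n x A) \<noteq> (y + axis i 1 \<in> filling n x A)"
    by (auto simp: edge_boundary_def)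
  have *: "z \<notin> A \<and> v \<in> A" if "z \<notin> filling n x A" "v \<in> filling n x A" "adjacent z v" for z v
  proof -
    have "z \<in> exterior n (cluster A {x})" "v \<notin> exterior n (cluster A {x})"
      using that by (auto simp: filling_def)
    then have v: "v \<in> cluster A {x}" using exterior_sep that(3) by blast
    moreover have "z \<notin> cluster A {x}" using cluster_subset_filling that(1) by blast
    ultimately show ?thesis
      using cluster_step[OF v, of z] that(3) adjacent_commute cluster_subset by blast
  qed
  have "adjacent y (y + axis i 1)" "adjacent (y + axis i 1) y" by (auto simp: adjacent_def)
  then show "e \<in> edge_boundary A"
    using b *[of y "y + axis i 1"] *[of "y + axis i 1" y] by (auto simp: e edge_boundary_def)
qed

text \<open>The boundary of a symmetric difference is the symmetric difference of the boundaries.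
  Flipping all spins of the filling therefore erases the contour and keeps every other boundary bond
  of \<open>A\<close>.\<close>

lemma weight_flip_filling:
  "weight \<beta> A = exp (- 2 * \<beta> * card (edge_boundary (filling n x A))) * weight \<beta> ((A - filling n x A) \<union> (filling n x A - A))"
proof -
  let ?H = "filling n x A"
  have finA: "finite A" using A finite_sup_ball finite_subset by blast
  have "edge_boundary ((A - ?H) \<union> (?H - A)) = edge_boundary A - edge_boundary ?H"
    using edge_boundary_filling_subset unfolding edge_boundary_def by blast
  moreover have "card (edge_boundary A) = card (edge_boundary ?H) + card (edge_boundary A - edge_boundary ?H)"
    using edge_boundary_filling_subset finite_edge_boundary[OF finA] finite_edge_boundary[OF finite_filling]
    by (simp add: card_Diff_subset card_mono)
  ultimately show ?thesis
    by (simp add: weight_def algebra_simps flip: exp_add)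
qed

lemma reaches_less_card_edge_boundary_filling:
  assumes "reaches r x A"
  shows "r + 1 \<le> card (edge_boundary (filling n x A))"
proof -
  obtain y where y: "y \<in> cluster A {x}" "r \<le> sup_dist x y" using assms by (auto simp: reaches_def)
  have "(x, y) \<in> (minus_bonds (cluster A {x}))\<^sup>*"
    by (rule cluster_connected) (use y in \<open>auto simp: cluster_def\<close>)
  then have "sup_dist x y + 1 \<le> card (edge_boundary (filling n x A))"
    using sup_dist_less_card_edge_boundary[OF d finite_filling cluster_subset_filling] cluster_base[of x A "{x}"] x
    by blast
  then show ?thesis using y(2) by simp
qed

end

text \<open>For fixed \<open>H\<close> the flip is injective, and it maps into subsets of the box
  because the filling stays in the box. In a general volume the filled holes could stick
  out.\<close>

lemma peierls_filling:
  fixes x :: "int ^ 'd::finite" and n :: nat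
  assumes d: "2 \<le> CARD('d)"
  defines "B \<equiv> {y. sup_dist 0 y \<le> n}"
  shows "event_prob \<beta> B (\<lambda>A. x \<in> A \<and> filling n x A = H) \<le> exp (- 2 * \<beta> * card (edge_boundary H))"
proof -
  have finB: "finite B" unfolding B_def by (rule finite_sup_ball)
  let ?S = "{A \<in> Pow B. x \<in> A \<and> filling n x A = H}" and ?c = "exp (- 2 * \<beta> * card (edge_boundary H))"
  let ?flip = "\<lambda>A. (A - H) \<union> (H - A)"
  have "(\<Sum>A\<in>Pow B. weight \<beta> A * of_bool (x \<in> A \<and> filling n x A = H)) = (\<Sum>A\<in>?S. weight \<beta> A)"
    by (rule sum.mono_neutral_cong_right) (use finB in auto)
  also have "\<dots> = (\<Sum>A\<in>?S. ?c * weight \<beta> (?flip A))"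
  proof (rule sum.cong[OF refl])
    fix A assume "A \<in> ?S"
    then show "weight \<beta> A = ?c * weight \<beta> (?flip A)"
      using weight_flip_filling[OF d, of A n x \<beta>] by (auto simp: B_def)
  qed
  also have "\<dots> = ?c * (\<Sum>A\<in>?flip ` ?S. weight \<beta> A)"
  proof -
    have "inj_on ?flip ?S" by (rule inj_onI) blast
    then show ?thesis by (simp add: sum.reindex sum_distrib_left)
  qed
  also have "\<dots> \<le> ?c * partition_sum \<beta> B"
  proof -
    have "?flip ` ?S \<subseteq> Pow B"
      using filling_subset_box[OF d] unfolding B_def by blast
    then show ?thesis
      unfolding partition_sum_def using finB by (intro mult_left_mono sum_mono2) auto
  qed
  finally show ?thesis
    using partition_sum_pos[OF finB, of \<beta>] by (simp add: mean_def divide_simps)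
qed

text \<open>Grouping by size gives a geometric series starting at \<open>r + 1\<close>. Its value at
  \<open>r = 0\<close> is \<open>1/3 < 1/2\<close>, which later makes the magnetization
  positive.\<close>

lemma sum_contour_weights:
  fixes z :: real and C :: "'e set set"
  assumes "finite C" "0 \<le> z" "\<And>S. S \<in> C \<Longrightarrow> r + 1 \<le> card S"
    and "\<And>n. 1 \<le> n \<Longrightarrow> real (card {S \<in> C. card S = n}) * z ^ n \<le> (1/4) ^ n"
  shows "(\<Sum>S\<in>C. z ^ card S) \<le> (1/4) ^ r / 3"
proof -
  define N where "N = Max (insert r (card ` C))"
  have N: "card S \<le> N" if "S \<in> C" for S using that assms(1) by (simp add: N_def)
  have "r \<le> N" using assms(1) by (simp add: N_def)
  have "(\<Sum>S\<in>C. z ^ card S) = (\<Sum>n\<in>{r + 1..N}. \<Sum>S\<in>{S \<in> C. card S = n}. z ^ card S)"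
    by (rule sum.group[symmetric]) (use assms N in auto)
  also have "\<dots> = (\<Sum>n\<in>{r + 1..N}. real (card {S \<in> C. card S = n}) * z ^ n)"
    by (rule sum.cong[OF refl]) simp
  also have "\<dots> \<le> (\<Sum>n\<in>{r + 1..N}. (1/4) ^ n)"
    by (rule sum_mono) (use assms(4) in auto)
  also have "\<dots> = ((1/4) ^ r - (1/4) ^ N) / 3"
    using \<open>r \<le> N\<close>
  proof (induction N rule: dec_induct)
    case (step m)
    then show ?case by (simp add: diff_divide_distrib)
  qed simp
  also have "\<dots> \<le> (1/4) ^ r / 3" by (simp add: divide_right_mono)
  finally show ?thesis .
qed

theorem peierls:
  fixes x :: "int ^ 'd::finite"
  assumes d: "2 \<le> CARD('d)" and \<beta>: "0 \<le> \<beta>" "8 * real (near_degree TYPE('d)) ^ 2 \<le> exp (2 * \<beta>)"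
    and U: "finite U"
  shows "event_prob \<beta> U (reaches r x) \<le> (1/4) ^ r / 3"
proof -
  define n where "n = Max (insert 0 (sup_dist 0 ` U))"
  define B :: "(int ^ 'd) set" where "B = {y. sup_dist 0 y \<le> n}"
  have finB: "finite B" unfolding B_def by (rule finite_sup_ball)
  have UB: "U \<subseteq> B" using U by (auto simp: B_def n_def)
  let ?\<Delta> = "real (near_degree TYPE('d))"
  define \<H> where "\<H> = filling n x ` {A. A \<subseteq> B \<and> x \<in> A \<and> reaches r x A}"
  have fin\<H>: "finite \<H>" unfolding \<H>_def
    by (intro finite_imageI finite_subset[OF _ finite_Pow_iff[THEN iffD2, OF finB]]) auto
  have \<H>: "finite H \<and> x \<in> H \<and> near_connected (edge_boundary H) \<and> r + 1 \<le> card (edge_boundary H)" if "H \<in> \<H>" for H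
  proof -
    obtain A where A: "H = filling n x A" "A \<subseteq> {y. sup_dist 0 y \<le> n}" "x \<in> A" "reaches r x A"
      using \<open>H \<in> \<H>\<close> unfolding \<H>_def B_def by blast
    show ?thesis
      unfolding A(1)
      by (intro conjI finite_filling[OF d A(2,3)] mem_filling[OF d A(2,3)] near_connected_filling[OF d A(2,3)]
          reaches_less_card_edge_boundary_filling[OF d A(2,3,4)])
  qed
  define z where "z = exp (- 2 * \<beta>)"
  have "event_prob \<beta> U (reaches r x) \<le> event_prob \<beta> B (reaches r x)"
    \<comment> \<open>The event is increasing, so the volume may be enlarged to a box, where the
      flip is available.\<close>
    by (rule mean_mono_volume[OF finB UB \<beta>(1)]) (auto dest: reaches_mono)
  also have "\<dots> \<le> mean \<beta> B (\<lambda>A. \<Sum>H\<in>\<H>. of_bool (x \<in> A \<and> filling n x A = H))"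
  proof (rule mean_mono[OF finB])
    fix A assume AB: "A \<subseteq> B"
    show "of_bool (reaches r x A) \<le> (\<Sum>H\<in>\<H>. of_bool (x \<in> A \<and> filling n x A = H) :: real)"
    proof (cases "reaches r x A")
      case True
      then have xA: "x \<in> A" using minus_bonds_rtrancl_mem by (auto simp: reaches_def cluster_def)
      then have "filling n x A \<in> \<H>" using AB True by (auto simp: \<H>_def)
      then have "(of_bool (x \<in> A \<and> filling n x A = filling n x A) :: real)
          \<le> (\<Sum>H\<in>\<H>. of_bool (x \<in> A \<and> filling n x A = H))"
        using fin\<H> by (intro member_le_sum[where f = "\<lambda>H. of_bool (x \<in> A \<and> filling n x A = H)"]) auto
      then show ?thesis using True xA by simp
    qed (simp add: sum_nonneg)
  qed
  also have "\<dots> = (\<Sum>H\<in>\<H>. event_prob \<beta> B (\<lambda>A. x \<in> A \<and> filling n x A = H))"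
    by (rule mean_sum)
  also have "\<dots> \<le> (\<Sum>H\<in>\<H>. exp (- 2 * \<beta> * card (edge_boundary H)))"
    unfolding B_def by (intro sum_mono peierls_filling d)
  also have "\<dots> = (\<Sum>H\<in>\<H>. z ^ card (edge_boundary H))"
    by (simp add: z_def mult_ac flip: exp_of_nat_mult)
  also have "\<dots> = (\<Sum>S\<in>edge_boundary ` \<H>. z ^ card S)"
  proof -
    have "inj_on edge_boundary \<H>" using edge_boundary_injective \<H> by (intro inj_onI) blast
    then show ?thesis by (simp add: sum.reindex)
  qed
  also have "\<dots> \<le> (1/4) ^ r / 3"
  proof (rule sum_contour_weights)
    fix m :: nat assume m: "1 \<le> m"
    obtain k :: 'd where True by simp
    \<comment> \<open>Contours of size \<open>m\<close> are counted according to the bond at which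
      the ray from \<open>x\<close> in the arbitrary direction \<open>k\<close> leaves the
      filling.\<close>
    let ?C = "\<lambda>s. {S. finite S \<and> (x + axis k (int s), k) \<in> S \<and> card S = m \<and> near_connected S}"
    have sub: "{S \<in> edge_boundary ` \<H>. card S = m} \<subseteq> (\<Union>s<m. ?C s)"
    proof
      fix S assume "S \<in> {S \<in> edge_boundary ` \<H>. card S = m}"
      then obtain H where H: "H \<in> \<H>" "S = edge_boundary H" "card S = m" by auto
      then show "S \<in> (\<Union>s<m. ?C s)"
        using \<H>[OF H(1)] exit_less_card_edge_boundary[OF d, of H x k] finite_edge_boundary[of H] by auto
    qed
    have "card {S \<in> edge_boundary ` \<H>. card S = m} \<le> card (\<Union>s<m. ?C s)"
      by (rule card_mono[OF _ sub]) (use card_contours(1) in blast)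
    also have "\<dots> \<le> (\<Sum>s<m. card (?C s))" by (rule card_UN_le) simp
    also have "\<dots> \<le> (\<Sum>s<m. near_degree TYPE('d) ^ (2 * (m - 1)))"
      by (rule sum_mono) (rule card_contours(2))
    also have "\<dots> = m * near_degree TYPE('d) ^ (2 * (m - 1))" by simp
    finally have "real (card {S \<in> edge_boundary ` \<H>. card S = m}) \<le> real (m * near_degree TYPE('d) ^ (2 * (m - 1)))"
      by (rule of_nat_mono)
    then have card: "real (card {S \<in> edge_boundary ` \<H>. card S = m}) \<le> m * ?\<Delta> ^ (2 * (m - 1))"
      by (simp only: of_nat_mult of_nat_power)
    have \<Delta>1: "1 \<le> ?\<Delta>"
    proof -
      have "(x + axis k (int 0), k) \<in> near (x + axis k (int 0), k)" by (simp add: near_def)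
      then have "0 < card (near (x + axis k (int 0), k))"
        using near_finite_card[of "(x + axis k (int 0), k)"] card_gt_0_iff by blast
      then show ?thesis using near_finite_card[of "(x + axis k (int 0), k)"] by linarith
    qed
    have "real m \<le> 2 ^ m" by (rule of_nat_less_two_power[THEN less_imp_le])
    moreover have "?\<Delta> ^ (2 * (m - 1)) \<le> ?\<Delta> ^ (2 * m)" using \<Delta>1 by (intro power_increasing) auto
    ultimately have "m * ?\<Delta> ^ (2 * (m - 1)) \<le> 2 ^ m * ?\<Delta> ^ (2 * m)"
      by (intro mult_mono) auto
    also have "\<dots> = (2 * ?\<Delta>\<^sup>2) ^ m" by (simp add: power_mult power_mult_distrib)
    finally have "real (card {S \<in> edge_boundary ` \<H>. card S = m}) * z ^ m \<le> (2 * ?\<Delta>\<^sup>2) ^ m * z ^ m"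
      using card by (intro mult_right_mono) (auto simp: z_def)
    also have "\<dots> = (2 * ?\<Delta>\<^sup>2 * z) ^ m" by (simp add: power_mult_distrib)
    also have "\<dots> \<le> (1/4) ^ m"
    proof (rule power_mono)
      \<comment> \<open>The \<open>m\<close> starting bonds cost \<open>2 ^ m\<close> and the walk
        \<open>?\<Delta> ^ (2 * m)\<close>; the constant \<open>8\<close> leaves the rate
        \<open>1/4\<close>.\<close>
      have "8 * ?\<Delta>\<^sup>2 * z \<le> exp (2 * \<beta>) * z" using \<beta>(2) by (intro mult_right_mono) (auto simp: z_def)
      also have "\<dots> = 1" by (simp add: z_def flip: exp_add)
      finally show "2 * ?\<Delta>\<^sup>2 * z \<le> 1/4" by simp
    qed (simp add: z_def)
    finally show "real (card {S \<in> edge_boundary ` \<H>. card S = m}) * z ^ m \<le> (1/4) ^ m" .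
  qed (use fin\<H> \<H> in \<open>auto simp: z_def\<close>)
  finally show ?thesis .
qed

section \<open>Moment bounds in finite volume\<close>

lemma power_add_le:
  fixes u v :: real
  assumes "0 \<le> u" "0 \<le> v"
  shows "(u + v) ^ m \<le> 2 ^ m * (u ^ m + v ^ m)"
proof -
  have "(u + v) ^ m \<le> (2 * max u v) ^ m" using assms by (intro power_mono) auto
  also have "\<dots> = 2 ^ m * max u v ^ m" by (simp add: power_mult_distrib)
  also have "\<dots> \<le> 2 ^ m * (u ^ m + v ^ m)"
    using assms by (intro mult_left_mono) (auto simp: max_def)
  finally show ?thesis .
qed

text \<open>The left side is \<open>q ^ (2 * p - m) * \<tau> ^ m\<close>. It is at most the first
  term on the right if \<open>\<tau> \<le> q\<close>, where \<open>2 \<le> m\<close> is used, and at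
  most the second otherwise.\<close>

lemma power_interpolation:
  fixes q \<tau> :: real
  assumes "0 \<le> q" "0 \<le> \<tau>" "2 \<le> m" "m \<le> p"
  shows "q ^ (2 * (p - m)) * (q ^ m * \<tau> ^ m) \<le> \<tau> ^ 2 * q ^ (2 * (p - 1)) + \<tau> ^ (2 * m) * q ^ (2 * (p - m))"
proof (cases "\<tau> \<le> q")
  case True
  have "\<tau> ^ m = \<tau> ^ 2 * \<tau> ^ (m - 2)"
    using assms(3) by (metis le_add_diff_inverse power_add)
  also have "\<dots> \<le> \<tau> ^ 2 * q ^ (m - 2)" using True assms by (intro mult_left_mono power_mono) auto
  finally have "q ^ (2 * (p - m)) * (q ^ m * \<tau> ^ m) \<le> q ^ (2 * (p - m)) * (q ^ m * (\<tau> ^ 2 * q ^ (m - 2)))"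
    using assms by (intro mult_left_mono) auto
  also have "\<dots> = \<tau> ^ 2 * q ^ (2 * (p - m) + m + (m - 2))" by (simp add: power_add mult_ac)
  also have "2 * (p - m) + m + (m - 2) = 2 * (p - 1)" using assms by simp
  finally show ?thesis using assms by (simp add: add_increasing2)
next
  case False
  then have "q ^ m * \<tau> ^ m \<le> \<tau> ^ m * \<tau> ^ m" using assms by (intro mult_right_mono power_mono) auto
  also have "\<dots> = \<tau> ^ (2 * m)" by (simp add: mult_2 power_add)
  finally have "q ^ (2 * (p - m)) * (q ^ m * \<tau> ^ m) \<le> q ^ (2 * (p - m)) * \<tau> ^ (2 * m)"
    using assms by (intro mult_left_mono) auto
  then show ?thesis using assms by (simp add: add_increasing mult_ac)
qed

lemma sum_quarter_powers: "(\<Sum>m = 1..p. (1/4 :: real) ^ m) \<le> 1/3"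
proof -
  have "(\<Sum>m = 1..p. (1/4 :: real) ^ m) = (1 - (1/4) ^ p) / 3"
    by (induction p) (auto simp: diff_divide_distrib)
  then show ?thesis by simp
qed

text \<open>The potential \<open>(a\<^sup>2 + s)\<^sup>p\<close> absorbs a centred increment into \<open>s\<close>. The constant grows
  polynomially in \<open>p\<close>, which is what makes stretched exponential moments finite in the end.\<close>

lemma potential_step:
  fixes P D :: "'c \<Rightarrow> real"
  assumes P: "\<And>c. c \<in> I \<Longrightarrow> 0 \<le> P c" "(\<Sum>c\<in>I. P c) = 1"
    and centred: "(\<Sum>c\<in>I. P c * D c) = 0"
    and moments: "\<And>i. 1 \<le> i \<Longrightarrow> i \<le> 2 * p \<Longrightarrow> (\<Sum>c\<in>I. P c * \<bar>D c\<bar> ^ i) \<le> t ^ i"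
    and "0 \<le> t" "0 \<le> s" "1 \<le> p"
  shows "(\<Sum>c\<in>I. P c * ((a + D c)\<^sup>2 + s) ^ p) \<le> (a\<^sup>2 + s + (16 * real p * t)\<^sup>2) ^ p"
proof -
  \<comment> \<open>The new potential is \<open>(q\<^sup>2 + y c) ^ p\<close> and is expanded in
    powers of \<open>y c\<close>, whose moments are the \<open>e m\<close>. The \<open>X m\<close>
    are the terms of \<open>(q\<^sup>2 + \<tau>\<^sup>2) ^ p\<close> without binomial
    coefficients.\<close>
  define q where "q = sqrt (a\<^sup>2 + s)"
  define \<tau> where "\<tau> = 16 * real p * t"
  define y where "y c = 2 * a * D c + (D c)\<^sup>2" for c
  define e where "e m = (\<Sum>c\<in>I. P c * y c ^ m)" for m
  define X where "X m = \<tau> ^ (2 * m) * q ^ (2 * (p - m))" for m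
  have q2: "q\<^sup>2 = a\<^sup>2 + s" and q0: "0 \<le> q" using assms by (auto simp: q_def)
  have "\<bar>a\<bar> \<le> q" using assms(6) by (simp add: q_def real_le_rsqrt)
  have \<tau>0: "0 \<le> \<tau>" using assms by (simp add: \<tau>_def)
  have X0: "0 \<le> X m" for m using \<tau>0 q0 by (simp add: X_def)
  \<comment> \<open>Centring removes the linear part \<open>2 * a * D c\<close> from the first
    moment. The terms with \<open>m \<ge> 2\<close> are bounded crudely.\<close>
  have e1: "e 1 \<le> t\<^sup>2"
  proof -
    have "e 1 = 2 * a * (\<Sum>c\<in>I. P c * D c) + (\<Sum>c\<in>I. P c * \<bar>D c\<bar> ^ 2)"
      by (simp add: e_def y_def algebra_simps sum.distrib sum_distrib_left)
    then show ?thesis using centred moments[of 2] assms(7) by simp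
  qed
  have e: "e m \<le> 2 ^ m * (2 ^ m * q ^ m * t ^ m + t ^ (2 * m))" if m: "1 \<le> m" "m \<le> p" for m
  proof -
    have "y c ^ m \<le> 2 ^ m * (2 ^ m * q ^ m * \<bar>D c\<bar> ^ m + \<bar>D c\<bar> ^ (2 * m))" for c
    proof -
      have "\<bar>y c\<bar> \<le> 2 * \<bar>a\<bar> * \<bar>D c\<bar> + (D c)\<^sup>2"
        unfolding y_def by (rule order_trans[OF abs_triangle_ineq]) (simp add: abs_mult)
      also have "\<dots> \<le> 2 * q * \<bar>D c\<bar> + \<bar>D c\<bar> ^ 2"
        using \<open>\<bar>a\<bar> \<le> q\<close> by (simp add: mult_right_mono)
      finally have "\<bar>y c\<bar> ^ m \<le> (2 * q * \<bar>D c\<bar> + \<bar>D c\<bar> ^ 2) ^ m" by (intro power_mono) auto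
      also have "\<dots> \<le> 2 ^ m * ((2 * q * \<bar>D c\<bar>) ^ m + (\<bar>D c\<bar> ^ 2) ^ m)"
        using q0 by (intro power_add_le) auto
      finally have "\<bar>y c\<bar> ^ m \<le> 2 ^ m * (2 ^ m * q ^ m * \<bar>D c\<bar> ^ m + \<bar>D c\<bar> ^ (2 * m))"
        by (simp add: power_mult_distrib power_mult)
      moreover have "y c ^ m \<le> \<bar>y c\<bar> ^ m" by (simp flip: power_abs)
      ultimately show ?thesis by linarith
    qed
    then have "e m \<le> (\<Sum>c\<in>I. P c * (2 ^ m * (2 ^ m * q ^ m * \<bar>D c\<bar> ^ m + \<bar>D c\<bar> ^ (2 * m))))"
      unfolding e_def using P(1) by (intro sum_mono mult_left_mono) auto
    also have "\<dots> = 2 ^ m * (2 ^ m * q ^ m * (\<Sum>c\<in>I. P c * \<bar>D c\<bar> ^ m) + (\<Sum>c\<in>I. P c * \<bar>D c\<bar> ^ (2 * m)))"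
      by (simp add: algebra_simps sum.distrib sum_distrib_left)
    also have "\<dots> \<le> 2 ^ m * (2 ^ m * q ^ m * t ^ m + t ^ (2 * m))"
      using m q0 by (intro mult_left_mono add_mono moments) auto
    finally show ?thesis .
  qed
  \<comment> \<open>Each term is charged partly to \<open>X 1\<close> and partly to
    \<open>X m\<close>. The charges to \<open>X 1\<close> add up to at most \<open>X 1 / 3\<close>,
    which the remaining halves absorb. Of the factor \<open>16\<close> in \<tau>, one
    \<open>4\<close> pays for the two factors \<open>2 ^ m\<close> in the moment bound and the other
    gives the rate \<open>1/4\<close>.\<close>
  have T: "real (p choose m) * e m * (q\<^sup>2) ^ (p - m) \<le> (1/4) ^ m * X 1 + X m / 2" if m: "1 \<le> m" "m \<le> p" for m
  proof (cases "m = 1")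
    case True
    have "real p * e 1 * (q\<^sup>2) ^ (p - 1) \<le> real p * t\<^sup>2 * (q\<^sup>2) ^ (p - 1)"
      using e1 by (intro mult_right_mono mult_left_mono) auto
    also have "real p * t\<^sup>2 \<le> \<tau>\<^sup>2 / 4"
    proof -
      have "real p * t\<^sup>2 \<le> (real p * real p) * t\<^sup>2" using assms(7) by (intro mult_right_mono) auto
      also have "\<dots> \<le> \<tau>\<^sup>2 / 4" using assms(5) by (simp add: \<tau>_def power2_eq_square)
      finally show ?thesis .
    qed
    finally have "real p * e 1 * (q\<^sup>2) ^ (p - 1) \<le> X 1 / 4"
      using q0 by (simp add: X_def power_mult mult_right_mono)
    then show ?thesis using True X0[of 1] by simp
  next
    case False
    have choose: "real (p choose m) \<le> real p ^ m"
      using binomial_le_pow[OF m(2)] by (metis of_nat_le_iff of_nat_power)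
    let ?e = "2 ^ m * (2 ^ m * q ^ m * t ^ m + t ^ (2 * m))"
    have "real (p choose m) * e m \<le> real (p choose m) * ?e"
      by (intro mult_left_mono e m) simp
    also have "\<dots> \<le> real p ^ m * ?e"
      using choose q0 assms(5) by (intro mult_right_mono) auto
    also have "\<dots> = (4 * real p * t) ^ m * q ^ m + (2 * real p * t\<^sup>2) ^ m"
    proof -
      have "(4 * real p * t) ^ m = (2 * (2 * (real p * t))) ^ m" by (simp add: mult.assoc)
      also have "\<dots> = 2 ^ m * (2 ^ m * (real p ^ m * t ^ m))" by (simp only: power_mult_distrib)
      finally have 1: "(4 * real p * t) ^ m = 2 ^ m * (2 ^ m * (real p ^ m * t ^ m))" .
      have 2: "(2 * real p * t\<^sup>2) ^ m = 2 ^ m * real p ^ m * t ^ (2 * m)"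
        by (simp only: power_mult_distrib power_mult)
      show ?thesis unfolding 1 2 by (simp only: algebra_simps)
    qed
    also have "\<dots> \<le> (\<tau> / 4) ^ m * q ^ m + (\<tau>\<^sup>2 / 4) ^ m"
    proof (intro add_mono power_mono)
      have "4 * real p * t = \<tau> / 4" by (simp add: \<tau>_def)
      then show "(4 * real p * t) ^ m * q ^ m \<le> (\<tau> / 4) ^ m * q ^ m" by (simp only: order_refl)
      have "2 * real p * t\<^sup>2 \<le> 2 * (real p * real p) * t\<^sup>2" using assms(7) by (intro mult_right_mono) auto
      also have "\<dots> \<le> \<tau>\<^sup>2 / 4" using assms(5) by (simp add: \<tau>_def power2_eq_square)
      finally show "2 * real p * t\<^sup>2 \<le> \<tau>\<^sup>2 / 4" .
    qed (use assms(5) in simp)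
    finally have "real (p choose m) * e m * (q\<^sup>2) ^ (p - m)
        \<le> ((\<tau> / 4) ^ m * q ^ m + (\<tau>\<^sup>2 / 4) ^ m) * (q\<^sup>2) ^ (p - m)"
      by (rule mult_right_mono) simp
    also have "\<dots> = (1/4) ^ m * (q ^ (2 * (p - m)) * (q ^ m * \<tau> ^ m) + X m)"
    proof -
      have "(\<tau> / 4) ^ m = (1/4) ^ m * \<tau> ^ m" "(\<tau>\<^sup>2 / 4) ^ m = (1/4) ^ m * \<tau> ^ (2 * m)"
        "(q\<^sup>2) ^ (p - m) = q ^ (2 * (p - m))"
        by (simp_all add: power_divide power_mult)
      then show ?thesis by (simp only: X_def) (simp only: algebra_simps)
    qed
    also have "\<dots> \<le> (1/4) ^ m * ((X 1 + X m) + X m)"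
      using power_interpolation[OF q0 \<tau>0 _ m(2)] m False
      by (intro mult_left_mono add_mono) (auto simp: X_def)
    also have "\<dots> = (1/4) ^ m * X 1 + 2 * (1/4) ^ m * X m" by (simp add: algebra_simps)
    also have "\<dots> \<le> (1/4) ^ m * X 1 + X m / 2"
    proof -
      have "(1/4 :: real) ^ m \<le> (1/4) ^ 1" by (rule power_decreasing) (use m in auto)
      then have "2 * (1/4) ^ m * X m \<le> (1/2) * X m" using X0[of m] by (intro mult_right_mono) auto
      then show ?thesis by simp
    qed
    finally show ?thesis .
  qed
  have "(\<Sum>c\<in>I. P c * ((a + D c)\<^sup>2 + s) ^ p) = (\<Sum>c\<in>I. P c * (y c + q\<^sup>2) ^ p)"
    by (simp add: q2 y_def power2_sum algebra_simps)
  also have "\<dots> = (\<Sum>c\<in>I. \<Sum>m\<le>p. P c * (real (p choose m) * y c ^ m * (q\<^sup>2) ^ (p - m)))"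
    by (simp only: binomial_ring sum_distrib_left)
  also have "\<dots> = (\<Sum>m\<le>p. \<Sum>c\<in>I. P c * (real (p choose m) * y c ^ m * (q\<^sup>2) ^ (p - m)))"
    by (rule sum.swap)
  also have "\<dots> = (\<Sum>m\<le>p. real (p choose m) * e m * (q\<^sup>2) ^ (p - m))"
    by (simp add: e_def sum_distrib_left sum_distrib_right mult_ac)
  also have "\<dots> = e 0 * (q\<^sup>2) ^ p + (\<Sum>m = 1..p. real (p choose m) * e m * (q\<^sup>2) ^ (p - m))"
    unfolding atMost_atLeast0 by (subst sum.atLeast_Suc_atMost) auto
  also have "\<dots> \<le> X 0 + (\<Sum>m = 1..p. (1/4) ^ m * X 1 + X m / 2)"
  proof (rule add_mono)
    show "e 0 * (q\<^sup>2) ^ p \<le> X 0" using P(2) by (simp add: e_def X_def power_mult)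
    show "(\<Sum>m = 1..p. real (p choose m) * e m * (q\<^sup>2) ^ (p - m)) \<le> (\<Sum>m = 1..p. (1/4) ^ m * X 1 + X m / 2)"
      by (rule sum_mono) (use T in auto)
  qed
  also have "\<dots> = X 0 + (\<Sum>m = 1..p. (1/4) ^ m) * X 1 + (\<Sum>m = 1..p. X m) / 2"
    by (simp add: sum.distrib sum_distrib_right sum_divide_distrib)
  also have "\<dots> \<le> X 0 + (\<Sum>m = 1..p. X m) / 2 + (\<Sum>m = 1..p. X m) / 2"
  proof -
    have "(\<Sum>m = 1..p. (1/4) ^ m) * X 1 \<le> (1/3) * X 1"
      using sum_quarter_powers X0[of 1] by (rule mult_right_mono)
    moreover have "X 1 \<le> (\<Sum>m = 1..p. X m)"
      by (rule member_le_sum) (use X0 assms(7) in auto)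
    ultimately show ?thesis using X0[of 1] by linarith
  qed
  also have "\<dots> = X 0 + (\<Sum>m = 1..p. X m)" by simp
  also have "\<dots> = (\<Sum>m\<le>p. X m)"
    unfolding atMost_atLeast0 by (subst (2) sum.atLeast_Suc_atMost) auto
  also have "\<dots> \<le> (\<Sum>m\<le>p. real (p choose m) * (\<tau>\<^sup>2) ^ m * (q\<^sup>2) ^ (p - m))"
  proof (rule sum_mono)
    fix m assume "m \<in> {..p}"
    then have "0 < p choose m" by simp
    then have "1 * X m \<le> real (p choose m) * X m"
      using X0[of m] by (intro mult_right_mono) (auto simp: Suc_le_eq)
    then show "X m \<le> real (p choose m) * (\<tau>\<^sup>2) ^ m * (q\<^sup>2) ^ (p - m)"
      by (simp only: X_def power_mult mult_1_left mult.assoc)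
  qed
  also have "\<dots> = (\<tau>\<^sup>2 + q\<^sup>2) ^ p" by (simp only: binomial_ring)
  finally show ?thesis by (simp add: q2 \<tau>_def add_ac)
qed

section \<open>Moments of the radius of a cluster\<close>

lemma power_le_fact_exp:
  fixes x :: real
  assumes "0 \<le> x"
  shows "x ^ q \<le> fact q * exp x"
proof -
  have s: "(\<lambda>n. x ^ n /\<^sub>R fact n) sums exp x" by (rule exp_converges)
  have "(\<Sum>n\<in>{q}. x ^ n /\<^sub>R fact n) \<le> (\<Sum>n. x ^ n /\<^sub>R fact n)"
    by (rule sum_le_suminf) (use s assms in \<open>auto simp: sums_iff\<close>)
  then have "x ^ q / fact q \<le> exp x" using s by (simp add: sums_iff field_simps)
  then show ?thesis by (simp add: field_simps)
qed

text \<open>Powers are traded for exponentials; the base \<open>3 \<ge> exp 1\<close> stays below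
  the rate \<open>4\<close> of the Peierls decay.\<close>

lemma power_le_fact_3_power: "real n ^ q \<le> fact q * 3 ^ n"
proof -
  have "exp (real n) = exp 1 ^ n" by (simp flip: exp_of_nat_mult)
  also have "\<dots> \<le> 3 ^ n" using exp_le by (intro power_mono) auto
  finally show ?thesis using power_le_fact_exp[of "real n" q] by (simp add: order_trans mult_left_mono)
qed

text \<open>The radius \<open>l\<close> satisfies
  \<open>(l + 2) ^ q \<le> 9 * fact q * 3 ^ l\<close>, and the mean of \<open>3 ^ l\<close> is at
  most one plus the sum of the \<open>(3/4) ^ r\<close>, that is at most \<open>5\<close>; hence
  \<open>45\<close>.\<close>

lemma mean_radius_power:
  fixes U :: "(int ^ 'd::finite) set"
  assumes "finite U"
    and tail: "\<And>r. event_prob \<beta> U (reaches r x) \<le> (1/4) ^ r"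
  shows "mean \<beta> U (\<lambda>A. (real (radius x (cluster A {x})) + 2) ^ q) \<le> 45 * fact q"
proof -
  define N where "N = radius x U"
  let ?l = "\<lambda>A. radius x (cluster A {x})"
  have "mean \<beta> U (\<lambda>A. (real (?l A) + 2) ^ q)
      \<le> mean \<beta> U (\<lambda>A. 9 * fact q * (1 + (\<Sum>r\<le>N. 3 ^ r * of_bool (reaches r x A))))"
  proof (rule mean_mono[OF assms(1)])
    fix A assume A: "A \<subseteq> U"
    have finC: "finite (cluster A {x})"
      using A assms(1) cluster_subset finite_subset by metis
    have "3 ^ ?l A \<le> 1 + (\<Sum>r\<le>N. 3 ^ r * of_bool (reaches r x A) :: real)"
    proof (cases "?l A = 0")
      case False
      then obtain y where y: "y \<in> cluster A {x}" "?l A = sup_dist x y"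
        using radius_attained[OF finC] by blast
      have "?l A \<le> N"
        using y A cluster_subset sup_dist_le_radius[OF assms(1), of y x] unfolding N_def by fastforce
      moreover have "reaches (?l A) x A" using y by (auto simp: reaches_def)
      ultimately have "3 ^ ?l A * of_bool (reaches (?l A) x A) \<le> (\<Sum>r\<le>N. 3 ^ r * of_bool (reaches r x A) :: real)"
        by (intro member_le_sum[where f = "\<lambda>r. 3 ^ r * of_bool (reaches r x A)"]) auto
      then show ?thesis using \<open>reaches (?l A) x A\<close> by simp
    qed (simp add: sum_nonneg)
    then have "fact q * 3 ^ (?l A + 2) \<le> 9 * fact q * (1 + (\<Sum>r\<le>N. 3 ^ r * of_bool (reaches r x A) :: real))"
      by (simp add: power_add)
    moreover have "(real (?l A) + 2) ^ q \<le> fact q * 3 ^ (?l A + 2)"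
      using power_le_fact_3_power[of "?l A + 2" q] by (simp only: of_nat_add of_nat_numeral)
    ultimately show "(real (?l A) + 2) ^ q \<le> 9 * fact q * (1 + (\<Sum>r\<le>N. 3 ^ r * of_bool (reaches r x A)))"
      by (rule order_trans[rotated])
  qed
  also have "\<dots> = 9 * fact q * (1 + (\<Sum>r\<le>N. 3 ^ r * event_prob \<beta> U (reaches r x)))"
    using assms(1) by (simp only: mean_cmult mean_add mean_sum mean_const)
  also have "\<dots> \<le> 9 * fact q * (1 + (\<Sum>r\<le>N. 3 ^ r * (1/4) ^ r))"
    by (intro mult_left_mono add_left_mono sum_mono tail) auto
  also have "(\<Sum>r\<le>N. 3 ^ r * (1/4 :: real) ^ r) = (\<Sum>r\<le>N. (3/4) ^ r)"
    by (simp add: power_divide)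
  also have "\<dots> \<le> 4"
  proof -
    have "(\<Sum>r\<le>N. (3/4 :: real) ^ r) = 4 - 3 * (3/4) ^ N" by (induction N) auto
    then show ?thesis by simp
  qed
  finally show ?thesis by (simp add: mult_left_mono)
qed

section \<open>A summable polynomial kernel on the lattice\<close>

definition poly_weight :: "int ^ 'd::finite \<Rightarrow> int ^ 'd \<Rightarrow> real" where
  "poly_weight x j = 1 / (1 + real (sup_dist x j)) ^ (2 * CARD('d))"

lemma poly_weight_pos: "0 < poly_weight x j"
  by (simp add: poly_weight_def)

lemma sum_inverse_squares: "(\<Sum>k\<le>n. 1 / (1 + real k)\<^sup>2) \<le> 2"
proof -
  have "(\<Sum>k\<le>n. 1 / (1 + real k)\<^sup>2) \<le> 2 - 1 / (1 + real n)"
  proof (induction n)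
    case (Suc n)
    have "1 / (2 + real n)\<^sup>2 \<le> 1 / ((1 + real n) * (2 + real n))"
      by (intro divide_left_mono) (auto simp: power2_eq_square)
    also have "\<dots> = 1 / (1 + real n) - 1 / (2 + real n)" by (simp add: field_simps)
    finally show ?case using Suc by (simp add: add_ac)
  qed simp
  moreover have "0 < 1 / (1 + real n)" by simp
  ultimately show ?thesis by linarith
qed

lemma sum_int_inverse_squares: "(\<Sum>t\<in>{x - int n..x + int n}. 1 / (1 + real_of_int \<bar>x - t\<bar>)\<^sup>2) \<le> 4"
proof -
  let ?h = "\<lambda>t. 1 / (1 + real_of_int \<bar>x - t\<bar>)\<^sup>2"
  let ?A = "(\<lambda>k. x + int k) ` {..n}" and ?B = "(\<lambda>k. x - int k) ` {..n}"
  have "{x - int n..x + int n} \<subseteq> ?A \<union> ?B"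
  proof
    fix t assume t: "t \<in> {x - int n..x + int n}"
    then have "t = x + int (nat (t - x)) \<and> nat (t - x) \<le> n \<or> t = x - int (nat (x - t)) \<and> nat (x - t) \<le> n"
      by auto
    then show "t \<in> ?A \<union> ?B" by blast
  qed
  then have "sum ?h {x - int n..x + int n} \<le> sum ?h (?A \<union> ?B)"
    by (intro sum_mono2) auto
  also have "\<dots> \<le> sum ?h ?A + sum ?h ?B"
    by (subst sum_Un) (auto intro: sum_nonneg)
  also have "sum ?h ?A = (\<Sum>k\<le>n. 1 / (1 + real k)\<^sup>2)"
    by (subst sum.reindex) (auto simp: inj_on_def)
  also have "sum ?h ?B = (\<Sum>k\<le>n. 1 / (1 + real k)\<^sup>2)"
    by (subst sum.reindex) (auto simp: inj_on_def)
  finally show ?thesis using sum_inverse_squares[of n] by linarith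
qed

text \<open>The exponent gives two powers to each coordinate. As no coordinate difference exceeds
  the sup distance, the kernel is at most a product of inverse squares, and the sum factorizes into
  sums bounded by \<open>4\<close>.\<close>

lemma sum_poly_weight:
  fixes x :: "int ^ 'd::finite"
  assumes "finite S"
  shows "(\<Sum>j\<in>S. poly_weight x j) \<le> 4 ^ CARD('d)"
proof -
  let ?h = "\<lambda>i t. 1 / (1 + real_of_int \<bar>x $ i - t\<bar>)\<^sup>2"
  define n where "n = Max (insert 0 (sup_dist x ` S))"
  have n: "sup_dist x j \<le> n" if "j \<in> S" for j using that assms by (simp add: n_def)
  have "(\<Sum>j\<in>S. poly_weight x j) \<le> (\<Sum>j\<in>S. \<Prod>i\<in>UNIV. ?h i (j $ i))"
  proof (rule sum_mono)
    fix j
    have "poly_weight x j = (\<Prod>i\<in>(UNIV :: 'd set). 1 / (1 + real (sup_dist x j))\<^sup>2)"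
      by (simp add: poly_weight_def power_mult power_divide power_one_over)
    also have "\<dots> \<le> (\<Prod>i\<in>UNIV. ?h i (j $ i))"
    proof (rule prod_mono, intro conjI)
      fix i
      have "real_of_int \<bar>x $ i - j $ i\<bar> \<le> real (sup_dist x j)"
        using coordinate_le_sup_dist[of x i j] by linarith
      then show "1 / (1 + real (sup_dist x j))\<^sup>2 \<le> ?h i (j $ i)"
        by (intro divide_left_mono power_mono mult_pos_pos zero_less_power) auto
    qed simp
    finally show "poly_weight x j \<le> (\<Prod>i\<in>UNIV. ?h i (j $ i))" .
  qed
  also have "\<dots> = (\<Sum>f\<in>vec_nth ` S. \<Prod>i\<in>UNIV. ?h i (f i))"
    by (subst sum.reindex) (auto simp: inj_on_def vec_nth_inject)
  also have "\<dots> \<le> (\<Sum>f\<in>Pi\<^sub>E UNIV (\<lambda>i. {x $ i - int n..x $ i + int n}). \<Prod>i\<in>UNIV. ?h i (f i))"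
  proof (rule sum_mono2)
    show "vec_nth ` S \<subseteq> Pi\<^sub>E UNIV (\<lambda>i. {x $ i - int n..x $ i + int n})"
      using n by (force simp: sup_dist_le_iff PiE_def Pi_def abs_le_iff algebra_simps)
  qed (auto intro!: finite_PiE prod_nonneg)
  also have "\<dots> = (\<Prod>i\<in>UNIV. \<Sum>t\<in>{x $ i - int n..x $ i + int n}. ?h i t)"
    by (rule prod_sum_PiE[symmetric]) auto
  also have "\<dots> \<le> (\<Prod>i\<in>(UNIV :: 'd set). 4)"
    by (intro prod_mono conjI sum_nonneg sum_int_inverse_squares) auto
  finally show ?thesis by simp
qed

text \<open>The Schur test: Cauchy-Schwarz with the square root of the symmetric kernel, then both
  marginal sums are bounded by \<open>4 ^ d\<close>.\<close>

lemma sum_convolution_squares: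
  fixes dl :: "int ^ 'd::finite \<Rightarrow> real"
  assumes "finite U" "finite S"
  shows "(\<Sum>x\<in>U. (\<Sum>j\<in>S. dl j * poly_weight x j)\<^sup>2) \<le> (4 ^ CARD('d))\<^sup>2 * (\<Sum>j\<in>S. (dl j)\<^sup>2)"
proof -
  let ?W = "4 ^ CARD('d) :: real" and ?w = "poly_weight :: int ^ 'd \<Rightarrow> int ^ 'd \<Rightarrow> real"
  have "(\<Sum>x\<in>U. (\<Sum>j\<in>S. dl j * ?w x j)\<^sup>2) \<le> (\<Sum>x\<in>U. ?W * (\<Sum>j\<in>S. (dl j)\<^sup>2 * ?w x j))"
  proof (rule sum_mono)
    fix x
    have pw: "sqrt (?w x j) * sqrt (?w x j) = ?w x j" for j
      using poly_weight_pos[of x j] by simp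
    have "(\<Sum>j\<in>S. dl j * ?w x j)\<^sup>2 = (\<Sum>j\<in>S. (dl j * sqrt (?w x j)) * sqrt (?w x j))\<^sup>2"
      by (simp only: mult.assoc pw)
    also have "\<dots> \<le> (\<Sum>j\<in>S. (dl j * sqrt (?w x j))\<^sup>2) * (\<Sum>j\<in>S. (sqrt (?w x j))\<^sup>2)"
      by (rule Cauchy_Schwarz_ineq_sum)
    also have "\<dots> = (\<Sum>j\<in>S. (dl j)\<^sup>2 * ?w x j) * (\<Sum>j\<in>S. ?w x j)"
      by (simp add: power_mult_distrib less_imp_le[OF poly_weight_pos])
    also have "\<dots> \<le> (\<Sum>j\<in>S. (dl j)\<^sup>2 * ?w x j) * ?W"
      by (intro mult_left_mono sum_poly_weight assms sum_nonneg)
         (simp add: less_imp_le[OF poly_weight_pos])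
    finally show "(\<Sum>j\<in>S. dl j * ?w x j)\<^sup>2 \<le> ?W * (\<Sum>j\<in>S. (dl j)\<^sup>2 * ?w x j)" by (simp add: mult.commute)
  qed
  also have "\<dots> = ?W * (\<Sum>j\<in>S. (dl j)\<^sup>2 * (\<Sum>x\<in>U. ?w j x))"
  proof -
    have "?w x j = ?w j x" for x j by (simp add: poly_weight_def sup_dist_commute)
    then have "(\<Sum>x\<in>U. \<Sum>j\<in>S. (dl j)\<^sup>2 * ?w x j) = (\<Sum>j\<in>S. \<Sum>x\<in>U. (dl j)\<^sup>2 * ?w j x)"
      by (simp only: sum.swap[of _ U])
    then show ?thesis by (simp only: sum_distrib_left[symmetric])
  qed
  also have "\<dots> \<le> ?W * (\<Sum>j\<in>S. (dl j)\<^sup>2 * ?W)"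
    by (intro mult_left_mono sum_mono sum_poly_weight assms) auto
  finally show ?thesis by (simp add: power2_eq_square sum_distrib_left mult_ac)
qed

lemma power_le_4_power: "\<exists>K\<ge>1. \<forall>r::nat. (1 + real r) ^ M \<le> K * 4 ^ r"
proof (intro exI[of _ "3 * fact M"] conjI allI)
  show "1 \<le> 3 * (fact M :: real)" using fact_ge_1[of M, where 'a = real] by linarith
  fix r :: nat
  have "(1 + real r) ^ M \<le> fact M * 3 ^ (1 + r)"
    using power_le_fact_3_power[of "1 + r" M] by (simp only: of_nat_add of_nat_1)
  also have "\<dots> = 3 * fact M * 3 ^ r" by simp
  also have "\<dots> \<le> 3 * fact M * 4 ^ r" by (intro mult_left_mono power_mono) auto
  finally show "(1 + real r) ^ M \<le> 3 * fact M * 4 ^ r" .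
qed

text \<open>Effect on the mean of \<open>g\<close> of revealing the cluster \<open>T\<close> of \<open>x\<close>: a site \<open>j\<close> is influenced only
  if it lies in \<open>T\<close> or its own cluster reaches \<open>T\<close>.\<close>

lemma mean_cluster_deviation:
  fixes U :: "(int ^ 'd::finite) set" and g :: "(int ^ 'd) set \<Rightarrow> real"
  assumes "finite U" "0 \<le> \<beta>" "T \<subseteq> U"
    and tail: "\<And>r x. event_prob \<beta> U (reaches r x) \<le> (1/4) ^ r"
    and lip: "\<And>A j. \<bar>g (insert j A) - g A\<bar> \<le> dl j"
    and K: "1 \<le> K" "\<And>r::nat. (1 + real r) ^ (2 * CARD('d)) \<le> K * 4 ^ r"
  shows "\<bar>mean \<beta> (U - explored {x} T) (\<lambda>B. g (T \<union> B)) - mean \<beta> U g\<bar>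
    \<le> 2 * K * (real (radius x T) + 2) ^ (2 * CARD('d)) * (\<Sum>j\<in>U. dl j * poly_weight x j)"
proof -
  let ?M = "2 * CARD('d)" and ?l = "radius x T"
  define V where "V = U - explored {x} T"
  have finT: "finite T" and finV: "finite V" using assms finite_subset by (auto simp: V_def)
  have dl0: "0 \<le> dl j" for j using lip[of j "{}"] abs_ge_zero order_trans by blast
  \<comment> \<open>The estimate \<open>1 + |x - j| \<le> (1 + s) * (?l + 2)\<close> is
    multiplicative, so a polynomial kernel separates the radius from the excess distance
    \<open>s\<close>. The factor in \<open>s\<close> is beaten by the Peierls decay, with constant
    \<open>K\<close>.\<close>
  have weight: "1 \<le> (1 + real s) ^ ?M * ((real ?l + 2) ^ ?M * poly_weight x j)"
    if "sup_dist x j \<le> s + (?l + 1)" for s j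
  proof -
    have "1 + real (sup_dist x j) \<le> (1 + real s) * (real ?l + 2)"
    proof -
      have "real (sup_dist x j) \<le> real s + real ?l + 1" using that by linarith
      moreover have "0 \<le> real s * real ?l" by simp
      moreover have "(1 + real s) * (real ?l + 2) = real s * real ?l + 2 * real s + real ?l + 2"
        by (simp add: algebra_simps)
      ultimately show ?thesis by linarith
    qed
    then have "(1 + real (sup_dist x j)) ^ ?M \<le> ((1 + real s) * (real ?l + 2)) ^ ?M"
      by (intro power_mono) auto
    then have "1 \<le> ((1 + real s) * (real ?l + 2)) ^ ?M / (1 + real (sup_dist x j)) ^ ?M"
      by (subst pos_le_divide_eq) auto
    then show ?thesis
      by (simp only: poly_weight_def power_mult_distrib times_divide_eq_right mult_1_right)
  qed
  have inf1: "of_bool (j \<in> T) \<le> K * (real ?l + 2) ^ ?M * poly_weight x j" for j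
  proof (cases "j \<in> T")
    case True
    then have "1 \<le> (real ?l + 2) ^ ?M * poly_weight x j"
      using weight[of j 0] sup_dist_le_radius[OF finT, of j x] by simp
    also have "\<dots> \<le> K * ((real ?l + 2) ^ ?M * poly_weight x j)"
      using K(1) less_imp_le[OF poly_weight_pos[of x j]] by (intro mult_right_mono[of 1 K, simplified]) auto
    finally show ?thesis using True by (simp add: mult.assoc)
  next
    case False
    then show ?thesis using K(1) less_imp_le[OF poly_weight_pos[of x j]] by simp
  qed
  have inf2: "event_prob \<beta> U (\<lambda>A. j \<in> A) - event_prob \<beta> V (\<lambda>A. j \<in> A)
      \<le> K * (real ?l + 2) ^ ?M * poly_weight x j" for j
  proof -
    define s where "s = sup_dist x j - (?l + 1)"
    let ?w = "(real ?l + 2) ^ ?M * poly_weight x j"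
    have w0: "0 \<le> ?w" using less_imp_le[OF poly_weight_pos[of x j]] by simp
    have "event_prob \<beta> U (\<lambda>A. j \<in> A) - event_prob \<beta> V (\<lambda>A. j \<in> A) \<le> event_prob \<beta> U (reaches s j)"
      unfolding V_def s_def by (rule influence_le_reaches) (use assms finT in auto)
    also have "\<dots> \<le> (1/4) ^ s" by (rule tail)
    also have "\<dots> \<le> (1/4) ^ s * ((1 + real s) ^ ?M * ?w)"
      using weight[of j s] by (simp add: s_def)
    also have "\<dots> \<le> (1/4) ^ s * ((K * 4 ^ s) * ?w)"
      by (intro mult_left_mono mult_right_mono K w0) auto
    also have "\<dots> = K * (real ?l + 2) ^ ?M * poly_weight x j" by (simp add: power_divide)
    finally show ?thesis .
  qed
  \<comment> \<open>The deviation has two parts: inserting the minus spins of \<open>T\<close>,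
    treated here, and shrinking the volume from \<open>U\<close> to \<open>V\<close>.\<close>
  have "\<bar>mean \<beta> V (\<lambda>B. g (T \<union> B)) - mean \<beta> V g\<bar> \<le> (\<Sum>j\<in>U. dl j * of_bool (j \<in> T))"
  proof -
    have "\<bar>g (T \<union> B) - g B\<bar> \<le> (\<Sum>j\<in>U. dl j * of_bool (j \<in> T))" for B
    proof -
      have "\<bar>g (B \<union> T) - g B\<bar> \<le> (\<Sum>j\<in>T - B. dl j)" by (rule oscillation_le[OF lip finT])
      also have "\<dots> \<le> (\<Sum>j\<in>T. dl j)" by (rule sum_mono2) (use finT dl0 in auto)
      also have "\<dots> = (\<Sum>j\<in>U. dl j * of_bool (j \<in> T))"
        by (rule sum.mono_neutral_cong_left) (use assms in auto)
      finally show ?thesis by (simp add: Un_commute)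
    qed
    then have "mean \<beta> V (\<lambda>B. \<bar>g (T \<union> B) - g B\<bar>) \<le> mean \<beta> V (\<lambda>_. \<Sum>j\<in>U. dl j * of_bool (j \<in> T))"
      by (intro mean_mono finV)
    then show ?thesis
      using abs_mean_le[OF finV, of \<beta> "\<lambda>B. g (T \<union> B) - g B"] by (simp add: mean_diff mean_const finV)
  qed
  moreover have "\<bar>mean \<beta> V g - mean \<beta> U g\<bar>
      \<le> (\<Sum>j\<in>U. dl j * (event_prob \<beta> U (\<lambda>A. j \<in> A) - event_prob \<beta> V (\<lambda>A. j \<in> A)))"
    by (rule mean_diff_volume) (use assms lip in \<open>auto simp: V_def\<close>)
  ultimately have "\<bar>mean \<beta> V (\<lambda>B. g (T \<union> B)) - mean \<beta> U g\<bar>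
      \<le> (\<Sum>j\<in>U. dl j * of_bool (j \<in> T))
        + (\<Sum>j\<in>U. dl j * (event_prob \<beta> U (\<lambda>A. j \<in> A) - event_prob \<beta> V (\<lambda>A. j \<in> A)))"
    by linarith
  also have "\<dots> \<le> (\<Sum>j\<in>U. dl j * (K * (real ?l + 2) ^ ?M * poly_weight x j))
      + (\<Sum>j\<in>U. dl j * (K * (real ?l + 2) ^ ?M * poly_weight x j))"
    by (intro add_mono sum_mono mult_left_mono inf1 inf2 dl0)
  also have "\<dots> = 2 * K * (real ?l + 2) ^ ?M * (\<Sum>j\<in>U. dl j * poly_weight x j)"
  proof -
    have "(\<Sum>j\<in>U. dl j * (c * poly_weight x j)) = c * (\<Sum>j\<in>U. dl j * poly_weight x j)" for c
      by (simp add: sum_distrib_left mult_ac)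
    then show ?thesis by simp
  qed
  finally show ?thesis unfolding V_def .
qed

text \<open>Induction on the volume, exploring one cluster at a time.\<close>

lemma moment_recursion:
  fixes S :: "(int ^ 'd::finite) set" and g :: "(int ^ 'd) set \<Rightarrow> real"
  assumes \<beta>: "0 \<le> \<beta>" and S: "finite S" and p: "1 \<le> p"
    and tail: "\<And>(U :: (int ^ 'd) set) r x. finite U \<Longrightarrow> event_prob \<beta> U (reaches r x) \<le> (1/4) ^ r"
    and K: "1 \<le> K" "\<And>r::nat. (1 + real r) ^ (2 * CARD('d)) \<le> K * 4 ^ r"
    and lip: "\<And>A j. \<bar>g (insert j A) - g A\<bar> \<le> dl j"
    and U: "U \<subseteq> S"
  defines "u \<equiv> \<lambda>x. \<Sum>j\<in>S. dl j * poly_weight x j"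
    and "b \<equiv> 90 * K * (real (4 * p * CARD('d))) ^ (2 * CARD('d))"
  shows "mean \<beta> U (\<lambda>A. (a + g A - mean \<beta> U g) ^ (2 * p)) \<le> (a\<^sup>2 + (16 * real p * b)\<^sup>2 * (\<Sum>x\<in>U. (u x)\<^sup>2)) ^ p"
  using finite_subset[OF U S] U lip
proof (induction U arbitrary: g a rule: finite_psubset_induct)
  case (psubset U)
  let ?M = "2 * CARD('d)"
  note lip = psubset.prems(2)
  have dl0: "0 \<le> dl j" for j using lip[of j "{}"] abs_ge_zero order_trans by blast
  have u0: "0 \<le> u x" for x
    unfolding u_def by (intro sum_nonneg mult_nonneg_nonneg dl0 less_imp_le[OF poly_weight_pos])
  have b0: "0 \<le> b" using K(1) by (simp add: b_def)
  show ?case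
  proof (cases "U = {}")
    case True
    then show ?thesis by (simp add: power_mult)
  next
    case False
    then obtain x where x: "x \<in> U" by blast
    define I where "I = (\<lambda>A. cluster A {x}) ` Pow U"
    define P where "P = cluster_prob \<beta> U {x}"
    define V where "V T = U - explored {x} T" for T
    define D where "D T = mean \<beta> (V T) (\<lambda>B. g (T \<union> B)) - mean \<beta> U g" for T
    \<comment> \<open>The site \<open>x\<close> is explored whatever its spin, so all later volumes
      lie in \<open>U - {x}\<close> and the square of \<open>u x\<close> is charged once.\<close>
    define s where "s = (16 * real p * b)\<^sup>2 * (\<Sum>y\<in>U - {x}. (u y)\<^sup>2)"
    have finV: "finite (V T)" for T using psubset.hyps by (simp add: V_def)
    have markov: "mean \<beta> U f = (\<Sum>T\<in>I. P T * mean \<beta> (V T) (\<lambda>B. f (T \<union> B)))" for f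
      unfolding I_def P_def V_def by (rule mean_cluster[OF psubset.hyps])
    have P0: "0 \<le> P T" for T unfolding P_def by (rule cluster_prob_nonneg[OF psubset.hyps])
    have P1: "(\<Sum>T\<in>I. P T) = 1"
      using markov[of "\<lambda>_. 1"] by (simp add: mean_const psubset.hyps finV)
    have "(\<Sum>T\<in>I. P T * D T) = (\<Sum>T\<in>I. P T * mean \<beta> (V T) (\<lambda>B. g (T \<union> B))) - (\<Sum>T\<in>I. P T) * mean \<beta> U g"
      by (simp add: D_def algebra_simps sum_subtractf sum_distrib_right)
    then have PD: "(\<Sum>T\<in>I. P T * D T) = 0" using markov[of g] P1 by simp
    have TU: "T \<subseteq> U" if "T \<in> I" for T
      using that cluster_subset unfolding I_def by fastforce
    have Dle: "\<bar>D T\<bar> \<le> 2 * K * u x * (real (radius x T) + 2) ^ ?M" if "T \<in> I" for T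
    proof -
      have "\<bar>D T\<bar> \<le> 2 * K * (real (radius x T) + 2) ^ ?M * (\<Sum>j\<in>U. dl j * poly_weight x j)"
        using mean_cluster_deviation[OF psubset.hyps \<beta> TU[OF that] tail[OF psubset.hyps] lip K, of x]
        by (simp only: D_def V_def)
      also have "\<dots> \<le> 2 * K * (real (radius x T) + 2) ^ ?M * u x"
        unfolding u_def using K(1) psubset.prems(1) S
        by (intro mult_left_mono sum_mono2 mult_nonneg_nonneg dl0 less_imp_le[OF poly_weight_pos]) auto
      finally show ?thesis by (simp add: mult_ac)
    qed
    have moments: "(\<Sum>T\<in>I. P T * \<bar>D T\<bar> ^ i) \<le> (b * u x) ^ i" if i: "1 \<le> i" "i \<le> 2 * p" for i
    proof -
      let ?c = "2 * K * u x"
      have c0: "0 \<le> ?c" using K(1) u0 by simp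
      have "(\<Sum>T\<in>I. P T * \<bar>D T\<bar> ^ i) \<le> (\<Sum>T\<in>I. P T * (?c ^ i * (real (radius x T) + 2) ^ (?M * i)))"
      proof (intro sum_mono mult_left_mono P0)
        fix T assume "T \<in> I"
        then have "\<bar>D T\<bar> ^ i \<le> (?c * (real (radius x T) + 2) ^ ?M) ^ i" by (intro power_mono Dle) auto
        then show "\<bar>D T\<bar> ^ i \<le> ?c ^ i * (real (radius x T) + 2) ^ (?M * i)"
          by (simp only: power_mult_distrib power_mult)
      qed
      also have "\<dots> = ?c ^ i * mean \<beta> U (\<lambda>A. (real (radius x (cluster A {x})) + 2) ^ (?M * i))"
        unfolding I_def P_def
        by (subst sum_cluster_prob[OF psubset.hyps, where \<phi> = "\<lambda>T. ?c ^ i * (real (radius x T) + 2) ^ (?M * i)"])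
           (rule mean_cmult)
      also have "\<dots> \<le> ?c ^ i * (45 * fact (?M * i))"
        using c0 by (intro mult_left_mono mean_radius_power psubset.hyps tail) auto
      \<comment> \<open>The factorial is at most \<open>n ^ n\<close> with
        \<open>n = ?M * i \<le> 4 * p * d\<close>, as \<open>i \<le> 2 * p\<close>. Raising
        \<open>45\<close> to the power \<open>i\<close> gives a pure \<open>i\<close>-th power;
        together with the \<open>2\<close> in \<open>?c\<close> it yields the \<open>90\<close> in
        \<open>b\<close>.\<close>
      also have "\<dots> \<le> ?c ^ i * (45 ^ i * (real (4 * p * CARD('d)) ^ ?M) ^ i)"
      proof (intro mult_left_mono mult_mono)
        have "(fact (?M * i) :: real) \<le> real ((?M * i) ^ (?M * i))"
          by (metis fact_le_power le_refl of_nat_fact of_nat_mono)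
        also have "\<dots> \<le> real (4 * p * CARD('d)) ^ (?M * i)"
          unfolding of_nat_power by (intro power_mono of_nat_mono) (use i in auto)
        finally show "(fact (?M * i) :: real) \<le> (real (4 * p * CARD('d)) ^ ?M) ^ i"
          by (simp only: power_mult)
        show "(45 :: real) \<le> 45 ^ i" using i by (intro self_le_power) auto
      qed (use c0 in auto)
      also have "\<dots> = (b * u x) ^ i"
      proof -
        have "b * u x = ?c * (45 * real (4 * p * CARD('d)) ^ ?M)" by (simp add: b_def)
        then show ?thesis by (simp only: power_mult_distrib)
      qed
      finally show ?thesis .
    qed
    \<comment> \<open>The shift \<open>a\<close> collects the increments already revealed: given
      \<open>T\<close>, the deviation of \<open>g\<close> from its mean in \<open>U\<close> is
      \<open>D T\<close> plus its deviation from the conditional mean. This is why the induction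
      generalizes over \<open>a\<close> and \<open>g\<close>.\<close>
    have "mean \<beta> U (\<lambda>A. (a + g A - mean \<beta> U g) ^ (2 * p))
      = (\<Sum>T\<in>I. P T * mean \<beta> (V T) (\<lambda>B. ((a + D T) + g (T \<union> B) - mean \<beta> (V T) (\<lambda>B. g (T \<union> B))) ^ (2 * p)))"
    proof -
      have "a + D T + g (T \<union> B) - mean \<beta> (V T) (\<lambda>B. g (T \<union> B)) = a + g (T \<union> B) - mean \<beta> U g" for T B
        by (simp add: D_def)
      then show ?thesis
        using markov[of "\<lambda>A. (a + g A - mean \<beta> U g) ^ (2 * p)"] by (simp only:)
    qed
    also have "\<dots> \<le> (\<Sum>T\<in>I. P T * ((a + D T)\<^sup>2 + s) ^ p)"
    proof (intro sum_mono mult_left_mono P0)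
      fix T assume "T \<in> I"
      have xV: "x \<notin> V T" "V T \<subseteq> U - {x}" by (auto simp: V_def explored_def)
      then have "V T \<subset> U" using x by auto
      then have "mean \<beta> (V T) (\<lambda>B. ((a + D T) + g (T \<union> B) - mean \<beta> (V T) (\<lambda>B. g (T \<union> B))) ^ (2 * p))
          \<le> ((a + D T)\<^sup>2 + (16 * real p * b)\<^sup>2 * (\<Sum>x\<in>V T. (u x)\<^sup>2)) ^ p"
      proof (rule psubset.IH)
        show "V T \<subseteq> S" using psubset.prems(1) by (auto simp: V_def)
        show "\<bar>g (T \<union> insert j A) - g (T \<union> A)\<bar> \<le> dl j" for j A
          using lip[of j "T \<union> A"] by simp
      qed
      also have "\<dots> \<le> ((a + D T)\<^sup>2 + s) ^ p"
        unfolding s_def using xV psubset.hyps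
        by (intro power_mono add_left_mono mult_left_mono sum_mono2 add_nonneg_nonneg mult_nonneg_nonneg sum_nonneg) auto
      finally show "mean \<beta> (V T) (\<lambda>B. ((a + D T) + g (T \<union> B) - mean \<beta> (V T) (\<lambda>B. g (T \<union> B))) ^ (2 * p))
          \<le> ((a + D T)\<^sup>2 + s) ^ p" .
    qed
    also have "\<dots> \<le> (a\<^sup>2 + s + (16 * real p * (b * u x))\<^sup>2) ^ p"
      by (rule potential_step) (use P0 P1 PD moments p b0 u0 in \<open>auto simp: s_def intro!: sum_nonneg mult_nonneg_nonneg\<close>)
    also have "s + (16 * real p * (b * u x))\<^sup>2 = (16 * real p * b)\<^sup>2 * (\<Sum>x\<in>U. (u x)\<^sup>2)"
      using x psubset.hyps by (simp add: s_def sum.remove[of U x] power_mult_distrib algebra_simps)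
    then have "a\<^sup>2 + s + (16 * real p * (b * u x))\<^sup>2 = a\<^sup>2 + (16 * real p * b)\<^sup>2 * (\<Sum>x\<in>U. (u x)\<^sup>2)" by simp
    finally show ?thesis .
  qed
qed

text \<open>The constant \<open>Q\<close> precedes all quantifiers. The shift \<open>a\<close> is
  kept in order to centre at the infinite volume mean later.\<close>

theorem finite_volume_moments:
  assumes d: "2 \<le> CARD('d::finite)"
  shows "\<exists>Q>0. \<forall>\<beta> p (U :: (int ^ 'd) set) g dl a.
    0 \<le> \<beta> \<longrightarrow> 8 * real (near_degree TYPE('d)) ^ 2 \<le> exp (2 * \<beta>) \<longrightarrow> 1 \<le> p \<longrightarrow> finite U \<longrightarrow>
    (\<forall>A j. \<bar>g (insert j A) - g A\<bar> \<le> dl j) \<longrightarrow>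
    mean \<beta> U (\<lambda>A. (a + g A - mean \<beta> U g) ^ (2 * p))
      \<le> (a\<^sup>2 + (Q * real p ^ (2 * CARD('d) + 1))\<^sup>2 * (\<Sum>j\<in>U. (dl j)\<^sup>2)) ^ p"
proof -
  let ?M = "2 * CARD('d)"
  obtain K where K: "1 \<le> K" "\<And>r::nat. (1 + real r) ^ ?M \<le> K * 4 ^ r"
    using power_le_4_power by blast
  define Q where "Q = 16 * 90 * K * real (4 * CARD('d)) ^ ?M * 4 ^ CARD('d)"
  have Q: "0 < Q" using K(1) d by (simp add: Q_def)
  have "mean \<beta> U (\<lambda>A. (a + g A - mean \<beta> U g) ^ (2 * p))
      \<le> (a\<^sup>2 + (Q * real p ^ (?M + 1))\<^sup>2 * (\<Sum>j\<in>U. (dl j)\<^sup>2)) ^ p"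
    if h: "0 \<le> \<beta>" "8 * real (near_degree TYPE('d)) ^ 2 \<le> exp (2 * \<beta>)" "1 \<le> p" "finite U"
      "\<forall>A j. \<bar>g (insert j A) - g A\<bar> \<le> dl j"
    for \<beta> a and p :: nat and U :: "(int ^ 'd) set" and g dl
  proof -
    have tail: "event_prob \<beta> U (reaches r x) \<le> (1/4) ^ r" if "finite U" for U :: "(int ^ 'd) set" and r x
      using peierls[OF d h(1,2) that, of r x] zero_le_power[of "1/4 :: real" r] by linarith
    let ?u = "\<lambda>x. \<Sum>j\<in>U. dl j * poly_weight x j"
    define b where "b = 90 * K * (real (4 * p * CARD('d))) ^ ?M"
    have "mean \<beta> U (\<lambda>A. (a + g A - mean \<beta> U g) ^ (2 * p)) \<le> (a\<^sup>2 + (16 * real p * b)\<^sup>2 * (\<Sum>x\<in>U. (?u x)\<^sup>2)) ^ p"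
      unfolding b_def by (rule moment_recursion[OF h(1) h(4) h(3) tail K]) (use h(5) in auto)
    also have "\<dots> \<le> (a\<^sup>2 + (16 * real p * b)\<^sup>2 * ((4 ^ CARD('d))\<^sup>2 * (\<Sum>j\<in>U. (dl j)\<^sup>2))) ^ p"
      by (intro power_mono add_left_mono mult_left_mono sum_convolution_squares h(4)
          add_nonneg_nonneg mult_nonneg_nonneg sum_nonneg) auto
    also have "(16 * real p * b)\<^sup>2 * ((4 ^ CARD('d))\<^sup>2 * (\<Sum>j\<in>U. (dl j)\<^sup>2))
        = (Q * real p ^ (?M + 1))\<^sup>2 * (\<Sum>j\<in>U. (dl j)\<^sup>2)"
    proof -
      have "16 * real p * b * 4 ^ CARD('d) = Q * real p ^ (?M + 1)"
        by (simp add: Q_def b_def power_mult_distrib)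
      then have "(16 * real p * b * 4 ^ CARD('d))\<^sup>2 = (Q * real p ^ (?M + 1))\<^sup>2" by (simp only:)
      moreover have "(16 * real p * b)\<^sup>2 * ((4 ^ CARD('d))\<^sup>2 * (\<Sum>j\<in>U. (dl j)\<^sup>2))
          = (16 * real p * b * 4 ^ CARD('d))\<^sup>2 * (\<Sum>j\<in>U. (dl j)\<^sup>2)"
        by (simp only: power_mult_distrib mult.assoc)
      ultimately show ?thesis by (simp only:)
    qed
    finally show ?thesis .
  qed
  then show ?thesis using Q by blast
qed

section \<open>The plus phase as the limit of the finite volume measures\<close>

lemma nearest_neighbour_iff_adjacent:
  fixes x y :: "int ^ 'd::finite"
  shows "nearest_neighbour x y \<longleftrightarrow> adjacent x y"
proof
  assume "adjacent x y"
  then obtain i where "y = x + axis i 1 \<or> x = y + axis i 1" unfolding adjacent_def by blast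
  then have "\<bar>x $ j - y $ j\<bar> = (if j = i then 1 else 0)" for j by (auto simp: axis_def)
  then show "nearest_neighbour x y" by (simp add: nearest_neighbour_def)
next
  assume "nearest_neighbour x y"
  then have s: "(\<Sum>i\<in>UNIV. \<bar>x $ i - y $ i\<bar>) = 1" by (simp add: nearest_neighbour_def)
  have "\<not> (\<forall>i. x $ i = y $ i)"
  proof
    assume "\<forall>i. x $ i = y $ i"
    then have "(\<Sum>i\<in>UNIV. \<bar>x $ i - y $ i\<bar>) = 0" by simp
    then show False using s by simp
  qed
  then obtain i where i: "x $ i \<noteq> y $ i" by blast
  have "(\<Sum>j\<in>UNIV. \<bar>x $ j - y $ j\<bar>) = \<bar>x $ i - y $ i\<bar> + (\<Sum>j\<in>UNIV - {i}. \<bar>x $ j - y $ j\<bar>)"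
    by (rule sum.remove) auto
  moreover have "0 \<le> (\<Sum>j\<in>UNIV - {i}. \<bar>x $ j - y $ j\<bar>)" by (rule sum_nonneg) auto
  ultimately have 1: "\<bar>x $ i - y $ i\<bar> = 1" and 0: "(\<Sum>j\<in>UNIV - {i}. \<bar>x $ j - y $ j\<bar>) = 0"
    using s i by linarith+
  have other: "x $ j = y $ j" if "j \<noteq> i" for j
    using 0 that by (subst (asm) sum_nonneg_eq_0_iff) auto
  have "y = x + axis i 1 \<or> x = y + axis i 1"
  proof (cases "x $ i < y $ i")
    case True
    then have "y = x + axis i 1" using 1 other by (auto simp: vec_eq_iff axis_def)
    then show ?thesis ..
  next
    case False
    then have "x = y + axis i 1" using 1 other by (auto simp: vec_eq_iff axis_def)
    then show ?thesis ..
  qed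
  then show "adjacent x y" unfolding adjacent_def by blast
qed

lemma card_boundary_bonds:
  fixes A :: "(int ^ 'a::finite) set"
  shows "card (boundary_bonds A) = card (edge_boundary A)"
proof (rule bij_betw_same_card[symmetric])
  let ?f = "\<lambda>(x, i). if x \<in> A then (x, x + axis i 1) else (x + axis i 1, x)"
  show "bij_betw ?f (edge_boundary A) (boundary_bonds A)"
    unfolding bij_betw_def
  proof
    show "inj_on ?f (edge_boundary A)"
    proof (rule inj_onI)
      fix e e' assume "e \<in> edge_boundary A" "e' \<in> edge_boundary A" and eq: "?f e = ?f e'"
      then obtain x i y j where *: "e = (x, i)" "e' = (y, j)"
        "(x \<in> A) \<noteq> (x + axis i 1 \<in> A)" "(y \<in> A) \<noteq> (y + axis j 1 \<in> A)"
        by (auto simp: edge_boundary_def)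
      \<comment> \<open>Excludes that two different bonds give the same ordered pair with opposite
        orientations.\<close>
      have "axis i 1 + axis j 1 \<noteq> (0 :: int ^ 'a)" for i j :: 'a
      proof
        assume "axis i 1 + axis j 1 = (0 :: int ^ 'a)"
        then have "(axis i 1 + axis j 1 :: int ^ 'a) $ i = 0" by simp
        then show False by (simp add: axis_def split: if_splits)
      qed
      then have "x = y \<and> x + axis i 1 = y + axis j 1"
        using eq * by (auto split: if_splits)
      then show "e = e'" using * by (auto simp: axis_eq_axis)
    qed
    show "?f ` edge_boundary A = boundary_bonds A"
    proof (intro equalityI subsetI)
      fix p assume "p \<in> ?f ` edge_boundary A"
      then show "p \<in> boundary_bonds A"
        by (auto simp: edge_boundary_def boundary_bonds_def nearest_neighbour_iff_adjacent adjacent_def)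
    next
      fix p assume "p \<in> boundary_bonds A"
      then obtain x y where p: "p = (x, y)" "x \<in> A" "y \<notin> A" "adjacent x y"
        by (auto simp: boundary_bonds_def nearest_neighbour_iff_adjacent)
      then obtain i where "y = x + axis i 1 \<or> x = y + axis i 1" unfolding adjacent_def by blast
      then show "p \<in> ?f ` edge_boundary A"
      proof
        assume "y = x + axis i 1"
        then show ?thesis using p by (intro image_eqI[where x = "(x, i)"]) (auto simp: edge_boundary_def)
      next
        assume "x = y + axis i 1"
        then show ?thesis using p by (intro image_eqI[where x = "(y, i)"]) (auto simp: edge_boundary_def)
      qed
    qed
  qed
qed

definition minus_config :: "(int ^ 'd::finite) set \<Rightarrow> 'd config" where
  "minus_config A = (\<lambda>x. x \<notin> A)"

lemma minus_config_eq_iff [simp]: "minus_config A = minus_config B \<longleftrightarrow> A = B"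
  by (auto simp: minus_config_def fun_eq_iff)

lemma plus_configs_eq_image: "plus_configs \<Lambda> = minus_config ` Pow \<Lambda>"
proof (intro equalityI subsetI)
  fix \<sigma> assume "\<sigma> \<in> plus_configs \<Lambda>"
  then show "\<sigma> \<in> minus_config ` Pow \<Lambda>"
    by (intro image_eqI[where x = "{x. \<not> \<sigma> x}"]) (auto simp: plus_configs_def minus_config_def)
qed (auto simp: plus_configs_def minus_config_def)

text \<open>A bond contributes \<beta> if its ends agree and \<open>- \<beta>\<close> otherwise, so
  each disagreement costs \<open>2 * \<beta>\<close>. The disagreements are the boundary bonds of
  \<open>A\<close>, split into those inside \<Lambda> and those leaving it; the prefactor depends
  only on \<Lambda> and \<beta> and cancels on normalization.\<close>

lemma ising_plus_weight_minus_config: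
  fixes A :: "(int ^ 'd::finite) set"
  assumes "finite \<Lambda>" "A \<subseteq> \<Lambda>"
  shows "ising_plus_weight \<Lambda> \<beta> (minus_config A)
    = exp (\<beta> * (real (card (inner_bonds \<Lambda>)) + real (card (boundary_bonds \<Lambda>)))) * weight \<beta> A"
proof -
  let ?I = "{e \<in> boundary_bonds A. snd e \<in> \<Lambda>}" and ?O = "{e \<in> boundary_bonds A. snd e \<notin> \<Lambda>}"
  let ?pair = "\<lambda>e :: (int ^ 'd) \<times> (int ^ 'd). {fst e, snd e}"
  let ?C = "?pair ` ?I"
  have finA: "finite A" using assms finite_subset by blast
  have finbA: "finite (boundary_bonds A)" by (rule finite_boundary_bonds[OF finA])
  have finI: "finite (inner_bonds \<Lambda>)"
    by (rule finite_subset[of _ "Pow \<Lambda>"]) (use assms in \<open>auto simp: inner_bonds_def\<close>)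
  have finb: "finite (boundary_bonds \<Lambda>)" by (rule finite_boundary_bonds[OF assms(1)])
  have bond: "(\<Prod>x\<in>b. spin (minus_config A x)) = 1 - 2 * of_bool (b \<in> ?C)" if "b \<in> inner_bonds \<Lambda>" for b
  proof -
    obtain x y where b: "b = {x, y}" "x \<in> \<Lambda>" "y \<in> \<Lambda>" "nearest_neighbour x y"
      using \<open>b \<in> inner_bonds \<Lambda>\<close> by (auto simp: inner_bonds_def)
    have nn: "nearest_neighbour y x" using b(4) by (simp add: nearest_neighbour_iff_adjacent adjacent_commute)
    have "x \<noteq> y" using b(4) by (auto simp: nearest_neighbour_def)
    then have "(\<Prod>x\<in>b. spin (minus_config A x)) = (if (x \<in> A) = (y \<in> A) then 1 else - 1)"
      by (auto simp: b(1) spin_def minus_config_def)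
    moreover have "b \<in> ?C \<longleftrightarrow> (x \<in> A) \<noteq> (y \<in> A)"
    proof
      assume "b \<in> ?C"
      then obtain u v where "u \<in> A" "v \<notin> A" "b = {u, v}" by (auto simp: boundary_bonds_def)
      then show "(x \<in> A) \<noteq> (y \<in> A)" using b(1) by (auto simp: doubleton_eq_iff)
    next
      assume "(x \<in> A) \<noteq> (y \<in> A)"
      then consider "x \<in> A" "y \<notin> A" | "x \<notin> A" "y \<in> A" by blast
      then show "b \<in> ?C"
      proof cases
        case 1
        then show ?thesis using b by (intro image_eqI[where x = "(x, y)"]) (auto simp: boundary_bonds_def)
      next
        case 2
        then show ?thesis using b nn by (intro image_eqI[where x = "(y, x)"]) (auto simp: boundary_bonds_def)
      qed
    qed
    ultimately show ?thesis by auto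
  qed
  have "?C \<subseteq> inner_bonds \<Lambda>"
  proof
    fix b assume "b \<in> ?C"
    then obtain x y where "b = {x, y}" "x \<in> A" "y \<in> \<Lambda>" "nearest_neighbour x y"
      by (auto simp: boundary_bonds_def)
    then show "b \<in> inner_bonds \<Lambda>" using assms(2) unfolding inner_bonds_def by blast
  qed
  moreover have "card ?C = card ?I"
    by (rule card_image, rule inj_onI) (auto simp: boundary_bonds_def doubleton_eq_iff)
  ultimately have inner: "(\<Sum>b\<in>inner_bonds \<Lambda>. \<Prod>x\<in>b. spin (minus_config A x))
      = real (card (inner_bonds \<Lambda>)) - 2 * real (card ?I)"
    using finI by (simp add: bond sum_subtractf Int_absorb1 flip: sum_distrib_left)
  have "{e \<in> boundary_bonds \<Lambda>. fst e \<in> A} = ?O"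
    using assms(2) by (auto simp: boundary_bonds_def)
  moreover have "(\<Sum>(x, y)\<in>boundary_bonds \<Lambda>. spin (minus_config A x))
      = (\<Sum>e\<in>boundary_bonds \<Lambda>. 1 - 2 * of_bool (fst e \<in> A))"
    by (rule sum.cong) (auto simp: spin_def minus_config_def)
  ultimately have boundary: "(\<Sum>(x, y)\<in>boundary_bonds \<Lambda>. spin (minus_config A x))
      = real (card (boundary_bonds \<Lambda>)) - 2 * real (card ?O)"
    using finb by (simp add: sum_subtractf Int_def flip: sum_distrib_left)
  have "card (edge_boundary A) = card (?I \<union> ?O)"
    unfolding card_boundary_bonds[symmetric] by (rule arg_cong[where f = card]) auto
  also have "\<dots> = card ?I + card ?O"
    using finbA by (intro card_Un_disjoint) auto
  finally have "card (edge_boundary A) = card ?I + card ?O" .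
  then show ?thesis
    by (simp add: ising_plus_weight_def inner boundary weight_def algebra_simps flip: exp_add)
qed

lemma expectation_ising_plus:
  assumes "finite \<Lambda>"
  shows "measure_pmf.expectation (ising_plus \<Lambda> \<beta>) f = mean \<beta> \<Lambda> (\<lambda>A. f (minus_config A))"
proof -
  let ?c = "exp (\<beta> * (real (card (inner_bonds \<Lambda>)) + real (card (boundary_bonds \<Lambda>))))"
  have inj: "inj_on minus_config (Pow \<Lambda>)" by (auto simp: inj_on_def)
  have Z: "ising_plus_partition \<Lambda> \<beta> = ?c * partition_sum \<beta> \<Lambda>"
    unfolding ising_plus_partition_def partition_sum_def plus_configs_eq_image
    by (simp add: sum.reindex[OF inj] ising_plus_weight_minus_config[OF assms] sum_distrib_left)
  have "measure_pmf.expectation (ising_plus \<Lambda> \<beta>) f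
      = (\<Sum>\<sigma>\<in>plus_configs \<Lambda>. f \<sigma> * pmf (ising_plus \<Lambda> \<beta>) \<sigma>)"
    by (rule integral_measure_pmf_real)
       (auto simp: finite_plus_configs[OF assms] set_pmf_iff pmf_ising_plus[OF assms] split: if_splits)
  also have "\<dots> = (\<Sum>A\<in>Pow \<Lambda>. f (minus_config A) * (?c * weight \<beta> A / (?c * partition_sum \<beta> \<Lambda>)))"
    unfolding plus_configs_eq_image
    by (subst sum.reindex[OF inj])
       (auto simp: pmf_ising_plus[OF assms] plus_configs_eq_image Z ising_plus_weight_minus_config[OF assms])
  also have "\<dots> = mean \<beta> \<Lambda> (\<lambda>A. f (minus_config A))"
    by (simp add: mean_def sum_divide_distrib mult.commute)
  finally show ?thesis .
qed

section \<open>Limits of the probabilities of local patterns\<close>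

lemma tendsto_increasing_net:
  fixes h :: "'a set \<Rightarrow> real"
  assumes mono: "\<And>A B. finite B \<Longrightarrow> A \<subseteq> B \<Longrightarrow> h A \<le> h B" and bound: "\<And>A. finite A \<Longrightarrow> h A \<le> c"
  shows "\<exists>l. (h \<longlongrightarrow> l) (finite_subsets_at_top UNIV)"
proof -
  let ?l = "SUP A\<in>{A. finite A}. h A"
  have bdd: "bdd_above (h ` {A. finite A})" using bound by (auto intro!: bdd_aboveI2)
  have "(h \<longlongrightarrow> ?l) (finite_subsets_at_top UNIV)"
  proof (rule order_tendstoI)
    fix a assume "a < ?l"
    then obtain A where A: "finite A" "a < h A"
      using less_cSUP_iff[OF _ bdd, of a] by auto
    then show "eventually (\<lambda>B. a < h B) (finite_subsets_at_top UNIV)"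
      unfolding eventually_finite_subsets_at_top
      using mono by (intro exI[of _ A]) (auto intro: less_le_trans)
  next
    fix a assume "?l < a"
    then show "eventually (\<lambda>B. h B < a) (finite_subsets_at_top UNIV)"
      by (intro eventually_finite_subsets_at_top_weakI) (auto intro: le_less_trans[OF cSUP_upper[OF _ bdd]])
  qed
  then show ?thesis by blast
qed

lemma eventually_finite_volume: "eventually finite (finite_subsets_at_top UNIV)"
  by (rule eventually_finite_subsets_at_top_weakI)

text \<open>With no plus constraint the event is increasing, so its probability is monotone in the
  volume. Each plus constraint is removed by writing the event as a difference of two events with
  fewer plus constraints.\<close>

lemma pattern_prob_converges:
  fixes T R :: "(int ^ 'd::finite) set"
  assumes "0 \<le> \<beta>" "finite R"
  shows "\<exists>l. ((\<lambda>\<Lambda>. event_prob \<beta> \<Lambda> (\<lambda>A. T \<subseteq> A \<and> R \<inter> A = {})) \<longlongrightarrow> l) (finite_subsets_at_top UNIV)"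
  using assms(2)
proof (induction R arbitrary: T rule: finite_induct)
  case empty
  show ?case
  proof (rule tendsto_increasing_net[where c = 1])
    fix U V :: "(int ^ 'd) set" assume "finite V" "U \<subseteq> V"
    then show "event_prob \<beta> U (\<lambda>A. T \<subseteq> A \<and> {} \<inter> A = {}) \<le> event_prob \<beta> V (\<lambda>A. T \<subseteq> A \<and> {} \<inter> A = {})"
      by (intro mean_mono_volume assms(1)) auto
  qed (rule event_prob_le_1)
next
  case (insert x R)
  obtain l where l: "((\<lambda>\<Lambda>. event_prob \<beta> \<Lambda> (\<lambda>A. T \<subseteq> A \<and> R \<inter> A = {})) \<longlongrightarrow> l) (finite_subsets_at_top UNIV)"
    using insert.IH by blast
  obtain l' where l': "((\<lambda>\<Lambda>. event_prob \<beta> \<Lambda> (\<lambda>A. insert x T \<subseteq> A \<and> R \<inter> A = {})) \<longlongrightarrow> l') (finite_subsets_at_top UNIV)"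
    using insert.IH by blast
  have "event_prob \<beta> \<Lambda> (\<lambda>A. T \<subseteq> A \<and> insert x R \<inter> A = {})
      = event_prob \<beta> \<Lambda> (\<lambda>A. T \<subseteq> A \<and> R \<inter> A = {}) - event_prob \<beta> \<Lambda> (\<lambda>A. insert x T \<subseteq> A \<and> R \<inter> A = {})" for \<Lambda>
    unfolding mean_diff[symmetric] by (rule mean_cong) auto
  then show ?case using tendsto_diff[OF l l'] by auto
qed

definition pattern_limit :: "real \<Rightarrow> (int ^ 'd::finite) set \<Rightarrow> (int ^ 'd) set \<Rightarrow> real" where
  "pattern_limit \<beta> S T = Lim (finite_subsets_at_top UNIV) (\<lambda>\<Lambda>. event_prob \<beta> \<Lambda> (\<lambda>A. A \<inter> S = T))"

lemma pattern_limit: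
  fixes S T :: "(int ^ 'd::finite) set"
  assumes "0 \<le> \<beta>" "finite S" "T \<subseteq> S"
  shows "((\<lambda>\<Lambda>. event_prob \<beta> \<Lambda> (\<lambda>A. A \<inter> S = T)) \<longlongrightarrow> pattern_limit \<beta> S T) (finite_subsets_at_top UNIV)"
proof -
  have "(A \<inter> S = T) = (T \<subseteq> A \<and> (S - T) \<inter> A = {})" for A using assms(3) by auto
  then obtain l where l: "((\<lambda>\<Lambda>. event_prob \<beta> \<Lambda> (\<lambda>A. A \<inter> S = T)) \<longlongrightarrow> l) (finite_subsets_at_top UNIV)"
    using pattern_prob_converges[OF assms(1), of "S - T" T] assms(2) by auto
  moreover have "pattern_limit \<beta> S T = l"
    unfolding pattern_limit_def using l by (intro tendsto_Lim) auto
  ultimately show ?thesis by simp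
qed

lemma pattern_limit_nonneg:
  assumes "0 \<le> \<beta>" "finite S" "T \<subseteq> S"
  shows "0 \<le> pattern_limit \<beta> S T"
  by (rule tendsto_lowerbound[OF pattern_limit[OF assms]])
     (auto intro!: mean_nonneg eventually_mono[OF eventually_finite_volume])

text \<open>The consistency condition for the finite-dimensional distributions, inherited from
  finite volume through finite sums.\<close>

lemma pattern_limit_restrict:
  fixes S S' T :: "(int ^ 'd::finite) set"
  assumes "0 \<le> \<beta>" "finite S" "S' \<subseteq> S" "T \<subseteq> S'"
  shows "(\<Sum>T'\<in>{T' \<in> Pow S. T' \<inter> S' = T}. pattern_limit \<beta> S T') = pattern_limit \<beta> S' T"
proof (rule tendsto_unique[of "finite_subsets_at_top UNIV"])
  have finS': "finite S'" using assms finite_subset by blast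
  let ?P = "{T' \<in> Pow S. T' \<inter> S' = T}"
  have "event_prob \<beta> \<Lambda> (\<lambda>A. A \<inter> S' = T) = (\<Sum>T'\<in>?P. event_prob \<beta> \<Lambda> (\<lambda>A. A \<inter> S = T'))" for \<Lambda>
  proof -
    have "of_bool (A \<inter> S' = T) = (\<Sum>T'\<in>?P. of_bool (A \<inter> S = T') :: real)" for A
    proof -
      have "finite ?P" using assms(2) by simp
      then have "(\<Sum>T'\<in>?P. of_bool (A \<inter> S = T') :: real) = of_bool (A \<inter> S \<in> ?P)"
        unfolding of_bool_def by (rule sum.delta')
      moreover have "A \<inter> S \<in> ?P \<longleftrightarrow> A \<inter> S' = T" using assms(3) by auto
      ultimately show ?thesis by simp
    qed
    then show ?thesis by (simp add: mean_sum)
  qed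
  then show "((\<lambda>\<Lambda>. event_prob \<beta> \<Lambda> (\<lambda>A. A \<inter> S' = T)) \<longlongrightarrow> (\<Sum>T'\<in>?P. pattern_limit \<beta> S T')) (finite_subsets_at_top UNIV)"
    using assms by (auto intro!: tendsto_sum pattern_limit)
  show "((\<lambda>\<Lambda>. event_prob \<beta> \<Lambda> (\<lambda>A. A \<inter> S' = T)) \<longlongrightarrow> pattern_limit \<beta> S' T) (finite_subsets_at_top UNIV)"
    by (rule pattern_limit[OF assms(1) finS' assms(4)])
qed simp

lemma sum_pattern_limit:
  assumes "0 \<le> \<beta>" "finite S"
  shows "(\<Sum>T\<in>Pow S. pattern_limit \<beta> S T) = 1"
proof -
  have "pattern_limit \<beta> {} {} = 1"
    unfolding pattern_limit_def
    by (rule tendsto_Lim) (auto intro!: tendsto_eventually eventually_mono[OF eventually_finite_volume] mean_const)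
  then show ?thesis using pattern_limit_restrict[of \<beta> S "{}" "{}"] assms by (simp add: Pow_def)
qed

text \<open>Makes the Borel sets of the configuration space coincide with the product
  \<sigma>-algebra, so that measures on products can be used.\<close>

instance bool :: second_countable_topology
proof
  have "open S \<longleftrightarrow> generate_topology (UNIV :: bool set set) S" for S
    by (auto intro: Topological_Spaces.open_discrete generate_topology.Basis)
  then show "\<exists>B :: bool set set. countable B \<and> open = generate_topology B"
    by (intro exI[of _ UNIV]) (auto simp: fun_eq_iff)
qed

section \<open>Local sets and continuous functions on the configuration space\<close>

lemma open_local:
  fixes S :: "('a \<Rightarrow> bool) set"
  assumes "finite J" and loc: "\<And>f g. (\<And>x. x \<in> J \<Longrightarrow> f x = g x) \<Longrightarrow> f \<in> S \<Longrightarrow> g \<in> S"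
  shows "open S"
proof -
  have "S = (\<Union>f\<in>S. {g. \<forall>x\<in>J. g x \<in> {f x}})"
    using loc by auto
  moreover have "open {g :: 'a \<Rightarrow> bool. \<forall>x\<in>J. g x \<in> {f x}}" for f
    by (rule product_topology_basis') (auto intro: assms(1) Topological_Spaces.open_discrete)
  ultimately show ?thesis by (metis (no_types, lifting) open_UN)
qed

lemma continuous_on_local:
  fixes f :: "('a \<Rightarrow> bool) \<Rightarrow> 'b::topological_space"
  assumes "finite J" and loc: "\<And>\<sigma> \<tau>. (\<And>x. x \<in> J \<Longrightarrow> \<sigma> x = \<tau> x) \<Longrightarrow> f \<sigma> = f \<tau>"
  shows "continuous_on UNIV f"
proof (rule continuous_on_open_vimage[THEN iffD2, OF open_UNIV], intro allI impI)
  fix B :: "'b set"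
  show "open (f -` B \<inter> UNIV)"
  proof (rule open_local[OF assms(1)])
    fix \<sigma> \<tau> :: "'a \<Rightarrow> bool" assume "\<And>x. x \<in> J \<Longrightarrow> \<sigma> x = \<tau> x" and \<sigma>: "\<sigma> \<in> f -` B \<inter> UNIV"
    then have "f \<sigma> = f \<tau>" by (intro loc)
    then show "\<tau> \<in> f -` B \<inter> UNIV" using \<sigma> by simp
  qed
qed

lemma compact_UNIV_bool: "compact (UNIV :: ('a \<Rightarrow> bool) set)"
proof -
  have "compact_space (euclidean :: bool topology)"
    by (simp add: compact_space_def compactin_euclidean_iff finite_imp_compact)
  then have "compact_space (product_topology (\<lambda>_ :: 'a. euclidean :: bool topology) UNIV)"
    by (simp add: compact_space_product_topology)
  then show ?thesis
    by (simp add: euclidean_product_topology compact_space_def compactin_euclidean_iff)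
qed

lemma cylinder_in_open:
  fixes S :: "('a \<Rightarrow> bool) set"
  assumes "open S" "\<sigma> \<in> S"
  shows "\<exists>J. finite J \<and> {\<tau>. \<forall>x\<in>J. \<tau> x = \<sigma> x} \<subseteq> S"
proof -
  have "openin (product_topology (\<lambda>_. euclidean) UNIV) S"
    using assms(1) by (simp only: open_fun_def)
  from product_topology_open_contains_basis[OF this assms(2)]
  obtain X where X: "\<sigma> \<in> (\<Pi>\<^sub>E i\<in>UNIV. X i)" "finite {i. X i \<noteq> (UNIV :: bool set)}" "(\<Pi>\<^sub>E i\<in>UNIV. X i) \<subseteq> S"
    unfolding topspace_euclidean by blast
  have sub: "{\<tau>. \<forall>x\<in>{i. X i \<noteq> UNIV}. \<tau> x = \<sigma> x} \<subseteq> (\<Pi>\<^sub>E i\<in>UNIV. X i)"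
  proof
    fix \<tau> assume \<tau>: "\<tau> \<in> {\<tau>. \<forall>x\<in>{i. X i \<noteq> UNIV}. \<tau> x = \<sigma> x}"
    have "\<tau> i \<in> X i" for i
    proof (cases "X i = UNIV")
      case False
      then have "\<tau> i = \<sigma> i" using \<tau> by blast
      then show ?thesis using X(1) by auto
    qed simp
    then show "\<tau> \<in> (\<Pi>\<^sub>E i\<in>UNIV. X i)" by auto
  qed
  show ?thesis
    by (rule exI[of _ "{i. X i \<noteq> UNIV}"], rule conjI[OF X(2) order_trans[OF sub X(3)]])
qed

text \<open>By compactness finitely many cylinders, on each of which \<open>f\<close> stays within
  \<open>e / 2\<close> of its value at the centre, cover the space; the sites they mention form
  \<open>J\<close>.\<close>

lemma uniform_local_approximation:
  fixes f :: "('a \<Rightarrow> bool) \<Rightarrow> real"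
  assumes "continuous_on UNIV f" "0 < e"
  shows "\<exists>J. finite J \<and> (\<forall>\<sigma> \<tau>. (\<forall>x\<in>J. \<sigma> x = \<tau> x) \<longrightarrow> \<bar>f \<sigma> - f \<tau>\<bar> < e)"
proof -
  have "\<exists>J. finite J \<and> {\<tau>. \<forall>x\<in>J. \<tau> x = \<sigma> x} \<subseteq> f -` ball (f \<sigma>) (e / 2)" for \<sigma>
    by (rule cylinder_in_open) (use assms in \<open>auto intro: open_vimage\<close>)
  then have "\<forall>\<sigma>. \<exists>J. finite J \<and> {\<tau>. \<forall>x\<in>J. \<tau> x = \<sigma> x} \<subseteq> f -` ball (f \<sigma>) (e / 2)"
    by blast
  from choice[OF this]
  obtain J where J: "\<And>\<sigma>. finite (J \<sigma>)" "\<And>\<sigma>. {\<tau>. \<forall>x\<in>J \<sigma>. \<tau> x = \<sigma> x} \<subseteq> f -` ball (f \<sigma>) (e / 2)"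
    by blast
  let ?Z = "\<lambda>\<sigma>. {\<tau>. \<forall>x\<in>J \<sigma>. \<tau> x = \<sigma> x}"
  have opn: "open (?Z \<sigma>)" for \<sigma>
  proof (rule open_local[OF J(1)[of \<sigma>]])
    fix \<tau> \<tau>' :: "'a \<Rightarrow> bool" assume eq: "\<And>x. x \<in> J \<sigma> \<Longrightarrow> \<tau> x = \<tau>' x" and \<tau>: "\<tau> \<in> ?Z \<sigma>"
    have "\<tau>' x = \<sigma> x" if "x \<in> J \<sigma>" for x using eq[OF that] \<tau> that by blast
    then show "\<tau>' \<in> ?Z \<sigma>" by blast
  qed
  have cover: "UNIV \<subseteq> (\<Union>\<sigma>\<in>UNIV. ?Z \<sigma>)" by blast
  obtain C where C: "finite C" "UNIV \<subseteq> (\<Union>\<sigma>\<in>C. ?Z \<sigma>)"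
  proof (rule compactE_image[OF compact_UNIV_bool _ cover])
    show "open (?Z \<sigma>)" for \<sigma> by (rule opn)
  qed (rule that)
  have "\<bar>f \<tau> - f \<tau>'\<bar> < e" if eq: "\<forall>x\<in>(\<Union>\<sigma>\<in>C. J \<sigma>). \<tau> x = \<tau>' x" for \<tau> \<tau>'
  proof -
    obtain \<sigma> where \<sigma>: "\<sigma> \<in> C" "\<forall>x\<in>J \<sigma>. \<tau> x = \<sigma> x" using C(2) by blast
    then have "\<forall>x\<in>J \<sigma>. \<tau>' x = \<sigma> x" using eq by blast
    then have "\<tau> \<in> f -` ball (f \<sigma>) (e / 2)" "\<tau>' \<in> f -` ball (f \<sigma>) (e / 2)"
      using J(2)[of \<sigma>] \<sigma>(2) by blast+
    then show ?thesis unfolding vimage_eq mem_ball dist_real_def by linarith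
  qed
  then show ?thesis using C(1) J(1) by (intro exI[of _ "\<Union>\<sigma>\<in>C. J \<sigma>"]) auto
qed

definition cylinder :: "'a set \<Rightarrow> 'a set \<Rightarrow> ('a \<Rightarrow> bool) set" where
  "cylinder S T = {\<sigma>. \<forall>x\<in>S. \<sigma> x \<longleftrightarrow> x \<notin> T}"

lemma open_cylinder:
  assumes "finite S"
  shows "open (cylinder S T)"
proof (rule open_local[OF assms])
  fix \<sigma> \<tau> assume eq: "\<And>x. x \<in> S \<Longrightarrow> \<sigma> x = \<tau> x" and \<sigma>: "\<sigma> \<in> cylinder S T"
  have "\<tau> x \<longleftrightarrow> x \<notin> T" if "x \<in> S" for x
    using eq[OF that] \<sigma> that unfolding cylinder_def by blast
  then show "\<tau> \<in> cylinder S T" unfolding cylinder_def by blast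
qed

lemma local_eq_sum_cylinder:
  fixes f :: "'d::finite config \<Rightarrow> real"
  assumes "finite S" and loc: "\<And>\<sigma> \<tau>. (\<And>x. x \<in> S \<Longrightarrow> \<sigma> x = \<tau> x) \<Longrightarrow> f \<sigma> = f \<tau>"
  shows "f \<sigma> = (\<Sum>T\<in>Pow S. f (minus_config T) * indicator (cylinder S T) \<sigma>)"
proof -
  let ?T = "{x \<in> S. \<not> \<sigma> x}"
  have "\<sigma> \<in> cylinder S T \<longleftrightarrow> ?T = T" if "T \<in> Pow S" for T
    using that by (auto simp: cylinder_def)
  then have "(\<Sum>T\<in>Pow S. f (minus_config T) * indicator (cylinder S T) \<sigma>)
      = (\<Sum>T\<in>Pow S. if ?T = T then f (minus_config T) else 0)"
    by (intro sum.cong) (auto simp: indicator_def)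
  also have "\<dots> = f (minus_config ?T)"
    using assms(1) by (subst sum.delta') auto
  also have "\<dots> = f \<sigma>" by (rule loc) (auto simp: minus_config_def)
  finally show ?thesis by simp
qed

lemma mean_local_tendsto:
  fixes f :: "'d::finite config \<Rightarrow> real"
  assumes "0 \<le> \<beta>" "finite S" and loc: "\<And>\<sigma> \<tau>. (\<And>x. x \<in> S \<Longrightarrow> \<sigma> x = \<tau> x) \<Longrightarrow> f \<sigma> = f \<tau>"
  shows "((\<lambda>\<Lambda>. mean \<beta> \<Lambda> (\<lambda>A. f (minus_config A))) \<longlongrightarrow> (\<Sum>T\<in>Pow S. f (minus_config T) * pattern_limit \<beta> S T))
    (finite_subsets_at_top UNIV)"
proof -
  have ind: "indicator (cylinder S T) (minus_config A) = (of_bool (A \<inter> S = T) :: real)" if "T \<in> Pow S" for T A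
    using that by (auto simp: cylinder_def minus_config_def indicator_def)
  have "f (minus_config A) = (\<Sum>T\<in>Pow S. f (minus_config T) * of_bool (A \<inter> S = T))" for A
  proof -
    have "f (minus_config A) = (\<Sum>T\<in>Pow S. f (minus_config T) * indicator (cylinder S T) (minus_config A))"
      by (rule local_eq_sum_cylinder[OF assms(2) loc])
    also have "\<dots> = (\<Sum>T\<in>Pow S. f (minus_config T) * of_bool (A \<inter> S = T))"
      by (rule sum.cong[OF refl]) (simp only: ind)
    finally show ?thesis .
  qed
  then have "mean \<beta> \<Lambda> (\<lambda>A. f (minus_config A))
      = mean \<beta> \<Lambda> (\<lambda>A. \<Sum>T\<in>Pow S. f (minus_config T) * of_bool (A \<inter> S = T))" for \<Lambda>
    by (rule mean_cong)
  also have "\<dots> \<Lambda> = (\<Sum>T\<in>Pow S. f (minus_config T) * event_prob \<beta> \<Lambda> (\<lambda>A. A \<inter> S = T))" for \<Lambda>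
    by (simp only: mean_sum mean_cmult)
  finally show ?thesis
    using assms(1,2) by (auto intro!: tendsto_sum tendsto_mult_left pattern_limit)
qed

text \<open>Sets depending on finitely many sites have continuous indicators, so the limits fix
  their measures, and these sets determine a measure on the product \<sigma>-algebra.\<close>

lemma is_plus_phase_unique:
  fixes \<mu> \<nu> :: "'d::finite config measure"
  assumes "is_plus_phase \<beta> \<mu>" "is_plus_phase \<beta> \<nu>"
  shows "\<mu> = \<nu>"
proof -
  interpret \<mu>: prob_space \<mu> using assms by (simp add: is_plus_phase_def)
  interpret \<nu>: prob_space \<nu> using assms by (simp add: is_plus_phase_def)
  have s: "sets \<mu> = sets borel" "sets \<nu> = sets borel" using assms by (auto simp: is_plus_phase_def)
  have local_eq: "emeasure \<mu> S = emeasure \<nu> S"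
    if "finite J" and loc: "\<And>f g. (\<And>x. x \<in> J \<Longrightarrow> f x = g x) \<Longrightarrow> f \<in> S \<longleftrightarrow> g \<in> S" for J S
  proof -
    have opn: "open S" proof (rule open_local[OF that(1)])
      fix f g assume "\<And>x. x \<in> J \<Longrightarrow> f x = g x" and f: "f \<in> S"
      then have "f \<in> S \<longleftrightarrow> g \<in> S" by (intro loc)
      then show "g \<in> S" using f by blast
    qed
    then have S: "S \<in> sets \<mu>" "S \<in> sets \<nu>" using s by auto
    have "continuous_on UNIV (indicator S :: 'd config \<Rightarrow> real)"
    proof (rule continuous_on_local[OF that(1)])
      fix \<sigma> \<tau> :: "'d config" assume "\<And>x. x \<in> J \<Longrightarrow> \<sigma> x = \<tau> x"
      then have "\<sigma> \<in> S \<longleftrightarrow> \<tau> \<in> S" by (rule loc)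
      then show "indicator S \<sigma> = (indicator S \<tau> :: real)" by (simp only: indicator_def)
    qed
    moreover have "bounded (range (indicator S :: 'd config \<Rightarrow> real))"
      by (rule boundedI[of _ 1]) (auto simp: indicator_def)
    ultimately have "integral\<^sup>L \<mu> (indicator S :: 'd config \<Rightarrow> real) = integral\<^sup>L \<nu> (indicator S)"
      using assms unfolding is_plus_phase_def
      by (intro tendsto_unique[OF finite_subsets_at_top_neq_bot]) blast+
    then have "measure \<mu> S = measure \<nu> S" using S by simp
    then show ?thesis by (simp add: \<mu>.emeasure_eq_measure \<nu>.emeasure_eq_measure)
  qed
  let ?M = "\<lambda>_ :: int ^ 'd. borel :: bool measure"
  show ?thesis
  proof (rule measure_eqI_PiM_infinite[where I = UNIV and M = ?M])
    fix A :: "int ^ 'd \<Rightarrow> bool set" and J :: "(int ^ 'd) set" assume J: "finite J"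
    show "emeasure \<mu> (prod_emb UNIV ?M J (Pi\<^sub>E J A)) = emeasure \<nu> (prod_emb UNIV ?M J (Pi\<^sub>E J A))"
    proof (rule local_eq[OF J])
      fix f g :: "'d config" assume "\<And>x. x \<in> J \<Longrightarrow> f x = g x"
      then have "restrict f J = restrict g J" by (rule restrict_ext)
      then show "f \<in> prod_emb UNIV ?M J (Pi\<^sub>E J A) \<longleftrightarrow> g \<in> prod_emb UNIV ?M J (Pi\<^sub>E J A)"
        by (simp add: prod_emb_def)
    qed
  qed (simp_all add: s sets_PiM_equal_borel \<mu>.finite_measure_axioms)
qed

section \<open>Existence of the plus phase\<close>

definition pattern_pmf :: "real \<Rightarrow> (int ^ 'd::finite) set \<Rightarrow> (int ^ 'd) set pmf" where
  "pattern_pmf \<beta> S = embed_pmf (\<lambda>T. if T \<subseteq> S then pattern_limit \<beta> S T else 0)"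

lemma pmf_pattern_pmf:
  fixes S :: "(int ^ 'd::finite) set"
  assumes "0 \<le> \<beta>" "finite S"
  shows "pmf (pattern_pmf \<beta> S) T = (if T \<subseteq> S then pattern_limit \<beta> S T else 0)"
proof -
  let ?f = "\<lambda>T. if T \<subseteq> S then pattern_limit \<beta> S T else 0"
  have nonneg: "0 \<le> ?f T" for T using pattern_limit_nonneg[OF assms] by simp
  have "(\<integral>\<^sup>+T. ennreal (?f T) \<partial>count_space UNIV) = (\<Sum>T\<in>Pow S. ennreal (?f T))"
    by (rule nn_integral_count_space') (use assms(2) in auto)
  also have "\<dots> = ennreal (\<Sum>T\<in>Pow S. ?f T)" using nonneg by (rule sum_ennreal)
  also have "(\<Sum>T\<in>Pow S. ?f T) = (\<Sum>T\<in>Pow S. pattern_limit \<beta> S T)" by (rule sum.cong) auto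
  also have "\<dots> = 1" by (rule sum_pattern_limit[OF assms])
  finally show ?thesis unfolding pattern_pmf_def using nonneg by (intro pmf_embed_pmf) auto
qed

lemma map_pattern_pmf:
  fixes S :: "(int ^ 'd::finite) set"
  assumes "0 \<le> \<beta>" "finite S" "S' \<subseteq> S"
  shows "map_pmf (\<lambda>T. T \<inter> S') (pattern_pmf \<beta> S) = pattern_pmf \<beta> S'"
proof (rule pmf_eqI)
  fix T
  have finS': "finite S'" using assms finite_subset by blast
  have "pmf (map_pmf (\<lambda>T. T \<inter> S') (pattern_pmf \<beta> S)) T = measure (pattern_pmf \<beta> S) {T'. T' \<inter> S' = T}"
    by (simp add: pmf_map vimage_def)
  also have "\<dots> = measure (pattern_pmf \<beta> S) {T' \<in> Pow S. T' \<inter> S' = T}"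
    by (rule measure_prob_cong_0) (auto simp: pmf_pattern_pmf[OF assms(1,2)])
  also have "\<dots> = (\<Sum>T'\<in>{T' \<in> Pow S. T' \<inter> S' = T}. pattern_limit \<beta> S T')"
    using assms(2) by (subst measure_measure_pmf_finite) (auto simp: pmf_pattern_pmf[OF assms(1,2)])
  also have "\<dots> = (if T \<subseteq> S' then pattern_limit \<beta> S' T else 0)"
  proof (cases "T \<subseteq> S'")
    case True
    then show ?thesis using pattern_limit_restrict[OF assms True] by simp
  next
    case False
    then have empty: "{T' \<in> Pow S. T' \<inter> S' = T} = {}" by blast
    show ?thesis unfolding empty using False by simp
  qed
  also have "\<dots> = pmf (pattern_pmf \<beta> S') T" by (simp add: pmf_pattern_pmf[OF assms(1) finS'])
  finally show "pmf (map_pmf (\<lambda>T. T \<inter> S') (pattern_pmf \<beta> S)) T = pmf (pattern_pmf \<beta> S') T" .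
qed

text \<open>Kolmogorov extension of the consistent pattern distributions, transported by
  \<open>c\<close> from sets of minus spins to spins on \<open>J\<close>.\<close>

lemma exists_pattern_measure:
  assumes \<beta>: "0 \<le> \<beta>"
  shows "\<exists>\<mu> :: 'd::finite config measure. prob_space \<mu> \<and> sets \<mu> = sets borel \<and>
    (\<forall>S T. finite S \<longrightarrow> T \<subseteq> S \<longrightarrow> measure \<mu> (cylinder S T) = pattern_limit \<beta> S T)"
proof -
  let ?M = "\<lambda>_ :: int ^ 'd. borel :: bool measure"
  define c where "c J T = (\<lambda>x\<in>J. x \<notin> T)" for J T :: "(int ^ 'd) set"
  define P where "P J = distr (measure_pmf (pattern_pmf \<beta> J)) (PiM J ?M) (c J)" for J
  have c_space: "c J T \<in> space (PiM J ?M)" for J T by (auto simp: c_def space_PiM)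
  have c_meas: "c J \<in> measurable (measure_pmf q) (PiM J ?M)" for J q
    using c_space by simp
  interpret projective_family UNIV P ?M
  proof (rule projective_family.intro)
    fix J H :: "(int ^ 'd) set" assume JH: "J \<subseteq> H" "finite H"
    have "distr (P H) (PiM J ?M) (\<lambda>f. restrict f J)
        = distr (measure_pmf (pattern_pmf \<beta> H)) (PiM J ?M) ((\<lambda>f. restrict f J) \<circ> c H)"
      unfolding P_def by (intro distr_distr c_meas measurable_restrict_subset JH)
    also have "(\<lambda>f. restrict f J) \<circ> c H = c J \<circ> (\<lambda>T. T \<inter> J)"
      using JH(1) by (auto simp: c_def fun_eq_iff restrict_def)
    also have "distr (measure_pmf (pattern_pmf \<beta> H)) (PiM J ?M) (c J \<circ> (\<lambda>T. T \<inter> J))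
        = distr (measure_pmf (map_pmf (\<lambda>T. T \<inter> J) (pattern_pmf \<beta> H))) (PiM J ?M) (c J)"
      unfolding map_pmf_rep_eq by (intro distr_distr[symmetric]) (auto simp: c_space measurable_count_space_eq1)
    also have "\<dots> = P J" unfolding P_def map_pattern_pmf[OF \<beta> JH(2,1)] ..
    finally show "P J = distr (P H) (PiM J ?M) (\<lambda>f. restrict f J)" by (rule sym)
  next
    fix J :: "(int ^ 'd) set"
    show "prob_space (P J)"
      unfolding P_def by (rule measure_pmf.prob_space_distr[OF c_meas])
  qed
  have emb: "emb UNIV J X = {f. restrict f J \<in> X}" for J X
    by (auto simp: prod_emb_def)
  have lim: "emeasure lim (emb UNIV J X) = emeasure (P J) X" if "finite J" "X \<in> sets (PiM J ?M)" for J X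
  proof (rule emeasure_lim)
    \<comment> \<open>Countable additivity reduces to continuity at the empty set. Sets depending on
      finitely many sites are closed, so a decreasing sequence of nonempty ones has a common point
      by compactness.\<close>
    fix J :: "nat \<Rightarrow> (int ^ 'd) set" and X
    assume J: "\<And>i. finite (J i)" and X: "\<And>i. X i \<in> sets (PiM (J i) ?M)"
      and dec: "decseq (\<lambda>i. emb UNIV (J i) (X i))" and pos: "0 < (INF i. emeasure (P (J i)) (X i))"
    have ne: "emb UNIV (J i) (X i) \<noteq> {}" for i
    proof -
      have "X i \<noteq> {}" using less_INF_D[OF pos, of i] by auto
      then obtain f where f: "f \<in> X i" by blast
      then have "f \<in> extensional (J i)" using sets.sets_into_space[OF X[of i]] by (auto simp: space_PiM PiE_def)
      then have "restrict f (J i) = f" by (rule extensional_restrict)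
      then have "f \<in> emb UNIV (J i) (X i)" unfolding emb using f by simp
      then show ?thesis by blast
    qed
    have closed: "closed (emb UNIV (J i) (X i))" for i
    proof -
      have "open (- emb UNIV (J i) (X i))"
      proof (rule open_local[OF J[of i]])
        fix f g assume "\<And>x. x \<in> J i \<Longrightarrow> f x = g x" "f \<in> - emb UNIV (J i) (X i)"
        moreover from this(1) have "restrict f (J i) = restrict g (J i)" by (rule restrict_ext)
        ultimately show "g \<in> - emb UNIV (J i) (X i)" by (simp add: emb)
      qed
      then show ?thesis by (simp add: closed_def)
    qed
    have "UNIV \<inter> (\<Inter>i\<in>UNIV. emb UNIV (J i) (X i)) \<noteq> {}"
    proof (rule compact_imp_fip_image[OF compact_UNIV_bool closed])
      fix I' :: "nat set" assume "finite I'" "I' \<subseteq> UNIV"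
      have "emb UNIV (J (Max (insert 0 I'))) (X (Max (insert 0 I'))) \<subseteq> (\<Inter>i\<in>I'. emb UNIV (J i) (X i))"
      proof (rule INT_greatest)
        fix i assume "i \<in> I'"
        then have "i \<le> Max (insert 0 I')" using \<open>finite I'\<close> by simp
        then show "emb UNIV (J (Max (insert 0 I'))) (X (Max (insert 0 I'))) \<subseteq> emb UNIV (J i) (X i)"
          by (rule decseqD[OF dec])
      qed
      then show "UNIV \<inter> (\<Inter>i\<in>I'. emb UNIV (J i) (X i)) \<noteq> {}"
        using ne[of "Max (insert 0 I')"] by auto
    qed
    then show "(\<Inter>i. emb UNIV (J i) (X i)) \<noteq> {}" by simp
  qed (use that in auto)
  have sets_lim: "sets lim = sets borel" by (simp add: sets_PiM_equal_borel)
  \<comment> \<open>Total mass: the whole space is the cylinder over the empty set of sites.\<close>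
  have "emeasure lim (emb UNIV {} {\<lambda>x. undefined}) = emeasure (P {}) {\<lambda>x. undefined}"
    by (rule lim) (auto simp: PiM_empty)
  moreover have "emb UNIV {} {\<lambda>x. undefined} = space lim"
    by (auto simp: emb space_PiM restrict_def)
  moreover have "emeasure (P {}) {\<lambda>x. undefined} = 1"
  proof -
    have "space (P {}) = {\<lambda>x. undefined}" by (simp add: space_P space_PiM)
    then show ?thesis using prob_space.emeasure_space_1[OF prob_space_P[of "{}"]] by simp
  qed
  ultimately have prob: "prob_space lim" by (intro prob_spaceI) simp
  have "measure lim (cylinder S T) = pattern_limit \<beta> S T" if "finite S" "T \<subseteq> S" for S T
  proof -
    have X: "{c S T} \<in> sets (PiM S ?M)"
    proof -
      have "{c S T} = (\<Pi>\<^sub>E x\<in>S. {x \<notin> T})" by (auto simp: c_def PiE_def extensional_def fun_eq_iff)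
      also have "\<dots> \<in> sets (PiM S ?M)" using that(1) by (intro sets_PiM_I_finite) auto
      finally show ?thesis .
    qed
    have "cylinder S T = emb UNIV S {c S T}"
      by (auto simp: emb cylinder_def c_def fun_eq_iff restrict_def)
    then have "emeasure lim (cylinder S T) = emeasure (P S) {c S T}" using lim[OF that(1) X] by simp
    also have "\<dots> = emeasure (measure_pmf (pattern_pmf \<beta> S)) (c S -` {c S T})"
      unfolding P_def using X by (subst emeasure_distr[OF c_meas]) auto
    also have "\<dots> = emeasure (measure_pmf (pattern_pmf \<beta> S)) {T}"
    proof (rule emeasure_eq_AE)
      have "T' \<in> c S -` {c S T} \<longleftrightarrow> T' \<in> {T}" if "T' \<subseteq> S" for T'
        using that \<open>T \<subseteq> S\<close> by (auto simp: c_def fun_eq_iff restrict_def)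
      moreover have "T' \<subseteq> S" if "T' \<in> set_pmf (pattern_pmf \<beta> S)" for T'
        using that pmf_pattern_pmf[OF \<beta> \<open>finite S\<close>, of T'] unfolding set_pmf_iff by metis
      ultimately show "AE T' in measure_pmf (pattern_pmf \<beta> S). T' \<in> c S -` {c S T} \<longleftrightarrow> T' \<in> {T}"
        unfolding AE_measure_pmf_iff by blast
    qed auto
    also have "\<dots> = ennreal (pmf (pattern_pmf \<beta> S) T)" by (rule emeasure_pmf_single)
    also have "\<dots> = ennreal (pattern_limit \<beta> S T)"
      by (simp only: pmf_pattern_pmf[OF \<beta> that(1)] that(2) if_True)
    finally have e: "emeasure lim (cylinder S T) = ennreal (pattern_limit \<beta> S T)" .
    show ?thesis
      unfolding measure_def e by (rule enn2real_ennreal[OF pattern_limit_nonneg[OF \<beta> that]])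
  qed
  then show ?thesis using prob sets_lim by blast
qed

theorem is_plus_phase_plus_phase:
  assumes \<beta>: "0 \<le> \<beta>"
  shows "is_plus_phase \<beta> (plus_phase \<beta> :: 'd::finite config measure)"
proof -
  obtain \<mu> :: "'d config measure" where \<mu>: "prob_space \<mu>" "sets \<mu> = sets borel"
    and cyl: "\<And>S T. finite S \<Longrightarrow> T \<subseteq> S \<Longrightarrow> measure \<mu> (cylinder S T) = pattern_limit \<beta> S T"
    using exists_pattern_measure[OF \<beta>] by blast
  interpret prob_space \<mu> by fact
  have "is_plus_phase \<beta> \<mu>"
    unfolding is_plus_phase_def
  proof (intro conjI allI impI \<mu>, elim conjE)
    fix f :: "'d config \<Rightarrow> real" assume f: "continuous_on UNIV f" "bounded (range f)"
    have int: "integrable \<mu> h" if h: "continuous_on UNIV h" "bounded (range h)" for h :: "'d config \<Rightarrow> real"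
    proof -
      have "h \<in> borel_measurable \<mu>"
        using borel_measurable_continuous_onI[OF h(1)] measurable_cong_sets[OF \<mu>(2) refl] by blast
      moreover obtain B where "\<And>\<sigma>. norm (h \<sigma>) \<le> B" using h(2) by (auto simp: bounded_iff)
      ultimately show ?thesis by (intro integrable_const_bound[where B = B]) auto
    qed
    have "((\<lambda>\<Lambda>. mean \<beta> \<Lambda> (\<lambda>A. f (minus_config A))) \<longlongrightarrow> integral\<^sup>L \<mu> f) (finite_subsets_at_top UNIV)"
    proof (rule tendstoI)
      fix e :: real assume "0 < e"
      obtain S where S: "finite S" "\<And>\<sigma> \<tau>. (\<forall>x\<in>S. \<sigma> x = \<tau> x) \<Longrightarrow> \<bar>f \<sigma> - f \<tau>\<bar> < e / 3"
        using uniform_local_approximation[OF f(1), of "e / 3"] \<open>0 < e\<close> by auto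
      \<comment> \<open>All spins outside \<open>S\<close> are set to plus. This gives a local
        function within \<open>e / 3\<close> of \<open>f\<close>, for which convergence follows from
        the pattern limits.\<close>
      define h where "h \<sigma> = f (\<lambda>x. x \<in> S \<longrightarrow> \<sigma> x)" for \<sigma>
      have loc: "h \<sigma> = h \<tau>" if "\<And>x. x \<in> S \<Longrightarrow> \<sigma> x = \<tau> x" for \<sigma> \<tau>
        unfolding h_def using that by (metis (no_types, lifting))
      have fh: "\<bar>f \<sigma> - h \<sigma>\<bar> \<le> e / 3" for \<sigma>
        unfolding h_def using S(2)[of \<sigma> "\<lambda>x. x \<in> S \<longrightarrow> \<sigma> x"] by simp
      have h_bdd: "bounded (range h)"
        by (rule bounded_subset[OF f(2)]) (auto simp: h_def)
      have h_cont: "continuous_on UNIV h" by (rule continuous_on_local[OF S(1) loc])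
      have "integral\<^sup>L \<mu> h = (\<integral>\<sigma>. (\<Sum>T\<in>Pow S. h (minus_config T) * indicator (cylinder S T) \<sigma>) \<partial>\<mu>)"
        by (rule arg_cong[where f = "integral\<^sup>L \<mu>"], rule ext, rule local_eq_sum_cylinder[OF S(1) loc])
      also have "\<dots> = (\<Sum>T\<in>Pow S. h (minus_config T) * measure \<mu> (cylinder S T))"
      proof -
        have "cylinder S T \<in> sets \<mu>" for T using open_cylinder[OF S(1)] \<mu>(2) by auto
        then show ?thesis by (subst Bochner_Integration.integral_sum) (auto simp: emeasure_eq_measure)
      qed
      also have "\<dots> = (\<Sum>T\<in>Pow S. h (minus_config T) * pattern_limit \<beta> S T)"
        by (rule sum.cong) (auto simp: cyl S(1))
      finally have ih: "integral\<^sup>L \<mu> h = (\<Sum>T\<in>Pow S. h (minus_config T) * pattern_limit \<beta> S T)" .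
      have int_fh: "\<bar>integral\<^sup>L \<mu> f - integral\<^sup>L \<mu> h\<bar> \<le> e / 3"
      proof -
        have "\<bar>integral\<^sup>L \<mu> f - integral\<^sup>L \<mu> h\<bar> = \<bar>\<integral>\<sigma>. f \<sigma> - h \<sigma> \<partial>\<mu>\<bar>"
          by (simp add: int f h_bdd h_cont)
        also have "\<dots> \<le> (\<integral>\<sigma>. \<bar>f \<sigma> - h \<sigma>\<bar> \<partial>\<mu>)" by (rule integral_abs_bound)
        also have "\<dots> \<le> (\<integral>\<sigma>. e / 3 \<partial>\<mu>)"
        proof (rule integral_mono)
          show "integrable \<mu> (\<lambda>\<sigma>. \<bar>f \<sigma> - h \<sigma>\<bar>)"
            by (intro integrable_abs Bochner_Integration.integrable_diff int f h_bdd h_cont)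
        qed (use fh in auto)
        finally show ?thesis by (simp add: prob_space)
      qed
      have "eventually (\<lambda>\<Lambda>. dist (mean \<beta> \<Lambda> (\<lambda>A. h (minus_config A))) (integral\<^sup>L \<mu> h) < e / 3) (finite_subsets_at_top UNIV)"
        unfolding ih using \<open>0 < e\<close> by (intro tendstoD mean_local_tendsto[where f = h, OF \<beta> S(1) loc]) auto
      then show "eventually (\<lambda>\<Lambda>. dist (mean \<beta> \<Lambda> (\<lambda>A. f (minus_config A))) (integral\<^sup>L \<mu> f) < e) (finite_subsets_at_top UNIV)"
        using eventually_finite_volume
      proof eventually_elim
        case (elim \<Lambda>)
        have "\<bar>mean \<beta> \<Lambda> (\<lambda>A. f (minus_config A)) - mean \<beta> \<Lambda> (\<lambda>A. h (minus_config A))\<bar>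
            \<le> mean \<beta> \<Lambda> (\<lambda>A. \<bar>f (minus_config A) - h (minus_config A)\<bar>)"
          using abs_mean_le[OF elim(2), of \<beta> "\<lambda>A. f (minus_config A) - h (minus_config A)"] by (simp add: mean_diff)
        also have "\<dots> \<le> mean \<beta> \<Lambda> (\<lambda>_. e / 3)" by (intro mean_mono elim fh)
        finally have "\<bar>mean \<beta> \<Lambda> (\<lambda>A. f (minus_config A)) - mean \<beta> \<Lambda> (\<lambda>A. h (minus_config A))\<bar> \<le> e / 3"
          using elim(2) by (simp add: mean_const)
        then show ?case using elim(1) int_fh unfolding dist_real_def by linarith
      qed
    qed
    moreover have "eventually (\<lambda>\<Lambda>. mean \<beta> \<Lambda> (\<lambda>A. f (minus_config A)) = measure_pmf.expectation (ising_plus \<Lambda> \<beta>) f)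
        (finite_subsets_at_top UNIV)"
      using eventually_finite_volume by eventually_elim (simp add: expectation_ising_plus)
    ultimately show "((\<lambda>\<Lambda>. measure_pmf.expectation (ising_plus \<Lambda> \<beta>) f) \<longlongrightarrow> integral\<^sup>L \<mu> f) (finite_subsets_at_top UNIV)"
      by (rule Lim_transform_eventually)
  qed
  then show ?thesis
    unfolding plus_phase_def by (metis is_plus_phase_unique theI)
qed

corollary plus_phase_mean_tendsto:
  fixes f :: "'d::finite config \<Rightarrow> real"
  assumes \<beta>: "0 \<le> \<beta>" and f: "continuous_on UNIV f" "bounded (range f)"
  shows "((\<lambda>\<Lambda>. mean \<beta> \<Lambda> (\<lambda>A. f (minus_config A))) \<longlongrightarrow> integral\<^sup>L (plus_phase \<beta>) f) (finite_subsets_at_top UNIV)"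
proof -
  have "((\<lambda>\<Lambda>. measure_pmf.expectation (ising_plus \<Lambda> \<beta>) f) \<longlongrightarrow> integral\<^sup>L (plus_phase \<beta>) f) (finite_subsets_at_top UNIV)"
    using is_plus_phase_plus_phase[OF \<beta>, where 'd = 'd] f by (simp add: is_plus_phase_def)
  moreover have "eventually (\<lambda>\<Lambda>. measure_pmf.expectation (ising_plus \<Lambda> \<beta>) f = mean \<beta> \<Lambda> (\<lambda>A. f (minus_config A)))
      (finite_subsets_at_top UNIV)"
    using eventually_finite_volume by eventually_elim (simp add: expectation_ising_plus)
  ultimately show ?thesis by (rule Lim_transform_eventually)
qed

section \<open>Stretched exponential moments\<close>

text \<open>Subadditivity of a concave power: the fractions \<open>x / (x + h)\<close> and
  \<open>h / (x + h)\<close> add up to \<open>1\<close> and only grow when raised to the power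
  \<rho>.\<close>

lemma powr_add_le:
  fixes x h \<rho> :: real
  assumes "0 \<le> x" "0 < h" "0 < \<rho>" "\<rho> < 1"
  shows "(x + h) powr \<rho> \<le> x powr \<rho> + h powr \<rho>"
proof -
  let ?s = "x + h"
  have s: "0 < ?s" using assms by simp
  have *: "u \<le> u powr \<rho>" if "0 \<le> u" "u \<le> 1" for u :: real
    using powr_mono'[of \<rho> 1 u] that assms by simp
  have "1 = x / ?s + h / ?s" using s by (simp flip: add_divide_distrib)
  also have "\<dots> \<le> (x / ?s) powr \<rho> + (h / ?s) powr \<rho>"
    using assms by (intro add_mono *) (auto simp: divide_le_eq_1)
  also have "\<dots> = (x powr \<rho> + h powr \<rho>) / ?s powr \<rho>"
    using assms by (simp add: powr_divide add_divide_distrib)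
  finally show ?thesis using s by (simp add: le_divide_eq)
qed

text \<open>Here \<open>w = \<bar>Z\<bar> / (Q k\<^sup>\<kappa> N)\<close> in the application.\<close>

lemma powr_power_le:
  fixes w \<rho> :: real
  assumes "0 \<le> w" "0 < \<rho>" "\<rho> < 1"
  shows "(w powr \<rho>) ^ k \<le> 1 + w ^ (2 * k)"
proof (cases "w \<le> 1")
  case True
  then have "(w powr \<rho>) ^ k \<le> 1" using assms by (intro power_le_one) (auto simp: powr_le1)
  then show ?thesis using assms by (simp add: add_increasing2)
next
  case False
  then have "w powr \<rho> \<le> w powr 2" using assms by (intro powr_mono) auto
  then have "(w powr \<rho>) ^ k \<le> (w ^ 2) ^ k" using False by (intro power_mono) auto
  then show ?thesis by (simp add: power_mult)
qed

text \<open>The term of order \<open>k\<close> of the exponential series is bounded through the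
  moment of order \<open>2 * k\<close>, scaled by its own bound \<open>D\<close>. This leaves
  \<open>2 * \<epsilon> ^ k\<close>: the condition \<open>\<kappa> * \<rho> \<le> 1\<close> reduces
  the growth to \<open>k ^ k\<close>, which \<open>fact k * 3 ^ k\<close> dominates, and the
  \<open>3\<close> in \<open>L\<close> cancels that \<open>3 ^ k\<close>.\<close>

lemma (in prob_space) exp_powr_moment:
  fixes Z :: "'a \<Rightarrow> real"
  assumes Z: "random_variable borel Z" "\<And>x. \<bar>Z x\<bar> \<le> B"
    and moments: "\<And>p. 1 \<le> p \<Longrightarrow> expectation (\<lambda>x. Z x ^ (2 * p)) \<le> (Q * real p ^ \<kappa> * N) ^ (2 * p)"
    and pos: "0 < Q" "0 < N" "0 < \<rho>" "\<rho> < 1" "real \<kappa> * \<rho> \<le> 1" "0 < \<epsilon>" "\<epsilon> \<le> 1/2"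
  defines "L \<equiv> Q * (3 / \<epsilon>) powr (1 / \<rho>)"
  shows "(\<integral>\<^sup>+x. ennreal (exp (\<bar>Z x / (L * N)\<bar> powr \<rho>) - 1) \<partial>M) \<le> ennreal (4 * \<epsilon>)"
proof -
  have L: "0 < L" using pos by (simp add: L_def)
  have QL: "(Q / L) powr \<rho> = \<epsilon> / 3"
  proof -
    have "Q / L = (3 / \<epsilon>) powr - (1 / \<rho>)"
      unfolding L_def powr_minus_divide using pos(1) by simp
    then have "(Q / L) powr \<rho> = (3 / \<epsilon>) powr (- (1 / \<rho>) * \<rho>)" by (simp only: powr_powr)
    also have "- (1 / \<rho>) * \<rho> = -1" using pos by simp
    also have "(3 / \<epsilon>) powr -1 = \<epsilon> / 3" using pos by (simp add: powr_minus_divide)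
    finally show ?thesis .
  qed
  define Y where "Y x = \<bar>Z x / (L * N)\<bar> powr \<rho>" for x
  have [measurable]: "Y \<in> borel_measurable M" unfolding Y_def using Z(1) by measurable
  have bound: "(\<integral>\<^sup>+x. ennreal (Y x ^ k / fact k) \<partial>M) \<le> ennreal (2 * \<epsilon> ^ k)" if k: "1 \<le> k" for k :: nat
  proof -
    define D where "D = Q * real k ^ \<kappa> * N"
    have D: "0 < D" using pos k by (simp add: D_def)
    let ?q = "(Q / L * real k ^ \<kappa>) powr \<rho>"
    have q: "?q ^ k / fact k \<le> \<epsilon> ^ k"
    proof -
      have "(real k ^ \<kappa>) powr \<rho> = real k powr (real \<kappa> * \<rho>)"
        using k by (simp add: powr_powr flip: powr_realpow)
      also have "\<dots> \<le> real k powr 1" using k pos by (intro powr_mono) auto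
      finally have "(real k ^ \<kappa>) powr \<rho> \<le> real k" by simp
      then have "\<epsilon> / 3 * (real k ^ \<kappa>) powr \<rho> \<le> \<epsilon> / 3 * real k"
        using pos(6) by (intro mult_left_mono) auto
      moreover have "?q = \<epsilon> / 3 * (real k ^ \<kappa>) powr \<rho>"
        unfolding QL[symmetric] by (rule powr_mult)
      ultimately have "?q \<le> \<epsilon> / 3 * real k" by simp
      then have "?q ^ k \<le> (\<epsilon> / 3 * real k) ^ k" by (intro power_mono) auto
      also have "\<dots> = (\<epsilon> / 3) ^ k * real k ^ k" by (rule power_mult_distrib)
      also have "\<dots> \<le> (\<epsilon> / 3) ^ k * (fact k * 3 ^ k)"
        using pos by (intro mult_left_mono power_le_fact_3_power) auto
      also have "\<dots> = \<epsilon> ^ k * fact k" by (simp add: power_divide)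
      finally show ?thesis by (simp add: divide_le_eq)
    qed
    have pointwise: "Y x ^ k / fact k \<le> \<epsilon> ^ k * (1 + Z x ^ (2 * k) / D ^ (2 * k))" for x
    proof -
      let ?w = "\<bar>Z x\<bar> / D"
      have "\<bar>Z x / (L * N)\<bar> = ?w * (Q / L * real k ^ \<kappa>)"
        using pos L k by (simp add: D_def abs_mult)
      then have "Y x = ?w powr \<rho> * ?q"
        unfolding Y_def using D L pos by (simp only:) (rule powr_mult)
      then have "Y x ^ k / fact k = (?w powr \<rho>) ^ k * (?q ^ k / fact k)"
        by (simp add: power_mult_distrib)
      also have "\<dots> \<le> (1 + ?w ^ (2 * k)) * \<epsilon> ^ k"
        using D pos by (intro mult_mono powr_power_le q) auto
      also have "?w ^ (2 * k) = Z x ^ (2 * k) / D ^ (2 * k)"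
        by (simp add: power_divide power_mult)
      finally show ?thesis by (simp add: mult.commute)
    qed
    have int: "integrable M (\<lambda>x. Z x ^ (2 * k))"
    proof (rule integrable_const_bound)
      show "AE x in M. norm (Z x ^ (2 * k)) \<le> B ^ (2 * k)"
        using Z(2) by (auto simp: power_abs intro!: power_mono)
    qed (use Z(1) in measurable)
    have "(\<integral>\<^sup>+x. ennreal (Y x ^ k / fact k) \<partial>M)
        \<le> (\<integral>\<^sup>+x. ennreal (\<epsilon> ^ k * (1 + Z x ^ (2 * k) / D ^ (2 * k))) \<partial>M)"
      by (intro nn_integral_mono ennreal_leI pointwise)
    also have "\<dots> = ennreal (expectation (\<lambda>x. \<epsilon> ^ k * (1 + Z x ^ (2 * k) / D ^ (2 * k))))"
      using int pos D by (intro nn_integral_eq_integral) (auto intro!: AE_I2)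
    also have "expectation (\<lambda>x. \<epsilon> ^ k * (1 + Z x ^ (2 * k) / D ^ (2 * k)))
        = \<epsilon> ^ k * (1 + expectation (\<lambda>x. Z x ^ (2 * k)) / D ^ (2 * k))"
      using int by (simp add: prob_space)
    also have "\<dots> \<le> \<epsilon> ^ k * (1 + 1)"
    proof (intro mult_left_mono add_left_mono)
      show "expectation (\<lambda>x. Z x ^ (2 * k)) / D ^ (2 * k) \<le> 1"
        using moments[OF k] D by (simp add: D_def)
    qed (use pos in auto)
    finally show ?thesis using pos by (simp add: mult.commute ennreal_leI)
  qed
  have series: "(\<lambda>k. y ^ Suc k / fact (Suc k)) sums (exp y - 1)" for y :: real
  proof -
    have "(\<lambda>k. y ^ k / fact k) sums exp y"
      using exp_converges[of y] by (simp add: divide_inverse mult.commute)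
    then show ?thesis using sums_Suc_iff[of "\<lambda>k. y ^ k / fact k" "exp y - 1"] by simp
  qed
  have "ennreal (exp (Y x) - 1) = (\<Sum>k. ennreal (Y x ^ Suc k / fact (Suc k)))" for x
    by (rule suminf_ennreal_eq[OF _ series, symmetric]) (simp add: Y_def)
  then have "(\<integral>\<^sup>+x. ennreal (exp (Y x) - 1) \<partial>M) = (\<integral>\<^sup>+x. (\<Sum>k. ennreal (Y x ^ Suc k / fact (Suc k))) \<partial>M)"
    by (simp only:)
  also have "\<dots> = (\<Sum>k. \<integral>\<^sup>+x. ennreal (Y x ^ Suc k / fact (Suc k)) \<partial>M)"
    by (rule nn_integral_suminf) measurable
  also have "\<dots> \<le> (\<Sum>k. ennreal (2 * \<epsilon> ^ Suc k))"
    by (intro suminf_le bound summableI) simp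
  also have "\<dots> = ennreal (2 * \<epsilon> / (1 - \<epsilon>))"
  proof (rule suminf_ennreal_eq)
    have "(\<lambda>k. 2 * \<epsilon> * \<epsilon> ^ k) sums (2 * \<epsilon> * (1 / (1 - \<epsilon>)))"
      using pos by (intro sums_mult geometric_sums) auto
    then show "(\<lambda>k. 2 * \<epsilon> ^ Suc k) sums (2 * \<epsilon> / (1 - \<epsilon>))" by (simp add: mult.assoc)
  qed (use pos in auto)
  also have "\<dots> \<le> ennreal (4 * \<epsilon>)"
  proof (rule ennreal_leI)
    have "2 * \<epsilon> \<le> 4 * \<epsilon> * (1 - \<epsilon>)" using mult_left_mono[of "1/2" "1 - \<epsilon>" "4 * \<epsilon>"] pos by simp
    then show "2 * \<epsilon> / (1 - \<epsilon>) \<le> 4 * \<epsilon>" using pos by (simp add: divide_le_eq)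
  qed
  finally show ?thesis unfolding Y_def .
qed

lemma (in prob_space) tail_le_of_exp_powr_moment:
  fixes Z :: "'a \<Rightarrow> real"
  assumes Z: "random_variable borel Z" and pos: "0 < l" "0 < \<rho>" "0 < t"
    and moment: "(\<integral>\<^sup>+x. ennreal (exp (\<bar>Z x / l\<bar> powr \<rho>) - 1) \<partial>M) \<le> ennreal 2"
  shows "prob {x \<in> space M. t < \<bar>Z x\<bar>} \<le> 4 * exp (- ((t / l) powr \<rho>))"
proof -
  let ?A = "{x \<in> space M. t < \<bar>Z x\<bar>}" and ?v = "(t / l) powr \<rho>"
  have A: "?A \<in> events" using Z by measurable
  have "ennreal (exp ?v - 1) * emeasure M ?A = (\<integral>\<^sup>+x. ennreal (exp ?v - 1) * indicator ?A x \<partial>M)"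
    using A by (simp add: nn_integral_cmult_indicator)
  also have "\<dots> \<le> (\<integral>\<^sup>+x. ennreal (exp (\<bar>Z x / l\<bar> powr \<rho>) - 1) \<partial>M)"
  proof (rule nn_integral_mono)
    fix x
    have "?v \<le> \<bar>Z x / l\<bar> powr \<rho>" if "t < \<bar>Z x\<bar>"
    proof (rule powr_mono2)
      show "t / l \<le> \<bar>Z x / l\<bar>" using that pos(1) by (simp add: divide_right_mono)
    qed (use pos in auto)
    then show "ennreal (exp ?v - 1) * indicator ?A x \<le> ennreal (exp (\<bar>Z x / l\<bar> powr \<rho>) - 1)"
      by (auto simp: indicator_def intro!: ennreal_leI)
  qed
  also note moment
  finally have "ennreal ((exp ?v - 1) * prob ?A) \<le> ennreal 2"
    by (simp add: emeasure_eq_measure ennreal_mult)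
  then have m: "(exp ?v - 1) * prob ?A \<le> 2"
    by (rule ennreal_le_iff[THEN iffD1, rotated]) simp
  have "exp ?v * prob ?A \<le> 4"
  \<comment> \<open>Subtracting \<open>1\<close> in the exponential moment is harmful only for small
    \<open>?v\<close>; there the trivial bound \<open>prob ?A \<le> 1\<close> suffices, and
    otherwise \<open>exp ?v \<le> 2 * (exp ?v - 1)\<close>.\<close>
  proof (cases "exp ?v \<le> 2")
    case True
    then have "exp ?v * prob ?A \<le> 2 * 1" by (intro mult_mono) auto
    then show ?thesis by simp
  next
    case False
    then have "exp ?v * prob ?A \<le> 2 * (exp ?v - 1) * prob ?A" by (intro mult_right_mono) auto
    also have "\<dots> = 2 * ((exp ?v - 1) * prob ?A)" by (simp only: mult.assoc)
    also have "\<dots> \<le> 2 * 2" using m by (intro mult_left_mono) auto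
    finally show ?thesis by simp
  qed
  then have "prob ?A \<le> 4 / exp ?v" by (simp add: le_divide_eq mult.commute)
  then show ?thesis by (simp add: exp_minus divide_inverse)
qed

text \<open>Subadditivity of the power bounds \<open>young_Phi\<close> by
  \<open>exp (h_const \<rho> powr \<rho>)\<close> times the stretched exponential minus one; the
  hypothesis is scaled to cancel this factor.\<close>

lemma (in prob_space) luxembourg_norm_le:
  fixes Z :: "'a \<Rightarrow> real"
  assumes pos: "0 < l" "0 < \<rho>" "\<rho> < 1"
    and moment: "(\<integral>\<^sup>+x. ennreal (exp (\<bar>Z x / l\<bar> powr \<rho>) - 1) \<partial>M) \<le> ennreal (exp (- (h_const \<rho> powr \<rho>)))"
    and Z: "random_variable borel Z"
  shows "luxembourg_norm M \<rho> Z \<le> ennreal l"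
proof -
  note [measurable] = Z
  let ?h = "h_const \<rho>" and ?c = "exp (h_const \<rho> powr \<rho>)"
  have h: "0 < ?h" using pos by (simp add: h_const_def)
  have phi: "young_Phi \<rho> y \<le> ?c * (exp (\<bar>y\<bar> powr \<rho>) - 1)" for y
  proof -
    have "exp ((\<bar>y\<bar> + ?h) powr \<rho>) \<le> exp (\<bar>y\<bar> powr \<rho> + ?h powr \<rho>)"
      using powr_add_le[of "\<bar>y\<bar>" ?h \<rho>] h pos by simp
    then show ?thesis by (simp add: young_Phi_def exp_add algebra_simps)
  qed
  have "(\<integral>\<^sup>+x. ennreal (young_Phi \<rho> (Z x / l)) \<partial>M) \<le> (\<integral>\<^sup>+x. ennreal ?c * ennreal (exp (\<bar>Z x / l\<bar> powr \<rho>) - 1) \<partial>M)"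
    unfolding ennreal_mult'[OF exp_ge_zero, symmetric] by (intro nn_integral_mono ennreal_leI phi)
  also have "\<dots> = ennreal ?c * (\<integral>\<^sup>+x. ennreal (exp (\<bar>Z x / l\<bar> powr \<rho>) - 1) \<partial>M)"
    by (rule nn_integral_cmult) measurable
  also have "\<dots> \<le> ennreal ?c * ennreal (exp (- (?h powr \<rho>)))"
    using moment by (rule mult_left_mono) simp
  also have "\<dots> = 1" by (simp flip: ennreal_mult' exp_add)
  finally show ?thesis
    unfolding luxembourg_norm_def using pos(1) by (intro Inf_lower) auto
qed

section \<open>Local functions under the plus phase\<close>

lemma local_function_bounded:
  fixes g :: "'d::finite config \<Rightarrow> real"
  assumes "finite J" and loc: "\<And>\<sigma> \<tau>. (\<And>x. x \<in> J \<Longrightarrow> \<sigma> x = \<tau> x) \<Longrightarrow> g \<sigma> = g \<tau>"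
  shows "bounded (range g)"
proof (rule finite_imp_bounded, rule finite_subset)
  show "range g \<subseteq> (\<lambda>T. g (minus_config T)) ` Pow J"
  proof
    fix r assume "r \<in> range g"
    then obtain \<sigma> where r: "r = g \<sigma>" by blast
    have "g \<sigma> = g (minus_config {x \<in> J. \<not> \<sigma> x})" by (rule loc) (auto simp: minus_config_def)
    then show "r \<in> (\<lambda>T. g (minus_config T)) ` Pow J" unfolding r by blast
  qed
qed (use assms(1) in simp)

context
  fixes g :: "'d::finite config \<Rightarrow> real" and J :: "(int ^ 'd) set"
  assumes J: "finite J" and loc: "\<And>\<sigma> \<tau>. (\<And>x. x \<in> J \<Longrightarrow> \<sigma> x = \<tau> x) \<Longrightarrow> g \<sigma> = g \<tau>"
begin

lemma le_variation: "\<bar>g (flip x \<sigma>) - g \<sigma>\<bar> \<le> variation g x"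
  unfolding variation_def
proof (rule cSUP_upper)
  obtain B where B: "\<And>\<sigma>. \<bar>g \<sigma>\<bar> \<le> B"
    using local_function_bounded[of J g, OF J loc] by (auto simp: bounded_iff)
  have "\<bar>g (flip x \<tau>) - g \<tau>\<bar> \<le> 2 * B" for \<tau>
    using B[of "flip x \<tau>"] B[of \<tau>] by linarith
  then show "bdd_above (range (\<lambda>\<sigma>. \<bar>g (flip x \<sigma>) - g \<sigma>\<bar>))" by (intro bdd_aboveI2)
qed simp

lemma variation_nonneg: "0 \<le> variation g x"
  using le_variation abs_ge_zero order_trans by blast

lemma variation_eq_0: "x \<notin> J \<Longrightarrow> variation g x = 0"
proof -
  assume x: "x \<notin> J"
  have "g (flip x \<sigma>) = g \<sigma>" for \<sigma> by (rule loc) (use x in \<open>auto simp: flip_def\<close>)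
  then show ?thesis by (simp add: variation_def)
qed

lemma minus_config_lipschitz: "\<bar>g (minus_config (insert j A)) - g (minus_config A)\<bar> \<le> variation g j"
proof (cases "j \<in> A")
  case True
  then show ?thesis using variation_nonneg by (simp add: insert_absorb)
next
  case False
  then have "minus_config (insert j A) = flip j (minus_config A)"
    by (auto simp: minus_config_def flip_def fun_eq_iff)
  then show ?thesis using le_variation by simp
qed

lemma l2norm_variation: "(l2norm (variation g))\<^sup>2 = (\<Sum>j\<in>J. (variation g j)\<^sup>2)"
proof -
  have "(\<Sum>\<^sub>\<infinity>x. (variation g x)\<^sup>2) = (\<Sum>\<^sub>\<infinity>x\<in>J. (variation g x)\<^sup>2)"
    by (rule infsum_cong_neutral) (auto simp: variation_eq_0)
  also have "\<dots> = (\<Sum>j\<in>J. (variation g j)\<^sup>2)" using J by simp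
  finally show ?thesis by (simp add: l2norm_def sum_nonneg)
qed

lemma l2norm_nonneg: "0 \<le> l2norm (variation g)"
  by (simp add: l2norm_def infsum_nonneg)

lemma l2norm_pos:
  assumes "variation g \<noteq> (\<lambda>_. 0)"
  shows "0 < l2norm (variation g)"
proof -
  obtain x where x: "variation g x \<noteq> 0" using assms by (auto simp: fun_eq_iff)
  then have "x \<in> J" using variation_eq_0 by blast
  then have "0 < (\<Sum>j\<in>J. (variation g j)\<^sup>2)" using J x by (intro sum_pos2[of _ x]) auto
  then show ?thesis using l2norm_nonneg l2norm_variation by (metis less_eq_real_def power_zero_numeral less_irrefl)
qed

lemma sum_variation_le: "finite U \<Longrightarrow> (\<Sum>j\<in>U. (variation g j)\<^sup>2) \<le> (l2norm (variation g))\<^sup>2"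
proof -
  assume U: "finite U"
  have "(\<Sum>j\<in>U. (variation g j)\<^sup>2) = (\<Sum>j\<in>U \<inter> J. (variation g j)\<^sup>2)"
    by (rule sum.mono_neutral_right) (use U variation_eq_0 in auto)
  also have "\<dots> \<le> (\<Sum>j\<in>J. (variation g j)\<^sup>2)" by (rule sum_mono2) (use J in auto)
  finally show ?thesis by (simp only: l2norm_variation)
qed

lemma constant_of_variation_eq_0:
  assumes "variation g = (\<lambda>_. 0)"
  shows "g \<sigma> = g (minus_config {})"
proof -
  let ?A = "{x \<in> J. \<not> \<sigma> x}"
  have "\<bar>g (minus_config ({} \<union> ?A)) - g (minus_config {})\<bar> \<le> (\<Sum>j\<in>?A - {}. variation g j)"
    by (rule oscillation_le[of "\<lambda>A. g (minus_config A)", OF minus_config_lipschitz]) (use J in simp)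
  then have "g (minus_config ?A) = g (minus_config {})" using assms by simp
  moreover have "g \<sigma> = g (minus_config ?A)" by (rule loc) (auto simp: minus_config_def)
  ultimately show ?thesis by simp
qed

end

lemma local_continuous_bounded:
  fixes h :: "'d::finite config \<Rightarrow> real"
  assumes "finite J" "\<And>\<sigma> \<tau>. (\<And>x. x \<in> J \<Longrightarrow> \<sigma> x = \<tau> x) \<Longrightarrow> h \<sigma> = h \<tau>"
  shows "continuous_on UNIV h" "bounded (range h)"
  using continuous_on_local[of J h, OF assms] local_function_bounded[of J h, OF assms] by blast+

text \<open>In volume \<Lambda> take \<open>a\<close> to be the finite volume mean minus the
  limiting mean. The left side is then centred at the limiting mean, and \<open>a\<close> tends to
  \<open>0\<close> on the right.\<close>

lemma plus_phase_moments:
  fixes g :: "'d::finite config \<Rightarrow> real" and \<beta> :: real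
  assumes \<beta>: "0 \<le> \<beta>" and p: "1 \<le> p"
    and J: "finite J" and loc: "\<And>\<sigma> \<tau>. (\<And>x. x \<in> J \<Longrightarrow> \<sigma> x = \<tau> x) \<Longrightarrow> g \<sigma> = g \<tau>"
    and bound: "\<And>(U :: (int ^ 'd) set) h dl a. finite U \<Longrightarrow> (\<forall>A j. \<bar>h (insert j A) - h A\<bar> \<le> dl j) \<Longrightarrow>
      mean \<beta> U (\<lambda>A. (a + h A - mean \<beta> U h) ^ (2 * p)) \<le> (a\<^sup>2 + q\<^sup>2 * (\<Sum>j\<in>U. (dl j)\<^sup>2)) ^ p"
  shows "(\<integral>\<sigma>. (g \<sigma> - (\<integral>\<sigma>. g \<sigma> \<partial>plus_phase \<beta>)) ^ (2 * p) \<partial>plus_phase \<beta>)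
    \<le> (q * l2norm (variation g)) ^ (2 * p)"
proof -
  let ?F = "finite_subsets_at_top (UNIV :: (int ^ 'd) set)"
  let ?N = "l2norm (variation g)"
  define e where "e = (\<integral>\<sigma>. g \<sigma> \<partial>plus_phase \<beta>)"
  define h where "h = (\<lambda>A. g (minus_config A))"
  have "((\<lambda>\<Lambda>. mean \<beta> \<Lambda> (\<lambda>A. g (minus_config A))) \<longlongrightarrow> e) ?F"
    unfolding e_def by (intro plus_phase_mean_tendsto \<beta> local_continuous_bounded[of J g] J loc)
  then have lim_h: "((\<lambda>\<Lambda>. mean \<beta> \<Lambda> h) \<longlongrightarrow> e) ?F" by (simp only: h_def)
  have loc': "(g \<sigma> - e) ^ (2 * p) = (g \<tau> - e) ^ (2 * p)" if "\<And>x. x \<in> J \<Longrightarrow> \<sigma> x = \<tau> x" for \<sigma> \<tau>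
    using loc[OF that] by simp
  have "((\<lambda>\<Lambda>. mean \<beta> \<Lambda> (\<lambda>A. (g (minus_config A) - e) ^ (2 * p))) \<longlongrightarrow> (\<integral>\<sigma>. (g \<sigma> - e) ^ (2 * p) \<partial>plus_phase \<beta>)) ?F"
    by (intro plus_phase_mean_tendsto \<beta> local_continuous_bounded[of J "\<lambda>\<sigma>. (g \<sigma> - e) ^ (2 * p)"] J loc')
  then have lim_l: "((\<lambda>\<Lambda>. mean \<beta> \<Lambda> (\<lambda>A. (h A - e) ^ (2 * p))) \<longlongrightarrow> (\<integral>\<sigma>. (g \<sigma> - e) ^ (2 * p) \<partial>plus_phase \<beta>)) ?F"
    by (simp only: h_def)
  have lim_r: "((\<lambda>\<Lambda>. ((mean \<beta> \<Lambda> h - e)\<^sup>2 + (q * ?N)\<^sup>2) ^ p) \<longlongrightarrow> ((e - e)\<^sup>2 + (q * ?N)\<^sup>2) ^ p) ?F"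
    by (intro tendsto_intros lim_h)
  have "(\<integral>\<sigma>. (g \<sigma> - e) ^ (2 * p) \<partial>plus_phase \<beta>) \<le> ((e - e)\<^sup>2 + (q * ?N)\<^sup>2) ^ p"
  proof (rule tendsto_le[OF finite_subsets_at_top_neq_bot lim_r lim_l], rule eventually_mono[OF eventually_finite_volume])
    fix \<Lambda> :: "(int ^ 'd) set" assume fin: "finite \<Lambda>"
    have "mean \<beta> \<Lambda> (\<lambda>A. ((mean \<beta> \<Lambda> h - e) + h A - mean \<beta> \<Lambda> h) ^ (2 * p))
        \<le> ((mean \<beta> \<Lambda> h - e)\<^sup>2 + q\<^sup>2 * (\<Sum>j\<in>\<Lambda>. (variation g j)\<^sup>2)) ^ p"
      by (rule bound[OF fin]) (use minus_config_lipschitz[of J g, OF J loc] in \<open>auto simp: h_def\<close>)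
    also have "\<dots> \<le> ((mean \<beta> \<Lambda> h - e)\<^sup>2 + q\<^sup>2 * ?N\<^sup>2) ^ p"
      by (intro power_mono add_left_mono mult_left_mono sum_variation_le[of J g, OF J loc fin] add_nonneg_nonneg
          mult_nonneg_nonneg sum_nonneg) auto
    finally show "mean \<beta> \<Lambda> (\<lambda>A. (h A - e) ^ (2 * p)) \<le> ((mean \<beta> \<Lambda> h - e)\<^sup>2 + (q * ?N)\<^sup>2) ^ p"
      by (simp add: power_mult_distrib)
  qed
  also have "\<dots> = (q * ?N) ^ (2 * p)" by (simp add: power_mult)
  finally show ?thesis unfolding e_def .
qed

text \<open>By the Peierls bound with \<open>r = 0\<close> the spin at the origin is minus with
  probability at most \<open>1/3\<close>, uniformly in the volume, so its mean is at least
  \<open>1 - 2/3\<close>.\<close>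

lemma critical_beta_le:
  assumes d: "2 \<le> CARD('d::finite)"
    and \<beta>: "0 \<le> \<beta>" "8 * real (near_degree TYPE('d)) ^ 2 \<le> exp (2 * \<beta>)"
  shows "critical_beta TYPE('d) \<le> ereal \<beta>"
proof -
  let ?f = "\<lambda>\<sigma> :: 'd config. spin (\<sigma> 0)"
  have lim: "((\<lambda>\<Lambda>. mean \<beta> \<Lambda> (\<lambda>A. ?f (minus_config A))) \<longlongrightarrow> (\<integral>\<sigma>. ?f \<sigma> \<partial>plus_phase \<beta>))
      (finite_subsets_at_top (UNIV :: (int ^ 'd) set))"
    by (intro plus_phase_mean_tendsto \<beta> local_continuous_bounded[of "{0}" ?f]) auto
  have "1/3 \<le> (\<integral>\<sigma>. ?f \<sigma> \<partial>(plus_phase \<beta> :: 'd config measure))"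
  proof (rule tendsto_lowerbound[OF lim])
    show "eventually (\<lambda>\<Lambda>. 1/3 \<le> mean \<beta> \<Lambda> (\<lambda>A. ?f (minus_config A))) (finite_subsets_at_top (UNIV :: (int ^ 'd) set))"
    proof (rule eventually_mono[OF eventually_finite_volume])
      fix \<Lambda> :: "(int ^ 'd) set" assume fin: "finite \<Lambda>"
      have "1 - 2 * of_bool (reaches 0 0 A) \<le> ?f (minus_config A)" for A :: "(int ^ 'd) set"
        using cluster_base[of 0 A "{0}"] by (auto simp: spin_def minus_config_def reaches_def)
      then have "mean \<beta> \<Lambda> (\<lambda>A. 1 - 2 * of_bool (reaches 0 0 A)) \<le> mean \<beta> \<Lambda> (\<lambda>A. ?f (minus_config A))"
        by (intro mean_mono fin)
      moreover have "mean \<beta> \<Lambda> (\<lambda>A. 1 - 2 * of_bool (reaches 0 0 A)) = 1 - 2 * event_prob \<beta> \<Lambda> (reaches 0 0)"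
        by (simp only: mean_diff mean_cmult mean_const[OF fin])
      moreover have "event_prob \<beta> \<Lambda> (reaches 0 0) \<le> 1/3"
        using peierls[OF d \<beta> fin, of 0 0] by simp
      ultimately show "1/3 \<le> mean \<beta> \<Lambda> (\<lambda>A. ?f (minus_config A))" by linarith
    qed
  qed simp
  then have "0 < (\<integral>\<sigma>. ?f \<sigma> \<partial>(plus_phase \<beta> :: 'd config measure))" by linarith
  then show ?thesis unfolding critical_beta_def using \<beta>(1) by (intro Inf_lower) blast
qed

text \<open>Covers functions with vanishing variation, whose norm cannot serve as a positive scale.
  Every positive \<open>l\<close> is admissible, and the infimum is \<open>0\<close>.\<close>

lemma luxembourg_norm_zero:
  assumes "0 < \<rho>"
  shows "luxembourg_norm M \<rho> (\<lambda>_. 0) = 0"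
proof -
  have "luxembourg_norm M \<rho> (\<lambda>_. 0) \<le> ennreal l" if "0 < l" for l
    unfolding luxembourg_norm_def using that by (intro Inf_lower) (auto simp: young_Phi_def h_const_def)
  then have le: "luxembourg_norm M \<rho> (\<lambda>_. 0) \<le> 0 + ennreal l" if "0 < l" for l using that by simp
  have "luxembourg_norm M \<rho> (\<lambda>_. 0) \<le> 0" by (rule ennreal_le_epsilon) (rule le)
  then show ?thesis by simp
qed

theorem theorem9:
  assumes "CARD('d::finite) \<ge> 2"
  shows "\<exists>\<beta>\<^sub>0::real. ereal \<beta>\<^sub>0 > critical_beta TYPE('d) \<and> (\<forall>\<beta>>\<beta>\<^sub>0.
    let P = (plus_phase \<beta> :: 'd config measure);
        E = (\<lambda>f::'d config \<Rightarrow> real. integral\<^sup>L P f)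
    in
      (\<forall>p::nat. \<exists>C::real. 0 < C \<and>
        (\<forall>g. local_function g \<longrightarrow>
          E (\<lambda>\<sigma>. (g \<sigma> - E g) ^ (2 * p)) \<le> C * l2norm (variation g) ^ (2 * p) \<and>
          (\<forall>t>0. measure P {\<sigma>. \<bar>g \<sigma> - E g\<bar> > t}
             \<le> C * (l2norm (variation g) ^ (2 * p) / t ^ (2 * p))))) \<and>
      (\<exists>\<rho>\<^sub>m::real. 0 < \<rho>\<^sub>m \<and> \<rho>\<^sub>m < 1 \<and>
        (\<forall>\<rho>. 0 < \<rho> \<and> \<rho> < \<rho>\<^sub>m \<longrightarrow>
          (\<exists>K::real. 0 < K \<and>
            (\<forall>g. local_function g \<longrightarrow>
              luxembourg_norm P \<rho> (\<lambda>\<sigma>. g \<sigma> - E g) \<le> ennreal (K * l2norm (variation g)))) \<and>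
          (\<exists>c::real. 0 < c \<and>
            (\<forall>g. local_function g \<longrightarrow>
              (\<forall>t>0. measure P {\<sigma>. \<bar>g \<sigma> - E g\<bar> > t}
                 \<le> 4 * (if variation g = (\<lambda>_. 0) then 0
                         else exp (- c * (t powr \<rho> / l2norm (variation g) powr \<rho>)))))))))"
proof -
  let ?\<kappa> = "2 * CARD('d) + 1"
  \<comment> \<open>With this choice \<open>1 + 2 * \<beta> \<le> exp (2 * \<beta>)\<close> already
    gives the Peierls condition; adding \<open>1\<close> below makes the comparison with the
    critical point strict.\<close>
  define \<beta>\<^sub>1 where "\<beta>\<^sub>1 = 8 * real (near_degree TYPE('d)) ^ 2"
  have \<beta>1: "0 \<le> \<beta>\<^sub>1" by (simp add: \<beta>\<^sub>1_def)
  have large: "8 * real (near_degree TYPE('d)) ^ 2 \<le> exp (2 * \<beta>)" if "\<beta>\<^sub>1 \<le> \<beta>" for \<beta>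
  proof -
    have "\<beta>\<^sub>1 \<le> 1 + 2 * \<beta>" using that \<beta>1 by linarith
    also have "\<dots> \<le> exp (2 * \<beta>)" by (rule exp_ge_add_one_self)
    finally show ?thesis by (simp add: \<beta>\<^sub>1_def)
  qed
  obtain Q where Q: "0 < Q" and bound: "\<And>\<beta> p (U :: (int ^ 'd) set) g dl a.
    0 \<le> \<beta> \<Longrightarrow> 8 * real (near_degree TYPE('d)) ^ 2 \<le> exp (2 * \<beta>) \<Longrightarrow> 1 \<le> p \<Longrightarrow> finite U \<Longrightarrow>
    (\<forall>A j. \<bar>g (insert j A) - g A\<bar> \<le> dl j) \<Longrightarrow>
    mean \<beta> U (\<lambda>A. (a + g A - mean \<beta> U g) ^ (2 * p))
      \<le> (a\<^sup>2 + (Q * real p ^ ?\<kappa>)\<^sup>2 * (\<Sum>j\<in>U. (dl j)\<^sup>2)) ^ p"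
    using finite_volume_moments[OF assms] by blast
  have "critical_beta TYPE('d) \<le> ereal \<beta>\<^sub>1"
    by (rule critical_beta_le[OF assms \<beta>1]) (rule large[OF order_refl])
  also have "\<dots> < ereal (\<beta>\<^sub>1 + 1)" by simp
  finally have crit: "critical_beta TYPE('d) < ereal (\<beta>\<^sub>1 + 1)" .
  have main: "(\<forall>p::nat. \<exists>C::real. 0 < C \<and>
        (\<forall>g. local_function g \<longrightarrow>
          E (\<lambda>\<sigma>. (g \<sigma> - E g) ^ (2 * p)) \<le> C * l2norm (variation g) ^ (2 * p) \<and>
          (\<forall>t>0. measure P {\<sigma>. \<bar>g \<sigma> - E g\<bar> > t}
             \<le> C * (l2norm (variation g) ^ (2 * p) / t ^ (2 * p))))) \<and>
      (\<exists>\<rho>\<^sub>m::real. 0 < \<rho>\<^sub>m \<and> \<rho>\<^sub>m < 1 \<and>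
        (\<forall>\<rho>. 0 < \<rho> \<and> \<rho> < \<rho>\<^sub>m \<longrightarrow>
          (\<exists>K::real. 0 < K \<and>
            (\<forall>g. local_function g \<longrightarrow>
              luxembourg_norm P \<rho> (\<lambda>\<sigma>. g \<sigma> - E g) \<le> ennreal (K * l2norm (variation g)))) \<and>
          (\<exists>c::real. 0 < c \<and>
            (\<forall>g. local_function g \<longrightarrow>
              (\<forall>t>0. measure P {\<sigma>. \<bar>g \<sigma> - E g\<bar> > t}
                 \<le> 4 * (if variation g = (\<lambda>_. 0) then 0
                         else exp (- c * (t powr \<rho> / l2norm (variation g) powr \<rho>))))))))"
    if \<beta>: "\<beta>\<^sub>1 + 1 < \<beta>" and P_def: "P = (plus_phase \<beta> :: 'd config measure)"
      and E_def: "E = (\<lambda>f::'d config \<Rightarrow> real. integral\<^sup>L P f)" for \<beta> P E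
  proof -
    have \<beta>0: "0 \<le> \<beta>" and \<beta>_large: "8 * real (near_degree TYPE('d)) ^ 2 \<le> exp (2 * \<beta>)"
      using \<beta> \<beta>1 large[of \<beta>] by linarith+
    have phase: "is_plus_phase \<beta> P" unfolding P_def by (rule is_plus_phase_plus_phase[OF \<beta>0])
    interpret prob_space P using phase by (simp add: is_plus_phase_def)
    have sets_P: "sets P = sets borel" using phase by (simp add: is_plus_phase_def)
    have space_P: "space P = UNIV" using sets_eq_imp_space_eq[OF sets_P] by simp
    have facts: "random_variable borel (\<lambda>\<sigma>. g \<sigma> - E g) \<and> (\<exists>B. \<forall>\<sigma>. \<bar>g \<sigma> - E g\<bar> \<le> B) \<and>
        (\<forall>p. E (\<lambda>\<sigma>. (g \<sigma> - E g) ^ (2 * p)) \<le> (Q * real p ^ ?\<kappa> * l2norm (variation g)) ^ (2 * p)) \<and>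
        0 \<le> l2norm (variation g) \<and>
        (if variation g = (\<lambda>_. 0) then \<forall>\<sigma>. g \<sigma> - E g = 0 else 0 < l2norm (variation g))"
      if lf: "local_function g" for g
    proof -
      obtain J where J: "finite J" and loc': "\<forall>\<sigma> \<tau>. (\<forall>x\<in>J. \<sigma> x = \<tau> x) \<longrightarrow> g \<sigma> = g \<tau>"
        using lf unfolding local_function_def by blast
      have loc: "g \<sigma> = g \<tau>" if "\<And>x. x \<in> J \<Longrightarrow> \<sigma> x = \<tau> x" for \<sigma> \<tau> using loc' that by blast
      have "g \<in> borel_measurable P"
        using borel_measurable_continuous_onI[OF local_continuous_bounded(1)[of J g, OF J loc]]
          measurable_cong_sets[OF sets_P refl] by blast
      then have 1: "random_variable borel (\<lambda>\<sigma>. g \<sigma> - E g)" by simp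
      obtain B where B: "\<And>\<sigma>. \<bar>g \<sigma>\<bar> \<le> B"
        using local_continuous_bounded(2)[of J g, OF J loc] by (auto simp: bounded_iff)
      have "\<bar>g \<sigma> - E g\<bar> \<le> B + \<bar>E g\<bar>" for \<sigma> using B[of \<sigma>] by linarith
      then have 2: "\<exists>B. \<forall>\<sigma>. \<bar>g \<sigma> - E g\<bar> \<le> B" by blast
      have 3: "E (\<lambda>\<sigma>. (g \<sigma> - E g) ^ (2 * p)) \<le> (Q * real p ^ ?\<kappa> * l2norm (variation g)) ^ (2 * p)" for p
      proof (cases "p = 0")
        case True
        then show ?thesis by (simp add: E_def prob_space)
      next
        case False
        then have p: "1 \<le> p" by simp
        show ?thesis
          unfolding E_def P_def by (rule plus_phase_moments[OF \<beta>0 p J loc bound[OF \<beta>0 \<beta>_large p]])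
      qed
      have 4: "g \<sigma> - E g = 0" if v: "variation g = (\<lambda>_. 0)" for \<sigma>
      proof -
        have g: "g = (\<lambda>_. g (minus_config {}))"
          by (rule ext) (rule constant_of_variation_eq_0[of J g, OF J loc v])
        have "E g = E (\<lambda>_. g (minus_config {}))" by (rule arg_cong[OF g])
        also have "\<dots> = g (minus_config {})" by (simp add: E_def prob_space)
        finally show ?thesis using fun_cong[OF g, of \<sigma>] by simp
      qed
      have 5: "0 < l2norm (variation g)" if "variation g \<noteq> (\<lambda>_. 0)"
        by (rule l2norm_pos[of J g, OF J loc that])
      have 6: "0 \<le> l2norm (variation g)" by (rule l2norm_nonneg[of J g, OF J loc])
      show ?thesis using 1 2 3 4 5 6 by simp
    qed
    have part1: "\<exists>C::real. 0 < C \<and>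
        (\<forall>g. local_function g \<longrightarrow>
          E (\<lambda>\<sigma>. (g \<sigma> - E g) ^ (2 * p)) \<le> C * l2norm (variation g) ^ (2 * p) \<and>
          (\<forall>t>0. measure P {\<sigma>. \<bar>g \<sigma> - E g\<bar> > t}
             \<le> C * (l2norm (variation g) ^ (2 * p) / t ^ (2 * p))))" for p :: nat
    \<comment> \<open>For \<open>p = 0\<close> this constant is a zeroth power, hence
      \<open>1\<close> and positive.\<close>
    proof (intro exI[of _ "(Q * real p ^ ?\<kappa>) ^ (2 * p)"] conjI allI impI)
      show "0 < (Q * real p ^ ?\<kappa>) ^ (2 * p)" using Q by (cases "p = 0") auto
      fix g :: "'d config \<Rightarrow> real" assume g: "local_function g"
      let ?Z = "\<lambda>\<sigma>. g \<sigma> - E g" and ?N = "l2norm (variation g)"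
      obtain B where B: "\<And>\<sigma>. \<bar>?Z \<sigma>\<bar> \<le> B" using facts[OF g] by blast
      have rv: "random_variable borel ?Z" using facts[OF g] by blast
      show m: "E (\<lambda>\<sigma>. ?Z \<sigma> ^ (2 * p)) \<le> (Q * real p ^ ?\<kappa>) ^ (2 * p) * ?N ^ (2 * p)"
        using facts[OF g] by (simp only: power_mult_distrib)
      fix t :: real assume t: "0 < t"
      let ?A = "{\<sigma>. \<bar>?Z \<sigma>\<bar> > t}"
      have "{\<sigma> \<in> space P. \<bar>?Z \<sigma>\<bar> > t} \<in> events" using rv by measurable
      then have A: "?A \<in> events" by (simp add: space_P)
      have int: "integrable P (\<lambda>\<sigma>. ?Z \<sigma> ^ (2 * p))"
      proof (rule integrable_const_bound)
        show "AE \<sigma> in P. norm (?Z \<sigma> ^ (2 * p)) \<le> B ^ (2 * p)"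
          unfolding real_norm_def power_abs by (intro AE_I2 power_mono B abs_ge_zero)
      qed (use rv in measurable)
      have "t ^ (2 * p) * measure P ?A = (\<integral>\<sigma>. t ^ (2 * p) * indicator ?A \<sigma> \<partial>P)"
        using A by simp
      also have "\<dots> \<le> (\<integral>\<sigma>. ?Z \<sigma> ^ (2 * p) \<partial>P)"
      proof (rule integral_mono[OF _ int])
        fix \<sigma>
        have "t ^ (2 * p) \<le> \<bar>?Z \<sigma>\<bar> ^ (2 * p)" if "t < \<bar>?Z \<sigma>\<bar>"
          using that t by (intro power_mono) auto
        then show "t ^ (2 * p) * indicator ?A \<sigma> \<le> ?Z \<sigma> ^ (2 * p)"
          by (auto simp: indicator_def power_even_abs)
      qed (use A in \<open>simp add: emeasure_eq_measure\<close>)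
      also have "\<dots> \<le> (Q * real p ^ ?\<kappa>) ^ (2 * p) * ?N ^ (2 * p)" using m by (simp only: E_def)
      finally show "measure P ?A \<le> (Q * real p ^ ?\<kappa>) ^ (2 * p) * (?N ^ (2 * p) / t ^ (2 * p))"
        using t by (simp add: field_simps)
    qed
    have exp_moment: "(\<integral>\<^sup>+\<sigma>. ennreal (exp (\<bar>(g \<sigma> - E g) / (Q * (3 / \<epsilon>) powr (1 / \<rho>) * l2norm (variation g))\<bar> powr \<rho>) - 1) \<partial>P)
        \<le> ennreal (4 * \<epsilon>)"
      if g: "local_function g" "variation g \<noteq> (\<lambda>_. 0)" and \<rho>: "0 < \<rho>" "\<rho> < 1 / real ?\<kappa>" and \<epsilon>: "0 < \<epsilon>" "\<epsilon> \<le> 1/2"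
      for g \<rho> \<epsilon>
    proof -
      obtain B where B: "\<And>\<sigma>. \<bar>g \<sigma> - E g\<bar> \<le> B" using facts[OF g(1)] by blast
      have "real ?\<kappa> * \<rho> \<le> real ?\<kappa> * (1 / real ?\<kappa>)" using \<rho>(2) by (intro mult_left_mono) auto
      then have \<kappa>: "real ?\<kappa> * \<rho> \<le> 1" by simp
      have "1 / real ?\<kappa> \<le> 1" by simp
      then have \<rho>1: "\<rho> < 1" using \<rho>(2) by linarith
      show ?thesis
      proof (rule exp_powr_moment[OF _ B _ Q _ \<rho>(1) \<rho>1 \<kappa> \<epsilon>])
        show "random_variable borel (\<lambda>\<sigma>. g \<sigma> - E g)" using facts[OF g(1)] by blast
        show "0 < l2norm (variation g)" using facts[OF g(1)] g(2) by simp
        show "expectation (\<lambda>\<sigma>. (g \<sigma> - E g) ^ (2 * p)) \<le> (Q * real p ^ ?\<kappa> * l2norm (variation g)) ^ (2 * p)" for p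
          using facts[OF g(1)] unfolding E_def by blast
      qed
    qed
    have part2: "(\<exists>K::real. 0 < K \<and>
            (\<forall>g. local_function g \<longrightarrow>
              luxembourg_norm P \<rho> (\<lambda>\<sigma>. g \<sigma> - E g) \<le> ennreal (K * l2norm (variation g)))) \<and>
          (\<exists>c::real. 0 < c \<and>
            (\<forall>g. local_function g \<longrightarrow>
              (\<forall>t>0. measure P {\<sigma>. \<bar>g \<sigma> - E g\<bar> > t}
                 \<le> 4 * (if variation g = (\<lambda>_. 0) then 0
                         else exp (- c * (t powr \<rho> / l2norm (variation g) powr \<rho>))))))"
      if \<rho>: "0 < \<rho>" "\<rho> < 1 / real ?\<kappa>" for \<rho>
    proof
      have "1 / real ?\<kappa> \<le> 1" by simp
      then have \<rho>1: "\<rho> < 1" using \<rho>(2) by linarith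
      \<comment> \<open>The first bound is for the geometric series, the second brings the
        exponential moment \<open>4 * \<epsilon>\<close> below what the Luxembourg norm
        requires.\<close>
      define \<epsilon> where "\<epsilon> = min (1/2) (exp (- (h_const \<rho> powr \<rho>)) / 4)"
      have \<epsilon>: "0 < \<epsilon>" "\<epsilon> \<le> 1/2" "4 * \<epsilon> \<le> exp (- (h_const \<rho> powr \<rho>))"
        unfolding \<epsilon>_def by auto
      let ?K = "Q * (3 / \<epsilon>) powr (1 / \<rho>)"
      have K: "0 < ?K" using Q \<epsilon> by simp
      have "luxembourg_norm P \<rho> (\<lambda>\<sigma>. g \<sigma> - E g) \<le> ennreal (?K * l2norm (variation g))"
        if g: "local_function g" for g
      proof (cases "variation g = (\<lambda>_. 0)")
        case True
        then have "(\<lambda>\<sigma>. g \<sigma> - E g) = (\<lambda>_. 0)" using facts[OF g] by simp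
        then show ?thesis using luxembourg_norm_zero[OF \<rho>(1), of P] by simp
      next
        case False
        show ?thesis
        proof (rule luxembourg_norm_le[OF _ \<rho>(1) \<rho>1])
          show "0 < ?K * l2norm (variation g)" using K facts[OF g] False by simp
          show "(\<integral>\<^sup>+\<sigma>. ennreal (exp (\<bar>(g \<sigma> - E g) / (?K * l2norm (variation g))\<bar> powr \<rho>) - 1) \<partial>P)
              \<le> ennreal (exp (- (h_const \<rho> powr \<rho>)))"
            using exp_moment[OF g False \<rho> \<epsilon>(1,2)] ennreal_leI[OF \<epsilon>(3)] by (rule order_trans)
          show "random_variable borel (\<lambda>\<sigma>. g \<sigma> - E g)" using facts[OF g] by blast
        qed
      qed
      then show "\<exists>K::real. 0 < K \<and> (\<forall>g. local_function g \<longrightarrow>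
          luxembourg_norm P \<rho> (\<lambda>\<sigma>. g \<sigma> - E g) \<le> ennreal (K * l2norm (variation g)))"
        using K by (intro exI[of _ ?K] conjI) auto
      \<comment> \<open>The scale for \<open>\<epsilon> = 1/2\<close>, where the exponential moment
        is at most \<open>2\<close>, as the tail bound with prefactor \<open>4\<close>
        demands.\<close>
      let ?L = "Q * (3 / (1/2)) powr (1 / \<rho>)"
      have L: "0 < ?L" using Q by simp
      have "measure P {\<sigma>. \<bar>g \<sigma> - E g\<bar> > t} \<le> 4 * (if variation g = (\<lambda>_. 0) then 0
          else exp (- (1 / ?L powr \<rho>) * (t powr \<rho> / l2norm (variation g) powr \<rho>)))"
        if g: "local_function g" and t: "0 < t" for g t
      proof (cases "variation g = (\<lambda>_. 0)")
        case True
        then have "{\<sigma>. \<bar>g \<sigma> - E g\<bar> > t} = {}" using facts[OF g] t by simp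
        then show ?thesis using True by simp
      next
        case False
        let ?N = "l2norm (variation g)"
        have N: "0 < ?N" using facts[OF g] False by simp
        have "prob {\<sigma> \<in> space P. t < \<bar>g \<sigma> - E g\<bar>} \<le> 4 * exp (- ((t / (?L * ?N)) powr \<rho>))"
        proof (rule tail_le_of_exp_powr_moment[OF _ _ \<rho>(1) t])
          show "random_variable borel (\<lambda>\<sigma>. g \<sigma> - E g)" using facts[OF g] by blast
          show "0 < ?L * ?N" using L N by simp
          show "(\<integral>\<^sup>+\<sigma>. ennreal (exp (\<bar>(g \<sigma> - E g) / (?L * ?N)\<bar> powr \<rho>) - 1) \<partial>P) \<le> ennreal 2"
            using exp_moment[OF g False \<rho>, of "1/2"] by simp
        qed
        also have "(t / (?L * ?N)) powr \<rho> = (1 / ?L powr \<rho>) * (t powr \<rho> / ?N powr \<rho>)"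
          using t L N by (simp only: powr_divide powr_mult) simp
        finally show ?thesis using False by (simp add: space_P)
      qed
      then show "\<exists>c::real. 0 < c \<and> (\<forall>g. local_function g \<longrightarrow>
              (\<forall>t>0. measure P {\<sigma>. \<bar>g \<sigma> - E g\<bar> > t}
                 \<le> 4 * (if variation g = (\<lambda>_. 0) then 0
                         else exp (- c * (t powr \<rho> / l2norm (variation g) powr \<rho>)))))"
        using L by (intro exI[of _ "1 / ?L powr \<rho>"] conjI) auto
    qed
    \<comment> \<open>The threshold for \<rho> is \<open>1 / (2 * d + 1)\<close>, the same for every
      \<beta>.\<close>
    have "0 < 1 / real ?\<kappa>" "1 / real ?\<kappa> < 1" by simp_all
    then show ?thesis using part1 part2 by blast
  qed
  show ?thesis
    unfolding Let_def using crit main[OF _ refl refl] by blast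
qed

end
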